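(* Let $d>6$, $L\geq 1$. Suppose there exists $A>0$ such that $\tau_{p_c}(x)\sim A\langle x\rangle^{2-d}$ as $x\to\infty$. Then, as $p\uparrow p_c$, $\square(p)=\Theta(\psi_d(\chi(p)))$.
   Context: $d,L$ are integers. Consider the graph on $\mathbb{Z}^d$ with edge set $\mathcal{E}=\{\{x,y\}:0<\|x-y\|_1\leq L\}$. In Bernoulli bond percolation at parameter $p$, each edge of $\mathcal{E}$ is independently open with probability $p$; the law is $\mathbb{P}_p$. $x\leftrightarrow y$ means $x,y$ are joined by a path of open edges. $\tau_p(x)=\mathbb{P}_p(0\leftrightarrow x)$, $\chi(p)=\sum_{x\in\mathbb{Z}^d}\tau_p(x)$, $p_c$ is the critical probability, $\langle x\rangle=\max(1,\|x\|_2)$, and $\square(p)=\max_{x\in\mathbb{Z}^d}(\tau_p\ast\tau_p\ast\tau_p\ast\tau_p)(x)$, where $\ast$ is convolution on $\mathbb{Z}^d$. For $t>0$, $\psi_d(t)=t^{(8-d)/2}$ if $d<8$, $\psi_d(t)=\log t$ if $d=8$, $\psi_d(t)=1$ if $d>8$. *)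

theory Defs
  imports "HOL-Probability.Probability" "HOL-Library.Landau_Symbols"
begin

text \<open>
  The lattice is the type \<^typ>\<open>int ^ 'd\<close>, so the dimension is \<^term>\<open>CARD('d)\<close>. Quantities whose
  type does not mention \<^typ>\<open>'d\<close> take an argument of type \<^typ>\<open>'d itself\<close>.
\<close>

definition l1_norm :: "int ^ 'd::finite \<Rightarrow> int"
  where "l1_norm x = (\<Sum>i\<in>UNIV. \<bar>x $ i\<bar>)"

definition l2_norm :: "int ^ 'd::finite \<Rightarrow> real"
  where "l2_norm x = norm (\<chi> i. real_of_int (x $ i))"

definition bracket :: "int ^ 'd::finite \<Rightarrow> real"
  where "bracket x = max 1 (l2_norm x)"

definition edges :: "int \<Rightarrow> (int ^ 'd::finite) set set"
  where "edges L = {{x, y} | x y. 0 < l1_norm (x - y) \<and> l1_norm (x - y) \<le> L}"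

text \<open>A configuration maps each edge to \<^const>\<open>True\<close> if it is open and to \<^const>\<open>False\<close> otherwise.\<close>

definition perc :: "int \<Rightarrow> real \<Rightarrow> ((int ^ 'd::finite) set \<Rightarrow> bool) measure"
  where "perc L p = PiM (edges L) (\<lambda>_. measure_pmf (bernoulli_pmf p))"

definition open_adj ::
    "int \<Rightarrow> ((int ^ 'd::finite) set \<Rightarrow> bool) \<Rightarrow> int ^ 'd \<Rightarrow> int ^ 'd \<Rightarrow> bool"
  where "open_adj L \<omega> x y \<longleftrightarrow> {x, y} \<in> edges L \<and> \<omega> {x, y}"

definition connected_by_open ::
    "int \<Rightarrow> ((int ^ 'd::finite) set \<Rightarrow> bool) \<Rightarrow> int ^ 'd \<Rightarrow> int ^ 'd \<Rightarrow> bool"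
  where "connected_by_open L \<omega> = (open_adj L \<omega>)\<^sup>*\<^sup>*"

definition tau :: "int \<Rightarrow> real \<Rightarrow> int ^ 'd::finite \<Rightarrow> real"
  where "tau L p x = measure (perc L p) {\<omega> \<in> space (perc L p). connected_by_open L \<omega> 0 x}"

definition theta :: "'d::finite itself \<Rightarrow> int \<Rightarrow> real \<Rightarrow> real"
  where "theta _ L p =
    measure (perc L p) {\<omega> \<in> space (perc L p). infinite {x :: int ^ 'd. connected_by_open L \<omega> 0 x}}"

definition p_crit :: "'d::finite itself \<Rightarrow> int \<Rightarrow> real"
  where "p_crit D L = Inf {p \<in> {0..1}. theta D L p > 0}"

text \<open>
  Infinite sums are taken in \<^typ>\<open>ennreal\<close>, where they always exist; \<^term>\<open>\<infinity>\<close> is a possible value.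
  For \<open>p\<close> below \<open>p_crit\<close> the sum \<open>chi\<close> is finite (sharpness of the phase transition), and so is
  \<open>square_diagram\<close>, so \<^const>\<open>enn2real\<close> loses nothing there.
\<close>

definition chi :: "'d::finite itself \<Rightarrow> int \<Rightarrow> real \<Rightarrow> ennreal"
  where "chi _ L p = (\<Sum>\<^sub>\<infinity>x :: int ^ 'd. ennreal (tau L p x))"

definition conv ::
    "(int ^ 'd::finite \<Rightarrow> ennreal) \<Rightarrow> (int ^ 'd \<Rightarrow> ennreal) \<Rightarrow> int ^ 'd \<Rightarrow> ennreal"
    (infixl "\<circledast>" 70)
  where "(f \<circledast> g) x = (\<Sum>\<^sub>\<infinity>y. f y * g (x - y))"

text \<open>
  The greatest element below exists for every \<open>p\<close>: by the Cauchy--Schwarz inequality and the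
  symmetry of \<^const>\<open>tau\<close>, the fourfold convolution is largest at the origin.
\<close>

definition square_diagram :: "'d::finite itself \<Rightarrow> int \<Rightarrow> real \<Rightarrow> ennreal"
  where "square_diagram _ L p =
    (let t = (\<lambda>x :: int ^ 'd. ennreal (tau L p x))
     in GREATEST v. v \<in> range (t \<circledast> t \<circledast> t \<circledast> t))"

definition psi :: "nat \<Rightarrow> real \<Rightarrow> real"
  where "psi d t = (if d < 8 then t powr ((8 - real d) / 2) else if d = 8 then ln t else 1)"

end

theory Submission imports Defs
begin

text \<open>
  Write \<open>d\<close> for the dimension, \<open>\<chi>\<close> for the susceptibility at a parameter \<open>p\<close> slightly below the critical
  one, and \<open>B = \<tau> * \<tau>\<close> for the bubble. Since \<open>\<tau>\<close> is even, the fourfold convolution of \<open>\<tau>\<close> is largest at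
  the origin, where it is the sum of the \<open>B(x)\<^sup>2\<close> (\<open>square_diagram_eq\<close>). So everything depends on the size
  of \<open>B\<close>, and the correct picture is that \<open>B(x)\<close> has order \<open>|x|\<close> to the power \<open>4 - d\<close> up to distances of
  order \<open>\<surd>\<chi>\<close>, and that larger distances do not contribute more. Summing \<open>|x|\<close> to the power \<open>8 - 2 d\<close>
  over \<open>|x| \<le> \<surd>\<chi>\<close> gives \<open>\<surd>\<chi>\<close>, \<open>ln \<chi>\<close> or a constant when \<open>d\<close> is \<open>7\<close>, \<open>8\<close> or larger.

  The upper bound is soft. Monotonicity in \<open>p\<close> and the assumption on the critical two-point function bound
  \<open>B(x)\<close> by a multiple of \<open>|x|\<close> to the power \<open>4 - d\<close>, and the total mass of \<open>B\<close> is \<open>\<chi>\<^sup>2\<close>. Using the first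
  bound twice inside the ball of radius \<open>\<surd>\<chi>\<close>, and once, together with the mass, outside of it, gives the
  claim (\<open>square_upper\<close>).

  For the lower bound, Russo's formula and the BK inequality bound the derivative of \<open>\<tau>(x)\<close> by a sum of values
  of \<open>B\<close> near \<open>x\<close> (\<open>tau_decrement\<close>). Hence \<open>\<tau>\<close> differs from the critical two-point function by at most
  \<open>p\<^sub>c - p\<close> times a multiple of \<open>|x|\<close> to the power \<open>4 - d\<close>, and so keeps its critical order \<open>|x|\<close> to the
  power \<open>2 - d\<close> as long as \<open>|x|\<^sup>2\<close> is a small multiple of \<open>1 / (p\<^sub>c - p)\<close> (\<open>tau_lower_near_pc\<close>). This is
  the range \<open>|x| \<le> \<surd>\<chi>\<close>, up to a constant, because of the mean-field bound \<open>\<chi> = O(1 / (p\<^sub>c - p))\<close>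
  (\<open>susc_gap_bound\<close>).

  The mean-field bound is the theorem of Aizenman and Newman. As \<open>d > 6\<close>, the open triangle diagram
  \<open>\<nabla>(w) = (\<tau> * \<tau> * \<tau>)(w)\<close> at the critical point tends to \<open>0\<close> as \<open>w\<close> grows. When \<open>\<nabla>(w)\<close> is
  small, the cluster of the origin, seen from one of its vertices \<open>u\<close>, often avoids the cluster of \<open>u + w\<close>,
  and opening the edges of a fixed path from \<open>u\<close> to \<open>u + w\<close> one by one makes one of them pivotal.
  In place of a differential inequality this is used through finite increments:
  \<open>\<chi>(q) - \<chi>(p) \<ge> c (q - p) (\<chi>(p)\<^sup>2 - \<nabla>(w) \<chi>(q)\<^sup>2)\<close> for \<open>p < q < p\<^sub>c\<close> (\<open>susc_increment\<close>). Therefore \<open>\<chi>\<close> at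
  least doubles when \<open>p\<close> grows by a constant over \<open>\<chi>(p)\<close>. The lengths of the successive steps are dominated by
  a geometric series, so \<open>\<chi>\<close> would become infinite strictly below \<open>p\<^sub>c\<close> if \<open>(p\<^sub>c - p) \<chi>(p)\<close> were large.
  That it is finite there is the sharpness of the phase transition, for which the argument of Duminil-Copin and
  Tassion is followed (\<open>subcritical_susceptibility_finite\<close>).

  All inequalities of percolation theory are proved for a finite set of edges, where the measure is a
  finite sum and Russo's formula and the BK inequality follow by induction on the set of edges. The two-point
  function is the limit of its finite-volume versions (\<open>ftau_tendsto_tau\<close>).
\<close>

section \<open>Bernoulli measures on finite sets of edges\<close>

text \<open>
  The expectation of \<open>f\<close> when every element of the finite set \<open>F\<close> belongs to the random set \<open>\<eta>\<close>
  independently with probability \<open>p\<close>. As a finite sum it is a polynomial in \<open>p\<close>, and it makes sense for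
  every real \<open>p\<close>, so derivatives cause no trouble at \<open>0\<close> and \<open>1\<close>.
\<close>
definition bexp :: "real \<Rightarrow> 'e set \<Rightarrow> ('e set \<Rightarrow> real) \<Rightarrow> real"
  where "bexp p F f = (\<Sum>\<eta>\<in>Pow F. (\<Prod>e\<in>F. if e \<in> \<eta> then p else 1 - p) * f \<eta>)"

definition bprob :: "real \<Rightarrow> 'e set \<Rightarrow> ('e set \<Rightarrow> bool) \<Rightarrow> real"
  where "bprob p F A = bexp p F (\<lambda>\<eta>. of_bool (A \<eta>))"

lemma bexp_empty [simp]: "bexp p {} f = f {}"
  by (simp add: bexp_def)

text \<open>
  Conditioning on a single edge. The facts about finite volume are mostly inductions on the set of edges that use
  this equation.
\<close>
lemma bexp_insert:
  assumes "finite F" "e \<notin> F"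
  shows "bexp p (insert e F) f = p * bexp p F (\<lambda>\<eta>. f (insert e \<eta>)) + (1 - p) * bexp p F f"
proof -
  let ?w = "\<lambda>\<eta>. \<Prod>e\<in>F. if e \<in> \<eta> then p else 1 - p"
  have disj: "Pow F \<inter> insert e ` Pow F = {}" using assms by auto
  have inj: "inj_on (insert e) (Pow F)"
    using assms by (intro inj_onI) (metis PowD insert_ident subsetD)
  have w1: "(\<Prod>e'\<in>insert e F. if e' \<in> insert e \<eta> then p else 1 - p) = p * ?w \<eta>" for \<eta>
  proof -
    have "(\<Prod>e'\<in>F. if e' \<in> insert e \<eta> then p else 1 - p) = ?w \<eta>"
      using assms by (intro prod.cong) auto
    then show ?thesis using assms by simp
  qed
  have w0: "(\<Prod>e'\<in>insert e F. if e' \<in> \<eta> then p else 1 - p) = (1 - p) * ?w \<eta>" if "\<eta> \<subseteq> F" for \<eta>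
    using assms that by (subst prod.insert) auto
  have "bexp p (insert e F) f = (\<Sum>\<eta>\<in>Pow F. (\<Prod>e\<in>insert e F. if e \<in> \<eta> then p else 1 - p) * f \<eta>)
     + (\<Sum>\<eta>\<in>insert e ` Pow F. (\<Prod>e\<in>insert e F. if e \<in> \<eta> then p else 1 - p) * f \<eta>)"
    unfolding bexp_def Pow_insert using assms disj by (subst sum.union_disjoint) auto
  also have "(\<Sum>\<eta>\<in>Pow F. (\<Prod>e\<in>insert e F. if e \<in> \<eta> then p else 1 - p) * f \<eta>)
      = (1 - p) * bexp p F f"
    unfolding bexp_def sum_distrib_left
    by (intro sum.cong refl) (use w0 in \<open>auto simp: mult.assoc\<close>)
  also have "(\<Sum>\<eta>\<in>insert e ` Pow F. (\<Prod>e\<in>insert e F. if e \<in> \<eta> then p else 1 - p) * f \<eta>)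
      = p * bexp p F (\<lambda>\<eta>. f (insert e \<eta>))"
    unfolding bexp_def sum_distrib_left sum.reindex[OF inj] o_def
    by (intro sum.cong refl) (simp only: w1 mult.assoc)
  finally show ?thesis by simp
qed

lemma bexp_cong: "(\<And>\<eta>. \<eta> \<subseteq> F \<Longrightarrow> f \<eta> = g \<eta>) \<Longrightarrow> bexp p F f = bexp p F g"
  by (auto simp: bexp_def intro!: sum.cong)

lemma bexp_add: "bexp p F (\<lambda>\<eta>. f \<eta> + g \<eta>) = bexp p F f + bexp p F g"
  by (simp add: bexp_def algebra_simps sum.distrib)

lemma bexp_diff: "bexp p F (\<lambda>\<eta>. f \<eta> - g \<eta>) = bexp p F f - bexp p F g"
  by (simp add: bexp_def algebra_simps sum_subtractf)

lemma bexp_cmult: "bexp p F (\<lambda>\<eta>. c * f \<eta>) = c * bexp p F f"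
  by (simp add: bexp_def sum_distrib_left mult_ac)

lemma bexp_cmult_right: "bexp p F (\<lambda>\<eta>. f \<eta> * c) = bexp p F f * c"
  using bexp_cmult[of p F c f] by (simp add: mult.commute)

lemma bexp_sum: "bexp p F (\<lambda>\<eta>. \<Sum>i\<in>I. f i \<eta>) = (\<Sum>i\<in>I. bexp p F (f i))"
proof -
  have "bexp p F (\<lambda>\<eta>. \<Sum>i\<in>I. f i \<eta>)
      = (\<Sum>\<eta>\<in>Pow F. \<Sum>i\<in>I. (\<Prod>e\<in>F. if e \<in> \<eta> then p else 1 - p) * f i \<eta>)"
    by (simp add: bexp_def sum_distrib_left)
  also have "\<dots> = (\<Sum>i\<in>I. bexp p F (f i))"
    unfolding bexp_def by (rule sum.swap)
  finally show ?thesis .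
qed

lemma bexp_const: "finite F \<Longrightarrow> bexp p F (\<lambda>_. c) = c"
  by (induction F rule: finite_induct) (auto simp: bexp_insert algebra_simps)

lemma bexp_mono:
  assumes "p \<in> {0..1}" "\<And>\<eta>. \<eta> \<subseteq> F \<Longrightarrow> f \<eta> \<le> g \<eta>"
  shows "bexp p F f \<le> bexp p F g"
  unfolding bexp_def using assms by (intro sum_mono mult_left_mono prod_nonneg) auto

lemma bexp_nonneg:
  assumes "p \<in> {0..1}" "\<And>\<eta>. \<eta> \<subseteq> F \<Longrightarrow> 0 \<le> f \<eta>"
  shows "0 \<le> bexp p F f"
  unfolding bexp_def using assms by (intro sum_nonneg mult_nonneg_nonneg prod_nonneg) auto

lemma bprob_nonneg [simp]: "p \<in> {0..1} \<Longrightarrow> 0 \<le> bprob p F A"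
  unfolding bprob_def by (rule bexp_nonneg) auto

lemma bprob_mono:
  "p \<in> {0..1} \<Longrightarrow> (\<And>\<eta>. \<eta> \<subseteq> F \<Longrightarrow> A \<eta> \<Longrightarrow> B \<eta>) \<Longrightarrow> bprob p F A \<le> bprob p F B"
  unfolding bprob_def by (rule bexp_mono) auto

lemma bprob_cong: "(\<And>\<eta>. \<eta> \<subseteq> F \<Longrightarrow> A \<eta> = B \<eta>) \<Longrightarrow> bprob p F A = bprob p F B"
  unfolding bprob_def by (rule bexp_cong) auto

lemma bprob_True: "finite F \<Longrightarrow> (\<And>\<eta>. \<eta> \<subseteq> F \<Longrightarrow> A \<eta>) \<Longrightarrow> bprob p F A = 1"
  unfolding bprob_def using bexp_const[of F p 1] by (subst bexp_cong[where g = "\<lambda>_. 1"]) auto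

lemma bprob_le_1: "finite F \<Longrightarrow> p \<in> {0..1} \<Longrightarrow> bprob p F A \<le> 1"
  using bprob_mono[of p F A "\<lambda>_. True"] bprob_True[of F "\<lambda>_. True" p] by auto

lemma bprob_union_bound:
  assumes "p \<in> {0..1}" "finite I" "\<And>\<eta>. \<eta> \<subseteq> F \<Longrightarrow> A \<eta> \<Longrightarrow> \<exists>i\<in>I. B i \<eta>"
  shows "bprob p F A \<le> (\<Sum>i\<in>I. bprob p F (B i))"
proof -
  have "bprob p F A \<le> bexp p F (\<lambda>\<eta>. \<Sum>i\<in>I. of_bool (B i \<eta>))"
    unfolding bprob_def
  proof (rule bexp_mono[OF assms(1)])
    fix \<eta> assume \<eta>: "\<eta> \<subseteq> F"
    show "of_bool (A \<eta>) \<le> (\<Sum>i\<in>I. of_bool (B i \<eta>) :: real)"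
    proof (cases "A \<eta>")
      case True
      then obtain i where "i \<in> I" "B i \<eta>" using assms(3)[OF \<eta>] by auto
      then show ?thesis
        using member_le_sum[of i I "\<lambda>i. of_bool (B i \<eta>) :: real"] assms(2) by auto
    qed (auto intro!: sum_nonneg)
  qed
  then show ?thesis by (simp add: bexp_sum bprob_def)
qed

text \<open>
  Forcing one edge to be open costs at most a factor \<open>1 / p\<close>, since the edge is open with probability \<open>p\<close>
  independently of the rest.
\<close>
lemma bexp_insert_le:
  assumes "finite F" "e \<in> F" "0 < p" "p \<le> 1" "\<And>\<eta>. \<eta> \<subseteq> F \<Longrightarrow> 0 \<le> f \<eta>"
  shows "bexp p F (\<lambda>\<eta>. f (insert e \<eta>)) \<le> bexp p F f / p"
proof -
  define G where "G = F - {e}"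
  have G: "finite G" "e \<notin> G" "F = insert e G" using assms by (auto simp: G_def)
  have "bexp p F f = p * bexp p G (\<lambda>\<eta>. f (insert e \<eta>)) + (1 - p) * bexp p G f"
    using bexp_insert[OF G(1,2), of p f] G(3) by simp
  moreover have "0 \<le> (1 - p) * bexp p G f"
    using assms G(3) by (intro mult_nonneg_nonneg bexp_nonneg) auto
  moreover have "bexp p F (\<lambda>\<eta>. f (insert e \<eta>)) = bexp p G (\<lambda>\<eta>. f (insert e \<eta>))"
    unfolding G(3) using bexp_insert[OF G(1,2), of p "\<lambda>\<eta>. f (insert e \<eta>)"]
    by (simp add: algebra_simps)
  ultimately show ?thesis using assms by (simp add: field_simps)
qed

text \<open>
  Independence of the edges inside and outside of \<open>D\<close>. Formulating it for functions of \<open>\<eta> \<inter> D\<close> and \<open>\<eta> - D\<close>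
  makes the induction immediate: conditioning on one edge changes only one of the two functions.
\<close>
lemma bexp_indep:
  assumes "finite F"
  shows "bexp p F (\<lambda>\<eta>. f (\<eta> \<inter> D) * g (\<eta> - D))
    = bexp p F (\<lambda>\<eta>. f (\<eta> \<inter> D)) * bexp p F (\<lambda>\<eta>. g (\<eta> - D))"
  using assms
proof (induction F arbitrary: f g rule: finite_induct)
  case (insert e F)
  show ?case
  proof (cases "e \<in> D")
    case True
    then have s: "insert e \<eta> \<inter> D = insert e (\<eta> \<inter> D)" "insert e \<eta> - D = \<eta> - D" for \<eta> by auto
    show ?thesis
      using insert.IH[of "\<lambda>\<eta>. f (insert e \<eta>)" g] insert.IH[of f g] insert.hyps
      by (simp add: bexp_insert s algebra_simps)
  next
    case False
    then have s: "insert e \<eta> \<inter> D = \<eta> \<inter> D" "insert e \<eta> - D = insert e (\<eta> - D)" for \<eta> by auto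
    show ?thesis
      using insert.IH[of f "\<lambda>\<eta>. g (insert e \<eta>)"] insert.IH[of f g] insert.hyps
      by (simp add: bexp_insert s algebra_simps)
  qed
qed auto

lemma bexp_restrict:
  assumes "finite F"
  shows "bexp p F (\<lambda>\<eta>. f (\<eta> \<inter> D)) = bexp p (F \<inter> D) f"
  using assms
proof (induction F arbitrary: f rule: finite_induct)
  case (insert e F)
  then show ?case
    using insert.IH[of "\<lambda>\<eta>. f (insert e \<eta>)"] insert.IH[of f]
    by (cases "e \<in> D") (auto simp: bexp_insert algebra_simps)
qed auto

lemma bexp_image:
  assumes "finite F" "inj_on h F"
  shows "bexp p (h ` F) f = bexp p F (\<lambda>\<eta>. f (h ` \<eta>))"
  using assms
proof (induction F arbitrary: f rule: finite_induct)
  case (insert e F)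
  then show ?case by (simp add: bexp_insert)
qed auto

section \<open>Increasing events, Russo's formula and the BK inequality\<close>
definition increasing_event :: "('e set \<Rightarrow> bool) \<Rightarrow> bool"
  where "increasing_event A \<longleftrightarrow> (\<forall>\<eta> \<zeta>. \<eta> \<subseteq> \<zeta> \<longrightarrow> A \<eta> \<longrightarrow> A \<zeta>)"

lemma increasingI: "(\<And>\<eta> \<zeta>. \<eta> \<subseteq> \<zeta> \<Longrightarrow> A \<eta> \<Longrightarrow> A \<zeta>) \<Longrightarrow> increasing_event A"
  by (auto simp: increasing_event_def)

lemma increasingD: "increasing_event A \<Longrightarrow> A \<eta> \<Longrightarrow> \<eta> \<subseteq> \<zeta> \<Longrightarrow> A \<zeta>"
  by (auto simp: increasing_event_def)

lemma increasing_insert: "increasing_event A \<Longrightarrow> increasing_event (\<lambda>\<eta>. A (insert e \<eta>))"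
  by (intro increasingI) (erule (1) increasingD, blast)

lemma bprob_mono_edges:
  assumes "finite G" "F \<subseteq> G" "increasing_event A" "p \<in> {0..1}"
  shows "bprob p F A \<le> bprob p G A"
proof -
  have "bprob p F A = bprob p G (\<lambda>\<eta>. A (\<eta> \<inter> F))"
    using bexp_restrict[OF assms(1), of p "\<lambda>\<eta>. of_bool (A \<eta>)" F] assms(2)
    by (simp add: bprob_def Int_absorb1)
  also have "\<dots> \<le> bprob p G A"
    using assms by (intro bprob_mono) (auto elim: increasingD)
  finally show ?thesis .
qed

definition pivot :: "('e set \<Rightarrow> bool) \<Rightarrow> 'e \<Rightarrow> 'e set \<Rightarrow> bool"
  where "pivot A e \<eta> \<longleftrightarrow> A (insert e \<eta>) \<and> \<not> A (\<eta> - {e})"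

text \<open>
  Differentiating the recursion \<open>bexp_insert\<close>: the new edge contributes the difference between open and
  closed, and the remaining edges are covered by the induction hypothesis in both cases.
\<close>
lemma russo_expect:
  assumes "finite F"
  shows "((\<lambda>p. bexp p F f) has_field_derivative
    (\<Sum>e\<in>F. bexp p F (\<lambda>\<eta>. f (insert e \<eta>) - f (\<eta> - {e})))) (at p)"
  using assms
proof (induction F arbitrary: f rule: finite_induct)
  case (insert a F)
  let ?g = "\<lambda>\<eta>. f (insert a \<eta>)"
  let ?D = "\<lambda>f. \<Sum>e\<in>F. bexp p F (\<lambda>\<eta>. f (insert e \<eta>) - f (\<eta> - {e}))"
  have a: "bexp p (insert a F) (\<lambda>\<eta>. f (insert a \<eta>) - f (\<eta> - {a})) = bexp p F ?g - bexp p F f"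
  proof -
    have "bexp p F (\<lambda>\<eta>. f (insert a \<eta>) - f (\<eta> - {a})) = bexp p F (\<lambda>\<eta>. f (insert a \<eta>) - f \<eta>)"
      using insert.hyps by (intro bexp_cong arg_cong2[where f = "(-)"] arg_cong[where f = f]) auto
    moreover have "bexp p F (\<lambda>\<eta>. f (insert a \<eta>) - f (insert a \<eta> - {a}))
        = bexp p F (\<lambda>\<eta>. f (insert a \<eta>) - f \<eta>)"
      using insert.hyps by (intro bexp_cong arg_cong2[where f = "(-)"] arg_cong[where f = f]) auto
    ultimately show ?thesis
      using insert.hyps by (simp add: bexp_insert bexp_diff algebra_simps)
  qed
  have b: "bexp p (insert a F) (\<lambda>\<eta>. f (insert e \<eta>) - f (\<eta> - {e}))
      = p * bexp p F (\<lambda>\<eta>. ?g (insert e \<eta>) - ?g (\<eta> - {e}))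
        + (1 - p) * bexp p F (\<lambda>\<eta>. f (insert e \<eta>) - f (\<eta> - {e}))" if "e \<in> F" for e
  proof -
    have "e \<noteq> a" using that insert.hyps by auto
    then have "insert a \<eta> - {e} = insert a (\<eta> - {e})" for \<eta> by auto
    then show ?thesis using insert.hyps by (simp add: bexp_insert insert_commute)
  qed
  have "((\<lambda>p. p * bexp p F ?g + (1 - p) * bexp p F f) has_field_derivative
      (bexp p F ?g + p * ?D ?g - bexp p F f + (1 - p) * ?D f)) (at p)"
    by (rule derivative_eq_intros insert.IH refl | simp)+
  moreover have "bexp p F ?g + p * ?D ?g - bexp p F f + (1 - p) * ?D f
    = (\<Sum>e\<in>insert a F. bexp p (insert a F) (\<lambda>\<eta>. f (insert e \<eta>) - f (\<eta> - {e})))"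
    using insert.hyps by (simp add: a b sum.distrib sum_distrib_left)
  ultimately show ?case
    using insert.hyps by (simp add: bexp_insert)
qed auto

lemma russo:
  assumes "finite F" "increasing_event A"
  shows "((\<lambda>p. bprob p F A) has_field_derivative (\<Sum>e\<in>F. bprob p F (pivot A e))) (at p)"
proof -
  have "of_bool (A (insert e \<eta>)) - of_bool (A (\<eta> - {e})) = (of_bool (pivot A e \<eta>) :: real)" for e \<eta>
    using increasingD[OF assms(2), of "\<eta> - {e}" "insert e \<eta>"] by (auto simp: pivot_def)
  then show ?thesis
    using russo_expect[OF assms(1), of "\<lambda>\<eta>. of_bool (A \<eta>)" p] by (simp add: bprob_def)
qed

lemma bprob_mono_p:
  assumes "finite F" "increasing_event A" "0 \<le> p" "p \<le> q" "q \<le> 1"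
  shows "bprob p F A \<le> bprob q F A"
proof (rule DERIV_nonneg_imp_nondecreasing[OF assms(4)])
  fix r assume "p \<le> r" "r \<le> q"
  then have "r \<in> {0..1}" using assms by auto
  then show "\<exists>y. ((\<lambda>p. bprob p F A) has_real_derivative y) (at r) \<and> 0 \<le> y"
    using russo[OF assms(1,2), of r] by (intro exI conjI) (auto intro!: sum_nonneg)
qed

text \<open>
  For increasing events, to which alone it is applied, this is the disjoint occurrence of van den Berg and
  Kesten: \<open>\<alpha>\<close> and \<open>\<beta>\<close> are witnesses of the two events.
\<close>
definition disj_occ :: "('e set \<Rightarrow> bool) \<Rightarrow> ('e set \<Rightarrow> bool) \<Rightarrow> 'e set \<Rightarrow> bool" (infixr "\<box>" 65)
  where "(A \<box> B) \<eta> \<longleftrightarrow> (\<exists>\<alpha> \<beta>. \<alpha> \<subseteq> \<eta> \<and> \<beta> \<subseteq> \<eta> \<and> \<alpha> \<inter> \<beta> = {} \<and> A \<alpha> \<and> B \<beta>)"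

lemma increasing_disj_occ: "increasing_event (A \<box> B)"
  unfolding disj_occ_def by (rule increasingI) (meson subset_trans)

lemma disj_occ_mono:
  "(A \<box> B) \<eta> \<Longrightarrow> (\<And>\<alpha>. A \<alpha> \<Longrightarrow> A' \<alpha>) \<Longrightarrow> (\<And>\<beta>. B \<beta> \<Longrightarrow> B' \<beta>) \<Longrightarrow> (A' \<box> B') \<eta>"
  unfolding disj_occ_def by meson

text \<open>
  Induction on the set of edges. Let \<open>A\<^sub>0\<close>, \<open>A\<^sub>1\<close> be \<open>A\<close> with the new edge closed and open, and likewise for
  \<open>B\<close>. Open, the edge can serve only one of the two events, so the section of \<open>A \<box> B\<close> at the open edge lies in
  \<open>(A\<^sub>1 \<box> B\<^sub>0) \<union> (A\<^sub>0 \<box> B\<^sub>1)\<close>, and its section at the closed edge in the intersection of the same two events. Hence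
  the sum of the probabilities of the two sections is at most \<open>P(A\<^sub>1) P(B\<^sub>0) + P(A\<^sub>0) P(B\<^sub>1)\<close>, the mixed terms in
  the expansion of \<open>P(A) P(B)\<close>.
\<close>
theorem bk_inequality:
  assumes "finite F" "p \<in> {0..1}" "increasing_event A" "increasing_event B"
  shows "bprob p F (A \<box> B) \<le> bprob p F A * bprob p F B"
  using assms(1,3,4)
proof (induction F arbitrary: A B rule: finite_induct)
  case empty
  then show ?case by (auto simp: bprob_def disj_occ_def)
next
  case (insert e F)
  let ?A1 = "\<lambda>\<eta>. A (insert e \<eta>)" and ?B1 = "\<lambda>\<eta>. B (insert e \<eta>)"
  let ?P = "bprob p F"
  have inc: "increasing_event ?A1" "increasing_event ?B1"
    using insert.prems by (auto intro: increasing_insert)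
  have A1: "A \<eta> \<Longrightarrow> ?A1 \<eta>" and B1: "B \<eta> \<Longrightarrow> ?B1 \<eta>" for \<eta>
    using increasingD[OF insert.prems(1)] increasingD[OF insert.prems(2)] by blast+
  have split: "bprob p (insert e F) C = p * ?P (\<lambda>\<eta>. C (insert e \<eta>)) + (1 - p) * ?P C" for C
    using insert.hyps by (simp add: bprob_def bexp_insert)
  define c0 c1 where "c0 = ?P (A \<box> B)" and "c1 = ?P (\<lambda>\<eta>. (A \<box> B) (insert e \<eta>))"
  have open_cases: "(?A1 \<box> B) \<eta> \<or> (A \<box> ?B1) \<eta>" and open_both: "(?A1 \<box> ?B1) \<eta>"
    if \<eta>: "\<eta> \<subseteq> F" and occ: "(A \<box> B) (insert e \<eta>)" for \<eta>
  proof -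
    obtain \<alpha> \<beta> where ab: "\<alpha> \<subseteq> insert e \<eta>" "\<beta> \<subseteq> insert e \<eta>" "\<alpha> \<inter> \<beta> = {}" "A \<alpha>" "B \<beta>"
      using occ unfolding disj_occ_def by auto
    have ins: "\<gamma> \<subseteq> insert e (\<gamma> - {e})" for \<gamma> by auto
    have a: "?A1 (\<alpha> - {e})" and b: "?B1 (\<beta> - {e})"
      using increasingD[OF insert.prems(1) ab(4) ins] increasingD[OF insert.prems(2) ab(5) ins] by auto
    show "(?A1 \<box> ?B1) \<eta>"
      unfolding disj_occ_def using a b ab by (intro exI[of _ "\<alpha> - {e}"] exI[of _ "\<beta> - {e}"]) auto
    show "(?A1 \<box> B) \<eta> \<or> (A \<box> ?B1) \<eta>"
    proof (cases "e \<in> \<beta>")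
      case True
      then have "(A \<box> ?B1) \<eta>" unfolding disj_occ_def using b ab
        by (intro exI[of _ \<alpha>] exI[of _ "\<beta> - {e}"]) auto
      then show ?thesis by simp
    next
      case False
      then have "(?A1 \<box> B) \<eta>" unfolding disj_occ_def using a ab
        by (intro exI[of _ "\<alpha> - {e}"] exI[of _ \<beta>]) auto
      then show ?thesis by simp
    qed
  qed
  have c0: "c0 \<le> ?P A * ?P B"
    unfolding c0_def using insert by auto
  have c1: "c1 \<le> ?P ?A1 * ?P ?B1"
  proof -
    have "c1 \<le> ?P (?A1 \<box> ?B1)"
      unfolding c1_def using assms(2) open_both by (intro bprob_mono) auto
    also have "\<dots> \<le> ?P ?A1 * ?P ?B1" using insert.IH[OF inc] .
    finally show ?thesis .
  qed
  have c01: "c0 + c1 \<le> ?P A * ?P ?B1 + ?P ?A1 * ?P B"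
  proof -
    have "c0 + c1 \<le> ?P (A \<box> ?B1) + ?P (?A1 \<box> B)"
      unfolding c0_def c1_def bprob_def bexp_add[symmetric]
    proof (rule bexp_mono[OF assms(2)])
      fix \<eta> assume \<eta>: "\<eta> \<subseteq> F"
      have "(A \<box> B) \<eta> \<Longrightarrow> (A \<box> ?B1) \<eta>" "(A \<box> B) \<eta> \<Longrightarrow> (?A1 \<box> B) \<eta>"
        using A1 B1 by (auto elim: disj_occ_mono)
      with open_cases[OF \<eta>]
      show "of_bool ((A \<box> B) \<eta>) + of_bool ((A \<box> B) (insert e \<eta>))
          \<le> of_bool ((A \<box> ?B1) \<eta>) + (of_bool ((?A1 \<box> B) \<eta>) :: real)"
        by (auto simp: of_bool_def)
    qed
    also have "\<dots> \<le> ?P A * ?P ?B1 + ?P ?A1 * ?P B"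
      using insert.IH[OF insert.prems(1) inc(2)] insert.IH[OF inc(1) insert.prems(2)] by simp
    finally show ?thesis .
  qed
  have "bprob p (insert e F) (A \<box> B) = p * c1 + (1 - p) * c0"
    by (simp add: split c0_def c1_def)
  (* The weights p and 1 - p are split so that the mixed
     terms p (1 - p) multiply the sum c0 + c1, which is what c01 controls. *)
  also have "\<dots> = p\<^sup>2 * c1 + (1 - p)\<^sup>2 * c0 + p * (1 - p) * (c0 + c1)"
    by (simp add: power2_eq_square algebra_simps)
  also have "\<dots> \<le> p\<^sup>2 * (?P ?A1 * ?P ?B1) + (1 - p)\<^sup>2 * (?P A * ?P B)
      + p * (1 - p) * (?P A * ?P ?B1 + ?P ?A1 * ?P B)"
    using assms(2) c0 c1 c01 by (intro add_mono[OF add_mono] mult_left_mono) auto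
  also have "\<dots> = bprob p (insert e F) A * bprob p (insert e F) B"
    by (simp add: split power2_eq_square algebra_simps)
  finally show ?case .
qed

section \<open>Open paths and disjoint occurrence\<close>

text \<open>
  An edge is the set of its two ends, and a configuration \<open>\<eta>\<close> is the set of its open edges.
\<close>
definition conn :: "'v set set \<Rightarrow> 'v \<Rightarrow> 'v \<Rightarrow> bool"
  where "conn \<eta> = (\<lambda>x y. {x, y} \<in> \<eta>)\<^sup>*\<^sup>*"

lemma conn_refl [simp]: "conn \<eta> x x"
  by (simp add: conn_def)

lemma conn_edge: "{x, y} \<in> \<eta> \<Longrightarrow> conn \<eta> x y"
  by (auto simp: conn_def)

lemma conn_trans: "conn \<eta> x y \<Longrightarrow> conn \<eta> y z \<Longrightarrow> conn \<eta> x z"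
  by (auto simp: conn_def)

lemma conn_mono: "conn \<eta> x y \<Longrightarrow> \<eta> \<subseteq> \<zeta> \<Longrightarrow> conn \<zeta> x y"
  unfolding conn_def by (erule rtranclp_mono[THEN predicate2D, rotated]) auto

lemma conn_sym: "conn \<eta> x y \<Longrightarrow> conn \<eta> y x"
  unfolding conn_def
proof (induction rule: rtranclp_induct)
  case (step y z)
  then have "{z, y} \<in> \<eta>" by (simp add: insert_commute)
  then show ?case using step.IH by (rule converse_rtranclp_into_rtranclp)
qed auto

lemma conn_commute: "conn \<eta> x y \<longleftrightarrow> conn \<eta> y x"
  by (rule iffI) (erule conn_sym)+

lemma increasing_conn: "increasing_event (\<lambda>\<eta>. conn \<eta> x y)"
  by (rule increasingI) (rule conn_mono)

lemma conn_in_vertices: "conn \<eta> x y \<Longrightarrow> y \<in> insert x (\<Union>\<eta>)"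
  unfolding conn_def by (erule rtranclp.cases) auto

lemma conn_image:
  assumes "inj h"
  shows "conn ((`) h ` \<eta>) (h x) (h y) \<longleftrightarrow> conn \<eta> x y"
proof
  assume "conn ((`) h ` \<eta>) (h x) (h y)"
  moreover have "\<exists>b. z = h b \<and> conn \<eta> x b" if "conn ((`) h ` \<eta>) (h x) z" for z
    using that unfolding conn_def
  proof (induction rule: rtranclp_induct)
    case (step y z)
    then obtain b e where b: "y = h b" "(\<lambda>x y. {x, y} \<in> \<eta>)\<^sup>*\<^sup>* x b" and e: "e \<in> \<eta>" "{y, z} = h ` e"
      by auto
    then obtain c where c: "c \<in> e" "z = h c" by auto
    have "h ` {b, c} = h ` e" using b e c by auto
    then have "{b, c} = e" using assms by (metis inj_image_eq_iff)
    then show ?case using b c e by (auto intro: rtranclp.rtrancl_into_rtrancl)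
  qed auto
  ultimately show "conn \<eta> x y" using assms by (auto dest: injD)
next
  assume "conn \<eta> x y"
  then show "conn ((`) h ` \<eta>) (h x) (h y)"
    unfolding conn_def
  proof (induction rule: rtranclp_induct)
    case (step y z)
    then have "{h y, h z} \<in> (`) h ` \<eta>" by (auto intro!: image_eqI[of _ _ "{y, z}"])
    then show ?case using step.IH by (rule rtranclp.rtrancl_into_rtrancl[rotated])
  qed auto
qed

fun path_edges :: "'v list \<Rightarrow> 'v set set" where
  "path_edges (x # y # zs) = insert {x, y} (path_edges (y # zs))"
| "path_edges _ = {}"

lemma path_edges_split: "path_edges (xs @ z # ys) = path_edges (xs @ [z]) \<union> path_edges (z # ys)"
proof (induction xs)
  case (Cons x xs)
  then show ?case by (cases xs) auto
qed (auto split: list.split)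

lemma path_edges_Cons: "ys \<noteq> [] \<Longrightarrow> path_edges (x # ys) = insert {x, hd ys} (path_edges ys)"
  by (cases ys) auto

lemma path_edges_joint:
  assumes "xs \<noteq> []" "ys \<noteq> []"
  shows "path_edges (xs @ ys) = path_edges xs \<union> insert {last xs, hd ys} (path_edges ys)"
proof -
  have joint: "butlast xs @ last xs # ys = xs @ ys"
    using append_butlast_last_id[OF assms(1)] by (metis append.assoc append_Cons append_Nil)
  then show ?thesis
    using path_edges_split[of "butlast xs" "last xs" ys] assms path_edges_Cons[of ys]
    unfolding joint by simp
qed

lemma path_edges_subset: "e \<in> path_edges xs \<Longrightarrow> e \<subseteq> set xs"
  by (induction xs rule: path_edges.induct) auto

lemma path_edges_not_singleton: "distinct xs \<Longrightarrow> e \<in> path_edges xs \<Longrightarrow> \<not> e \<subseteq> {z}"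
  by (induction xs rule: path_edges.induct) auto

lemma finite_path_edges [simp]: "finite (path_edges xs)"
  by (induction xs rule: path_edges.induct) auto

text \<open>
  Two paths that share at most one vertex share no edge. This turns statements about vertices of
  self-avoiding paths into disjoint occurrence.
\<close>
lemma path_edges_disjoint:
  assumes "distinct xs" "set xs \<inter> set ys \<subseteq> {z}"
  shows "path_edges xs \<inter> path_edges ys = {}"
proof (intro equals0I)
  fix e assume "e \<in> path_edges xs \<inter> path_edges ys"
  then have "e \<subseteq> set xs" "e \<subseteq> set ys" "\<not> e \<subseteq> {z}"
    using path_edges_subset[of e] path_edges_not_singleton[OF assms(1), of e z] by simp_all
  then show False using assms(2) by auto
qed

lemma conn_path_edges: "xs \<noteq> [] \<Longrightarrow> conn (path_edges xs) (hd xs) (last xs)"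
proof (induction xs rule: path_edges.induct)
  case (1 x y zs)
  have "conn (path_edges (x # y # zs)) y (last (y # zs))"
    using 1 by (auto elim!: conn_mono)
  then have "conn (path_edges (x # y # zs)) x (last (y # zs))"
    using conn_trans[OF conn_edge[of x y "path_edges (x # y # zs)"]] by simp
  then show ?case by simp
qed auto

lemma conn_imp_path:
  assumes "conn \<eta> x y"
  obtains xs where "distinct xs" "xs \<noteq> []" "hd xs = x" "last xs = y" "path_edges xs \<subseteq> \<eta>"
proof -
  have "\<exists>xs. distinct xs \<and> xs \<noteq> [] \<and> hd xs = x \<and> last xs = y \<and> path_edges xs \<subseteq> \<eta>"
    using assms unfolding conn_def
  proof (induction rule: converse_rtranclp_induct)
    case base
    show ?case by (intro exI[of _ "[y]"]) auto
  next
    case (step x x')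
    then obtain xs where xs: "distinct xs" "xs \<noteq> []" "hd xs = x'" "last xs = y" "path_edges xs \<subseteq> \<eta>"
      by auto
    show ?case
    proof (cases "x \<in> set xs")
      case True
      then obtain ys zs where s: "xs = ys @ x # zs" by (auto dest: split_list)
      then show ?thesis using xs path_edges_split[of ys x zs]
        by (intro exI[of _ "x # zs"]) auto
    next
      case False
      then show ?thesis using xs step by (intro exI[of _ "x # xs"]) (auto simp: path_edges_Cons)
    qed
  qed
  then show thesis using that by auto
qed

lemma disj_occI: "\<alpha> \<subseteq> \<eta> \<Longrightarrow> \<beta> \<subseteq> \<eta> \<Longrightarrow> \<alpha> \<inter> \<beta> = {} \<Longrightarrow> A \<alpha> \<Longrightarrow> B \<beta> \<Longrightarrow> (A \<box> B) \<eta>"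
  unfolding disj_occ_def by meson

text \<open>
  A connection that cannot avoid \<open>C\<close> visits a vertex of \<open>C\<close>; cutting a self-avoiding path there gives
  two edge-disjoint connections.
\<close>
lemma conn_through:
  assumes "conn \<eta> v x" "\<not> conn {e \<in> \<eta>. e \<inter> C = {}} v x"
  shows "\<exists>y\<in>C. ((\<lambda>\<omega>. conn \<omega> v y) \<box> (\<lambda>\<omega>. conn \<omega> y x)) \<eta>"
proof -
  obtain xs where xs: "distinct xs" "xs \<noteq> []" "hd xs = v" "last xs = x" "path_edges xs \<subseteq> \<eta>"
    using conn_imp_path[OF assms(1)] by blast
  have "set xs \<inter> C \<noteq> {}"
  proof
    assume "set xs \<inter> C = {}"
    then have "path_edges xs \<subseteq> {e \<in> \<eta>. e \<inter> C = {}}"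
      using xs(5) path_edges_subset[of _ xs] by blast
    from conn_mono[OF conn_path_edges[OF xs(2)] this] show False using assms(2) xs(3,4) by simp
  qed
  then obtain y where yC: "y \<in> C" "y \<in> set xs" by auto
  obtain ys zs where "xs = ys @ y # zs" using split_list[OF yC(2)] by auto
  with yC have y: "y \<in> C" "xs = ys @ y # zs" by auto
  have "path_edges (ys @ [y]) \<inter> path_edges (y # zs) = {}"
    using xs(1) y by (intro path_edges_disjoint[where z = y]) auto
  moreover have "conn (path_edges (ys @ [y])) v y"
    using conn_path_edges[of "ys @ [y]"] xs(3) y(2) by (cases ys) auto
  moreover have "conn (path_edges (y # zs)) y x"
    using conn_path_edges[of "y # zs"] xs(4) y(2) by auto
  ultimately show ?thesis
    using y xs(5) path_edges_split[of ys y zs] by (intro bexI[of _ y] disj_occI[of "path_edges (ys @ [y])" \<eta> "path_edges (y # zs)"]) auto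
qed

text \<open>
  The branching of the tree-graph inequality: on a path from \<open>x\<close> to \<open>y\<close>, take as \<open>z\<close> the last vertex that lies
  on a self-avoiding path from \<open>x\<close> to \<open>u\<close>. What follows on the way to \<open>y\<close> meets the other path only in \<open>z\<close>.
\<close>
lemma conn_tree:
  assumes "conn \<eta> x u" "conn \<eta> x y"
  shows "\<exists>z. ((\<lambda>\<omega>. conn \<omega> x z) \<box> (\<lambda>\<omega>. conn \<omega> z u) \<box> (\<lambda>\<omega>. conn \<omega> z y)) \<eta>"
proof -
  obtain xs where xs: "distinct xs" "xs \<noteq> []" "hd xs = x" "last xs = u" "path_edges xs \<subseteq> \<eta>"
    using conn_imp_path[OF assms(1)] by blast
  obtain ys where ys: "distinct ys" "ys \<noteq> []" "hd ys = x" "last ys = y" "path_edges ys \<subseteq> \<eta>"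
    using conn_imp_path[OF assms(2)] by blast
  have "\<exists>z\<in>set ys. z \<in> set xs" using xs ys by (metis hd_in_set)
  then obtain ys1 z ys2 where z: "ys = ys1 @ z # ys2" "z \<in> set xs" "\<forall>w\<in>set ys2. w \<notin> set xs"
    by (rule split_list_last_propE)
  obtain xs1 xs2 where x: "xs = xs1 @ z # xs2" using z(2) by (auto dest: split_list)
  let ?a = "path_edges (xs1 @ [z])" and ?b = "path_edges (z # xs2)" and ?c = "path_edges (z # ys2)"
  have ab: "?a \<inter> ?b = {}" and ac: "?a \<inter> ?c = {}" and bc: "?b \<inter> ?c = {}"
    using xs(1) x z by (intro path_edges_disjoint[where z = z]; auto)+
  have sub: "?a \<subseteq> \<eta>" "?b \<subseteq> \<eta>" "?c \<subseteq> \<eta>"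
    using xs(5) ys(5) x z(1) path_edges_split[of xs1 z xs2] path_edges_split[of ys1 z ys2] by auto
  have "conn ?a x z" using conn_path_edges[of "xs1 @ [z]"] xs(3) x by (cases xs1) auto
  moreover have "conn ?b z u" using conn_path_edges[of "z # xs2"] xs(4) x by auto
  moreover have "conn ?c z y" using conn_path_edges[of "z # ys2"] ys(4) z by auto
  ultimately show ?thesis
    using ab ac bc sub
    by (intro exI[of _ z] disj_occI[of ?a \<eta> "?b \<union> ?c"] disj_occI[of ?b "?b \<union> ?c" ?c]) auto
qed

lemma conn_pivot:
  assumes "pivot (\<lambda>\<omega>. conn \<omega> x y) e \<eta>"
  shows "\<exists>u v. e = {u, v} \<and> ((\<lambda>\<omega>. conn \<omega> x u) \<box> (\<lambda>\<omega>. conn \<omega> v y)) \<eta>"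
proof -
  obtain xs where xs: "distinct xs" "xs \<noteq> []" "hd xs = x" "last xs = y" "path_edges xs \<subseteq> insert e \<eta>"
    using conn_imp_path[of "insert e \<eta>" x y] assms unfolding pivot_def by blast
  have "e \<in> path_edges xs"
  proof (rule ccontr)
    assume "e \<notin> path_edges xs"
    then have "path_edges xs \<subseteq> \<eta> - {e}" using xs(5) by auto
    from conn_mono[OF conn_path_edges[OF xs(2)] this] show False
      using assms xs(3,4) by (simp add: pivot_def)
  qed
  moreover have "\<exists>ys zs. xs = ys @ zs \<and> ys \<noteq> [] \<and> zs \<noteq> [] \<and> e = {last ys, hd zs}"
    if "e \<in> path_edges xs" for xs :: "'a list"
    using that
  proof (induction xs rule: path_edges.induct)
    case (1 a b cs)
    show ?case
    proof (cases "e = {a, b}")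
      case True
      then show ?thesis by (intro exI[of _ "[a]"] exI[of _ "b # cs"]) auto
    next
      case False
      then obtain ys zs where "b # cs = ys @ zs" "ys \<noteq> []" "zs \<noteq> []" "e = {last ys, hd zs}"
        using 1 by auto
      then show ?thesis by (intro exI[of _ "a # ys"] exI[of _ zs]) auto
    qed
  qed auto
  ultimately obtain ys zs where s: "xs = ys @ zs" "ys \<noteq> []" "zs \<noteq> []" "e = {last ys, hd zs}"
    by blast
  have "e \<notin> path_edges ys" "e \<notin> path_edges zs"
    using s(4) xs(1) last_in_set[OF s(2)] hd_in_set[OF s(3)]
      path_edges_subset[of e ys] path_edges_subset[of e zs] unfolding s(1) by auto
  moreover have "path_edges ys \<inter> path_edges zs = {}"
    using xs(1) s by (intro path_edges_disjoint[where z = x]) auto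
  moreover have "conn (path_edges ys) x (last ys)" "conn (path_edges zs) (hd zs) y"
    using conn_path_edges[OF s(2)] conn_path_edges[OF s(3)] xs(3,4) s by auto
  ultimately show ?thesis
    using xs(5) s path_edges_joint[OF s(2,3)]
    by (intro exI[of _ "last ys"] exI[of _ "hd zs"] conjI disj_occI[of "path_edges ys" _ "path_edges zs"]) auto
qed

text \<open>
  Cutting a self-avoiding path from inside \<open>S\<close> to outside of it at the first edge that leaves \<open>S\<close>. The first
  part uses only edges with both ends in \<open>S\<close>.
\<close>
lemma conn_exit:
  assumes "conn \<eta> u z" "u \<in> S" "z \<notin> S"
  shows "\<exists>x\<in>S. \<exists>y\<in>-S. ((\<lambda>\<omega>. conn (\<omega> \<inter> Pow S) u x) \<box> (\<lambda>\<omega>. {x, y} \<in> \<omega>) \<box> (\<lambda>\<omega>. conn \<omega> y z)) \<eta>"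
proof -
  obtain xs where xs: "distinct xs" "xs \<noteq> []" "hd xs = u" "last xs = z" "path_edges xs \<subseteq> \<eta>"
    using conn_imp_path[OF assms(1)] by blast
  have "\<exists>y\<in>set xs. y \<notin> S" using xs assms(3) by (metis last_in_set)
  then obtain ys y zs where y: "xs = ys @ y # zs" "y \<notin> S" "\<forall>w\<in>set ys. w \<in> S"
    using split_list_first_prop[of xs "\<lambda>y. y \<notin> S"] by auto
  have ys: "ys \<noteq> []" using xs(3) y assms(2) by auto
  let ?a = "path_edges ys" and ?c = "path_edges (y # zs)" and ?x = "last ys"
  have x: "?x \<in> S" "?x \<in> set ys" using y ys by auto
  have "conn ?a u ?x" using conn_path_edges[OF ys] xs(3) y ys by auto
  moreover have "?a \<subseteq> Pow S" using y path_edges_subset[of _ ys] by blast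
  ultimately have a: "conn (?a \<inter> Pow S) u ?x" by (simp add: Int_absorb2)
  have c: "conn ?c y z" using conn_path_edges[of "y # zs"] xs(4) y by auto
  have "?a \<inter> ?c = {}" using xs(1) y by (intro path_edges_disjoint[where z = y]) auto
  moreover have "{?x, y} \<notin> ?a" using path_edges_subset[of "{?x, y}" ys] y by auto
  moreover have "{?x, y} \<notin> ?c" using path_edges_subset[of "{?x, y}" "y # zs"] xs(1) y x by auto
  ultimately show ?thesis
    using a c x y(2) xs(5) path_edges_joint[OF ys, of "y # zs"] y(1)
    by (intro bexI[of _ ?x] bexI[of _ y] disj_occI[of ?a \<eta> "insert {?x, y} ?c"]
          disj_occI[of "{{?x, y}}" "insert {?x, y} ?c" ?c]) auto
qed

section \<open>The lattice, and the passage from finite to infinite volume\<close>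

text \<open>
  The two-point function in finite volume.
\<close>
abbreviation ftau :: "real \<Rightarrow> 'v set set \<Rightarrow> 'v \<Rightarrow> 'v \<Rightarrow> real"
  where "ftau p F x y \<equiv> bprob p F (\<lambda>\<eta>. conn \<eta> x y)"

lemma ftau_commute: "ftau p F x y = ftau p F y x"
  by (rule bprob_cong) (rule conn_commute)

definition sup_norm :: "int ^ 'd::finite \<Rightarrow> nat"
  where "sup_norm x = nat (MAX i. \<bar>x $ i\<bar>)"

definition cube :: "nat \<Rightarrow> (int ^ 'd::finite) set"
  where "cube n = {x. sup_norm x \<le> n}"

lemma sup_norm_le_iff: "sup_norm (x :: int ^ 'd::finite) \<le> n \<longleftrightarrow> (\<forall>i. \<bar>x $ i\<bar> \<le> int n)"
  unfolding sup_norm_def by (subst nat_le_iff) (subst Max_le_iff, auto)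

lemma abs_nth_le_sup_norm: "\<bar>x $ i\<bar> \<le> int (sup_norm x)"
  using sup_norm_le_iff[of x "sup_norm x"] by simp

lemma in_cube_iff: "x \<in> cube n \<longleftrightarrow> (\<forall>i. \<bar>x $ i\<bar> \<le> int n)"
  by (simp add: cube_def sup_norm_le_iff)

lemma sup_norm_0 [simp]: "sup_norm 0 = 0"
  using sup_norm_le_iff[of 0 0] by simp

lemma sup_norm_minus [simp]: "sup_norm (- x) = sup_norm x"
proof (intro antisym)
  show "sup_norm (- x) \<le> sup_norm x" "sup_norm x \<le> sup_norm (- x)"
    unfolding sup_norm_le_iff using abs_nth_le_sup_norm[of x] abs_nth_le_sup_norm[of "- x"] by simp_all
qed

lemma sup_norm_triangle: "sup_norm (x + y) \<le> sup_norm x + sup_norm y"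
  unfolding sup_norm_le_iff
proof
  fix i
  have "\<bar>x $ i + y $ i\<bar> \<le> \<bar>x $ i\<bar> + \<bar>y $ i\<bar>" by (rule abs_triangle_ineq)
  then show "\<bar>(x + y) $ i\<bar> \<le> int (sup_norm x + sup_norm y)"
    using abs_nth_le_sup_norm[of x i] abs_nth_le_sup_norm[of y i] by simp
qed

lemma zero_in_cube [simp]: "0 \<in> cube n"
  by (simp add: cube_def)

lemma cube_mono: "m \<le> n \<Longrightarrow> cube m \<subseteq> cube n"
  by (auto simp: cube_def)

lemma bij_betw_cube:
  "bij_betw vec_nth (cube n :: (int ^ 'd::finite) set) (Pi\<^sub>E UNIV (\<lambda>_. {- int n..int n}))"
  by (rule bij_betwI[where g = vec_lambda])
    (auto simp: in_cube_iff abs_le_iff PiE_UNIV_domain Pi_iff le_minus_iff minus_le_iff vec_lambda_inverse)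

lemma finite_cube [simp]: "finite (cube n :: (int ^ 'd::finite) set)"
  using bij_betw_finite[OF bij_betw_cube] by (simp add: finite_PiE)

lemma card_cube: "card (cube n :: (int ^ 'd::finite) set) = (2 * n + 1) ^ CARD('d)"
proof -
  have "nat (2 * int n + 1) = 2 * n + 1" by simp
  then show ?thesis
    using bij_betw_same_card[OF bij_betw_cube[where 'd = 'd]] by (simp add: card_PiE)
qed

lemma finite_subset_cube:
  assumes "finite (A :: (int ^ 'd::finite) set)"
  shows "\<exists>n. A \<subseteq> cube n"
proof -
  have "A \<subseteq> cube (Max (insert 0 (sup_norm ` A)))"
    using assms by (auto simp: cube_def intro!: Max_ge)
  then show ?thesis by blast
qed

lemma l1_norm_minus_commute: "l1_norm (x - y) = l1_norm (y - x)"
  by (simp add: l1_norm_def abs_minus_commute)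

lemma edge_iff:
  "{x, y} \<in> edges L \<longleftrightarrow> 0 < l1_norm (x - y) \<and> l1_norm (x - y) \<le> L"
  unfolding edges_def by (auto simp: doubleton_eq_iff l1_norm_minus_commute)

lemma edgesE:
  assumes "e \<in> edges L"
  obtains x y where "e = {x, y}" "x \<noteq> y" "0 < l1_norm (x - y)" "l1_norm (x - y) \<le> L"
  using assms unfolding edges_def by (force simp: l1_norm_def)

definition cube_edges :: "int \<Rightarrow> nat \<Rightarrow> (int ^ 'd::finite) set set"
  where "cube_edges L n = {e \<in> edges L. e \<subseteq> cube n}"

lemma finite_cube_edges [simp]: "finite (cube_edges L n)"
  by (rule finite_subset[of _ "Pow (cube n)"]) (auto simp: cube_edges_def)

lemma cube_edges_subset: "cube_edges L n \<subseteq> edges L"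
  by (auto simp: cube_edges_def)

lemma cube_edges_mono: "m \<le> n \<Longrightarrow> cube_edges L m \<subseteq> cube_edges L n"
  using cube_mono[of m n] by (auto simp: cube_edges_def)

lemma finite_edges_subset_cube_edges:
  assumes "finite F" "F \<subseteq> edges L"
  shows "\<exists>n. F \<subseteq> cube_edges L n"
proof -
  have "finite (\<Union>F)" using assms by (auto elim!: edgesE)
  then obtain n where "\<Union>F \<subseteq> cube n" using finite_subset_cube by blast
  then show ?thesis using assms(2) by (intro exI[of _ n]) (auto simp: cube_edges_def)
qed

lemma translate_edge_iff: "(+) a ` e \<in> edges L \<longleftrightarrow> e \<in> edges L"
proof -
  have imp: "(+) a ` e \<in> edges L" if "e \<in> edges L" for a :: "int ^ 'a" and e
    using that by (auto elim!: edgesE simp: edge_iff)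
  show ?thesis
    using imp[of e a] imp[of "(+) a ` e" "- a"] by (auto simp: image_image)
qed

lemma ftau_translate:
  assumes "finite F"
  shows "ftau p ((`) ((+) a) ` F) (a + x) (a + y) = ftau p F x (y :: int ^ 'd::finite)"
proof -
  have "inj_on ((`) ((+) a)) F" by (auto intro!: inj_onI simp: inj_image_eq_iff)
  then show ?thesis
    using conn_image[of "(+) a"] unfolding bprob_def by (subst bexp_image[OF assms]) auto
qed

text \<open>
  Steps of length one suffice: reducing one nonzero coordinate of the displacement lowers its \<open>\<ell>\<^sup>1\<close> norm by one.
\<close>
lemma conn_lattice:
  assumes "L \<ge> 1"
  shows "conn (edges L) x (y :: int ^ 'd::finite)"
proof -
  have "conn (edges L) x (x + z)" for z
  proof (induction "nat (l1_norm z)" arbitrary: z rule: less_induct)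
    case less
    show ?case
    proof (cases "z = 0")
      case False
      then obtain i where i: "z $ i \<noteq> 0" by (auto simp: vec_eq_iff)
      define z' where "z' = (\<chi> j. if j = i then z $ i - sgn (z $ i) else z $ j)"
      have nonneg: "l1_norm z \<ge> 0" for z :: "int ^ 'd" by (auto simp: l1_norm_def intro: sum_nonneg)
      have rest: "(\<Sum>j\<in>UNIV - {i}. \<bar>z' $ j\<bar>) = (\<Sum>j\<in>UNIV - {i}. \<bar>z $ j\<bar>)"
        by (rule sum.cong) (auto simp: z'_def)
      have "l1_norm z = \<bar>z $ i\<bar> + (\<Sum>j\<in>UNIV - {i}. \<bar>z $ j\<bar>)"
        "l1_norm z' = \<bar>z' $ i\<bar> + (\<Sum>j\<in>UNIV - {i}. \<bar>z' $ j\<bar>)"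
        unfolding l1_norm_def by (auto intro: sum.remove)
      moreover have "\<bar>z' $ i\<bar> = \<bar>z $ i\<bar> - 1" using i by (auto simp: z'_def sgn_if)
      ultimately have "l1_norm z' = l1_norm z - 1" using rest by simp
      then have IH: "conn (edges L) x (x + z')" using nonneg[of z'] by (intro less) auto
      have "l1_norm (x + z' - (x + z)) = (\<Sum>j\<in>UNIV. if j = i then 1 else 0)"
        unfolding l1_norm_def using i by (intro sum.cong) (auto simp: z'_def sgn_if)
      then have "{x + z', x + z} \<in> edges L" using assms by (simp add: edge_iff)
      from conn_trans[OF IH conn_edge[OF this]] show ?thesis .
    qed simp
  qed
  from this[of "y - x"] show ?thesis by simp
qed

definition open_edges :: "int \<Rightarrow> ((int ^ 'd::finite) set \<Rightarrow> bool) \<Rightarrow> (int ^ 'd) set set"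
  where "open_edges L \<omega> = {e \<in> edges L. \<omega> e}"

lemma connected_by_open_iff: "connected_by_open L \<omega> x y \<longleftrightarrow> conn (open_edges L \<omega>) x y"
proof -
  have "open_adj L \<omega> = (\<lambda>x y. {x, y} \<in> open_edges L \<omega>)"
    by (intro ext) (simp add: open_adj_def open_edges_def)
  then show ?thesis by (simp add: connected_by_open_def conn_def)
qed

lemma conn_open_edges_iff:
  "conn (open_edges L \<omega>) x y \<longleftrightarrow> (\<exists>n. conn (open_edges L \<omega> \<inter> cube_edges L n) x y)"
proof
  assume "conn (open_edges L \<omega>) x y"
  then obtain xs where xs: "xs \<noteq> []" "hd xs = x" "last xs = y" "path_edges xs \<subseteq> open_edges L \<omega>"
    by (rule conn_imp_path)
  have "path_edges xs \<subseteq> edges L" using xs(4) by (auto simp: open_edges_def)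
  then obtain n where "path_edges xs \<subseteq> cube_edges L n"
    using finite_edges_subset_cube_edges[OF finite_path_edges] by blast
  then show "\<exists>n. conn (open_edges L \<omega> \<inter> cube_edges L n) x y"
    using xs conn_path_edges[OF xs(1)] by (intro exI[of _ n]) (auto intro: conn_mono)
qed (auto intro: conn_mono)

lemma perc_prob_space: "prob_space (perc L p)"
  unfolding perc_def by (intro prob_space_PiM measure_pmf.prob_space_axioms)

text \<open>
  For events that depend on finitely many edges, the infinite product measure is the finite sum \<open>bprob\<close>: the
  event is a finite disjoint union of cylinders, one for each set of open edges in \<open>F\<close>.
\<close>
lemma perc_finite_event:
  fixes F :: "(int ^ 'd::finite) set set"
  assumes F: "finite F" "F \<subseteq> edges L" and p: "p \<in> {0..1}"
  shows perc_finite_event_sets: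
      "{\<omega> \<in> space (perc L p). A (open_edges L \<omega> \<inter> F)} \<in> sets (perc L p)" (is ?S)
    and perc_finite_event_measure:
      "measure (perc L p) {\<omega> \<in> space (perc L p). A (open_edges L \<omega> \<inter> F)} = bprob p F A" (is ?M)
proof -
  let ?B = "\<lambda>_. measure_pmf (bernoulli_pmf p)"
  interpret product_prob_space ?B "edges L :: (int ^ 'd) set set"
    by unfold_locales
  interpret Q: prob_space "perc L p" by (rule perc_prob_space)
  define cyl where "cyl \<eta> = prod_emb (edges L) ?B F (Pi\<^sub>E F (\<lambda>e. {e \<in> \<eta>}))" for \<eta>
  have cyl: "\<omega> \<in> cyl \<eta> \<longleftrightarrow> \<omega> \<in> space (perc L p) \<and> open_edges L \<omega> \<inter> F = \<eta>" if "\<eta> \<subseteq> F" for \<eta> \<omega>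
    using F that by (auto simp: cyl_def prod_emb_def perc_def space_PiM open_edges_def PiE_iff)
  have cyl_sets: "cyl \<eta> \<in> sets (perc L p)" for \<eta>
    unfolding cyl_def perc_def using F by (intro sets_PiM_I) auto
  have cyl_measure: "measure (perc L p) (cyl \<eta>) = (\<Prod>e\<in>F. if e \<in> \<eta> then p else 1 - p)" for \<eta>
  proof -
    have "measure (perc L p) (cyl \<eta>) = (\<Prod>e\<in>F. measure (measure_pmf (bernoulli_pmf p)) {e \<in> \<eta>})"
      unfolding cyl_def perc_def using F by (intro measure_PiM_emb) auto
    also have "\<dots> = (\<Prod>e\<in>F. if e \<in> \<eta> then p else 1 - p)"
      using p by (intro prod.cong) (auto simp: measure_pmf_single)
    finally show ?thesis .
  qed
  have eq: "{\<omega> \<in> space (perc L p). A (open_edges L \<omega> \<inter> F)} = (\<Union>\<eta>\<in>{\<eta>\<in>Pow F. A \<eta>}. cyl \<eta>)"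
    using cyl by auto
  show ?S unfolding eq using F cyl_sets by (intro sets.finite_UN) auto
  have "measure (perc L p) (\<Union>\<eta>\<in>{\<eta>\<in>Pow F. A \<eta>}. cyl \<eta>)
      = (\<Sum>\<eta>\<in>{\<eta>\<in>Pow F. A \<eta>}. measure (perc L p) (cyl \<eta>))"
    using F cyl_sets cyl by (intro Q.finite_measure_finite_Union) (auto simp: disjoint_family_on_def)
  also have "\<dots> = bprob p F A"
    unfolding bprob_def bexp_def cyl_measure
    using F by (intro sum.mono_neutral_cong_left) auto
  finally show ?M unfolding eq .
qed

lemma conn_event_Union:
  "{\<omega> \<in> space (perc L p). conn (open_edges L \<omega>) x y}
    = (\<Union>n. {\<omega> \<in> space (perc L p). conn (open_edges L \<omega> \<inter> cube_edges L n) x y})"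
  unfolding conn_open_edges_iff by auto

lemma conn_event_sets:
  assumes "p \<in> {0..1}"
  shows "{\<omega> \<in> space (perc L p). conn (open_edges L \<omega>) x y} \<in> sets (perc L p)"
  unfolding conn_event_Union
  using perc_finite_event_sets[OF finite_cube_edges cube_edges_subset assms] by (intro sets.countable_UN) auto

lemma ftau_tendsto_measure:
  fixes x y :: "int ^ 'd::finite"
  assumes "p \<in> {0..1}"
  shows "(\<lambda>n. ftau p (cube_edges L n) x y)
    \<longlonglongrightarrow> measure (perc L p) {\<omega> \<in> space (perc L p). conn (open_edges L \<omega>) x y}"
proof -
  interpret P: prob_space "perc L p" by (rule perc_prob_space)
  have "incseq (\<lambda>n. {\<omega> \<in> space (perc L p). conn (open_edges L \<omega> \<inter> cube_edges L n) x y})"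
  proof (intro monoI subsetI)
    fix m n :: nat and \<omega> :: "(int ^ 'd) set \<Rightarrow> bool"
    assume "m \<le> n"
    then have "open_edges L \<omega> \<inter> cube_edges L m \<subseteq> open_edges L \<omega> \<inter> cube_edges L n"
      using cube_edges_mono by blast
    from conn_mono[OF _ this, of x y]
    show "\<omega> \<in> {\<omega> \<in> space (perc L p). conn (open_edges L \<omega> \<inter> cube_edges L m) x y} \<Longrightarrow>
        \<omega> \<in> {\<omega> \<in> space (perc L p). conn (open_edges L \<omega> \<inter> cube_edges L n) x y}"
      by simp
  qed
  moreover have "range (\<lambda>n. {\<omega> \<in> space (perc L p). conn (open_edges L \<omega> \<inter> cube_edges L n) x y})
      \<subseteq> sets (perc L p)"
    using perc_finite_event_sets[OF finite_cube_edges cube_edges_subset assms] by auto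
  ultimately have "(\<lambda>n. measure (perc L p) {\<omega> \<in> space (perc L p). conn (open_edges L \<omega> \<inter> cube_edges L n) x y})
      \<longlonglongrightarrow> measure (perc L p) {\<omega> \<in> space (perc L p). conn (open_edges L \<omega>) x y}"
    unfolding conn_event_Union by (rule P.finite_Lim_measure_incseq[rotated])
  then show ?thesis
    by (simp only: perc_finite_event_measure[OF finite_cube_edges cube_edges_subset assms,
        where A = "\<lambda>\<eta>. conn \<eta> x y"])
qed

lemma ftau_mono_edges:
  "finite G \<Longrightarrow> F \<subseteq> G \<Longrightarrow> p \<in> {0..1} \<Longrightarrow> ftau p F x y \<le> ftau p G x y"
  by (rule bprob_mono_edges[OF _ _ increasing_conn])

lemma ftau_le_measure:
  assumes "p \<in> {0..1}" "finite F" "F \<subseteq> edges L"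
  shows "ftau p F x y \<le> measure (perc L p) {\<omega> \<in> space (perc L p). conn (open_edges L \<omega>) x y}"
proof -
  obtain m where m: "F \<subseteq> cube_edges L m" using finite_edges_subset_cube_edges assms by blast
  have "ftau p F x y \<le> ftau p (cube_edges L n) x y" if "n \<ge> m" for n
    using m cube_edges_mono[OF that, of L] assms by (intro ftau_mono_edges) auto
  then show ?thesis
    by (intro LIMSEQ_le_const[OF ftau_tendsto_measure[OF assms(1)]]) auto
qed

text \<open>
  Translation invariance. It is inherited from finite volume, where translating a set of edges is a
  bijection; it allows one function of the displacement to stand for all two-point probabilities.
\<close>
lemma measure_conn:
  assumes "p \<in> {0..1}"
  shows "measure (perc L p) {\<omega> \<in> space (perc L p). conn (open_edges L \<omega>) x y}
    = tau L p (y - x :: int ^ 'd::finite)"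
proof -
  let ?m = "\<lambda>x y. measure (perc L p) {\<omega> \<in> space (perc L p). conn (open_edges L \<omega>) x y}"
  have le: "?m x y \<le> ?m (a + x) (a + y)" for a x y :: "int ^ 'd"
  proof (intro LIMSEQ_le_const2[OF ftau_tendsto_measure[OF assms]] exI allI impI)
    fix n
    have "ftau p (cube_edges L n) x y = ftau p ((`) ((+) a) ` cube_edges L n) (a + x) (a + y)"
      by (simp add: ftau_translate)
    also have "\<dots> \<le> ?m (a + x) (a + y)"
      using cube_edges_subset[of L n] by (intro ftau_le_measure assms) (auto simp: translate_edge_iff)
    finally show "ftau p (cube_edges L n) x y \<le> ?m (a + x) (a + y)" .
  qed
  have "?m x y = ?m 0 (y - x)"
    using le[of x y "- x"] le[of 0 "y - x" x] by (intro antisym) auto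
  then show ?thesis by (simp add: tau_def connected_by_open_iff)
qed

lemma ftau_le_tau:
  assumes "p \<in> {0..1}" "finite F" "F \<subseteq> edges L"
  shows "ftau p F x y \<le> tau L p (y - x)"
  using ftau_le_measure[OF assms, of x y] unfolding measure_conn[OF assms(1)] .

lemma ftau_tendsto_tau:
  assumes "p \<in> {0..1}"
  shows "(\<lambda>n. ftau p (cube_edges L n) x y) \<longlonglongrightarrow> tau L p (y - x)"
  using ftau_tendsto_measure[OF assms, of L x y] unfolding measure_conn[OF assms] .

lemma tau_nonneg [simp]: "0 \<le> tau L p x"
  by (simp add: tau_def)

lemma tau_le_1: "tau L p x \<le> 1"
proof -
  interpret P: prob_space "perc L p" by (rule perc_prob_space)
  show ?thesis by (simp add: tau_def)
qed

lemma tau_minus: 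
  assumes "p \<in> {0..1}"
  shows "tau L p (- x) = tau L p x"
  using LIMSEQ_unique[OF ftau_tendsto_tau[OF assms, of L x 0]] ftau_tendsto_tau[OF assms, of L 0 x]
  by (simp add: ftau_commute[of p _ x 0])

lemma tau_0 [simp]: "tau L p 0 = 1"
proof -
  interpret P: prob_space "perc L p" by (rule perc_prob_space)
  show ?thesis by (simp add: tau_def connected_by_open_iff P.prob_space)
qed

lemma tau_mono:
  assumes "0 \<le> p" "p \<le> q" "q \<le> 1"
  shows "tau L p x \<le> tau L q x"
  using ftau_tendsto_tau[of p L 0 x] ftau_tendsto_tau[of q L 0 x] assms
  by (intro LIMSEQ_le) (auto intro!: bprob_mono_p increasing_conn)

text \<open>
  A cluster is infinite exactly if it leaves every cube, so a lower bound for leaving the cubes that is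
  uniform in the cube, and that can be tested on finite sets of edges, is a lower bound for percolation.
\<close>
lemma theta_ge:
  fixes F :: "nat \<Rightarrow> (int ^ 'd::finite) set set"
  assumes p: "p \<in> {0..1}" and F: "\<And>n. finite (F n)" "\<And>n. F n \<subseteq> edges L"
    and c: "\<And>n. c \<le> bprob p (F n) (\<lambda>\<eta>. \<exists>y. y \<notin> cube n \<and> conn \<eta> 0 y)"
  shows "c \<le> theta TYPE('d) L p"
proof -
  interpret P: prob_space "perc L p" by (rule perc_prob_space)
  define E where "E n = {\<omega> \<in> space (perc L p). \<exists>y\<in>- cube n. conn (open_edges L \<omega>) 0 (y :: int ^ 'd)}" for n
  have sets: "E n \<in> sets (perc L p)" for n
  proof -
    have "E n = (\<Union>y\<in>- cube n. {\<omega> \<in> space (perc L p). conn (open_edges L \<omega>) 0 y})"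
      by (auto simp: E_def)
    also have "\<dots> \<in> sets (perc L p)"
      by (intro sets.countable_UN') (auto intro: conn_event_sets[OF p])
    finally show ?thesis .
  qed
  have "decseq E"
    using cube_mono by (intro antimonoI) (fastforce simp: E_def)
  then have "(\<lambda>n. measure (perc L p) (E n)) \<longlonglongrightarrow> measure (perc L p) (\<Inter>n. E n)"
    using sets by (intro P.finite_Lim_measure_decseq) auto
  moreover have "(\<Inter>n. E n) = {\<omega> \<in> space (perc L p). infinite {x :: int ^ 'd. connected_by_open L \<omega> 0 x}}"
  proof -
    have "infinite A \<longleftrightarrow> (\<forall>n. \<exists>y\<in>- cube n. y \<in> A)" for A :: "(int ^ 'd) set"
      using finite_subset_cube[of A] finite_subset[OF _ finite_cube, of A] by blast
    then show ?thesis by (auto simp: E_def connected_by_open_iff)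
  qed
  moreover have "c \<le> measure (perc L p) (E n)" for n
  proof -
    have "c \<le> measure (perc L p) {\<omega> \<in> space (perc L p). \<exists>y. y \<notin> cube n \<and> conn (open_edges L \<omega> \<inter> F n) 0 y}"
      using c[of n] perc_finite_event_measure[OF F p, where A = "\<lambda>\<eta>. \<exists>y. y \<notin> cube n \<and> conn \<eta> 0 y"] by simp
    also have "\<dots> \<le> measure (perc L p) (E n)"
      using sets by (intro P.finite_measure_mono) (auto simp: E_def intro: conn_mono)
    finally show ?thesis .
  qed
  ultimately show ?thesis
    unfolding theta_def by (metis LIMSEQ_le_const)
qed

text \<open>
  At parameter \<open>1\<close> all edges of a path out of the cube are open. This shows that the set in the definition of
  the critical parameter is not empty.
\<close>
lemma theta_one_ge_1:
  assumes "L \<ge> 1"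
  shows "1 \<le> theta TYPE('d::finite) L 1"
proof -
  have "\<exists>F. finite F \<and> F \<subseteq> edges L \<and> (\<exists>y. y \<notin> cube n \<and> conn F 0 (y :: int ^ 'd))" for n
  proof -
    define y :: "int ^ 'd" where "y = (\<chi> i. int n + 1)"
    have "y \<notin> cube n" by (auto simp: y_def in_cube_iff)
    moreover obtain xs where xs: "xs \<noteq> []" "hd xs = 0" "last xs = y" "path_edges xs \<subseteq> edges L"
      using conn_imp_path[OF conn_lattice[OF assms]] by metis
    moreover have "conn (path_edges xs) 0 y" using conn_path_edges[OF xs(1)] xs by simp
    ultimately show ?thesis by (intro exI[of _ "path_edges xs"]) auto
  qed
  then obtain F where F: "finite (F n)" "F n \<subseteq> edges L" "\<exists>y. y \<notin> cube n \<and> conn (F n) 0 (y :: int ^ 'd)" for n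
    by metis
  have one: "bprob 1 G A = 1" if "finite G" "A G" for G :: "(int ^ 'd) set set" and A
  proof -
    have "bprob 1 G A = bexp 1 G (\<lambda>\<eta>. of_bool (A \<eta>))" by (simp add: bprob_def)
    also have "\<dots> = of_bool (A G)"
      using that(1) by (induction G arbitrary: A rule: finite_induct) (auto simp: bexp_insert)
    finally show ?thesis using that by simp
  qed
  show ?thesis
    by (rule theta_ge[of _ F]) (use F one in auto)
qed

lemma p_crit_in:
  assumes "L \<ge> 1"
  shows "p_crit TYPE('d::finite) L \<in> {0..1}"
    and "\<And>p. p \<in> {0..1} \<Longrightarrow> theta TYPE('d) L p > 0 \<Longrightarrow> p_crit TYPE('d) L \<le> p"
proof -
  let ?S = "{p \<in> {0..1}. theta TYPE('d) L p > 0}"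
  have ne: "1 \<in> ?S" using theta_one_ge_1[OF assms, where 'd = 'd] by auto
  have bdd: "bdd_below ?S" by (auto intro: bdd_belowI[of _ 0])
  show "p_crit TYPE('d) L \<in> {0..1}"
    unfolding p_crit_def using ne bdd by (auto intro!: cInf_greatest cInf_lower)
  show "\<And>p. p \<in> {0..1} \<Longrightarrow> theta TYPE('d) L p > 0 \<Longrightarrow> p_crit TYPE('d) L \<le> p"
    unfolding p_crit_def using bdd by (auto intro!: cInf_lower)
qed

section \<open>Sharpness of the phase transition\<close>

definition boundary_pairs :: "int \<Rightarrow> (int ^ 'd::finite) set \<Rightarrow> ((int ^ 'd) \<times> (int ^ 'd)) set"
  where "boundary_pairs L S = {(x, y). x \<in> S \<and> y \<notin> S \<and> {x, y} \<in> edges L}"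

text \<open>
  The quantity \<open>\<phi>\<^sub>p(S)\<close> of Duminil-Copin and Tassion: the expected number of open edges by which one can leave
  \<open>S\<close> after reaching the inner end within \<open>S\<close>.
\<close>
definition phi :: "int \<Rightarrow> real \<Rightarrow> (int ^ 'd::finite) set \<Rightarrow> real"
  where "phi L p S = (\<Sum>(x, y)\<in>boundary_pairs L S. p * ftau p (edges L \<inter> Pow S) 0 x)"

lemma sup_norm_le_l1_norm: "int (sup_norm x) \<le> l1_norm x"
proof -
  have "\<bar>x $ i\<bar> \<le> l1_norm x" for i
    unfolding l1_norm_def by (rule member_le_sum) auto
  then have "sup_norm x \<le> nat (l1_norm x)"
    unfolding sup_norm_le_iff by (auto simp: l1_norm_def sum_nonneg)
  then show ?thesis by (auto simp: l1_norm_def sum_nonneg le_nat_iff)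
qed

lemma edge_sup_norm: "{x, y} \<in> edges L \<Longrightarrow> sup_norm (x - y) \<le> nat L"
  using sup_norm_le_l1_norm[of "x - y"] by (auto simp: edge_iff)

lemma finite_nbrs: "finite {y :: int ^ 'd::finite. {x, y} \<in> edges L}"
proof (rule finite_subset)
  show "{y. {x, y} \<in> edges L} \<subseteq> (\<lambda>z. x - z) ` cube (nat L)"
    using edge_sup_norm by (force simp: cube_def intro: image_eqI[of _ _ "x - _"])
qed auto

lemma finite_boundary_pairs [simp]: "finite S \<Longrightarrow> finite (boundary_pairs L S)"
  by (rule finite_subset[of _ "SIGMA x:S. {y. {x, y} \<in> edges L}"])
    (auto simp: boundary_pairs_def finite_nbrs)

lemma finite_edges_touching:
  assumes "finite V"
  shows "finite {e \<in> edges L. e \<inter> V \<noteq> {}}"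
proof (rule finite_subset)
  show "{e \<in> edges L. e \<inter> V \<noteq> {}} \<subseteq> (\<lambda>(x, y). {x, y}) ` (SIGMA x:V. {y. {x, y} \<in> edges L})"
  proof
    fix e assume "e \<in> {e \<in> edges L. e \<inter> V \<noteq> {}}"
    then have "e \<in> edges L" "e \<inter> V \<noteq> {}" by auto
    moreover obtain x y where "e = {x, y}" using edgesE[OF \<open>e \<in> edges L\<close>] by metis
    ultimately have e: "e = {x, y}" "e \<in> edges L" "x \<in> V \<or> y \<in> V" by auto
    then show "e \<in> (\<lambda>(x, y). {x, y}) ` (SIGMA x:V. {y. {x, y} \<in> edges L})"
      by (auto intro: image_eqI[of _ _ "(x, y)"] image_eqI[of _ _ "(y, x)"] simp: insert_commute)
  qed
qed (use assms in \<open>auto simp: finite_nbrs\<close>)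

lemma edges_Pow_subset: "edges L \<inter> Pow S \<subseteq> {e \<in> edges L. e \<inter> S \<noteq> {}}"
  by (auto elim!: edgesE simp: edge_iff)

lemma finite_edges_Pow [simp]: "finite S \<Longrightarrow> finite (edges L \<inter> Pow S)"
  by (rule finite_subset[OF edges_Pow_subset finite_edges_touching])

lemma bprob_single:
  assumes "finite F"
  shows "bprob p F (\<lambda>\<eta>. e \<in> \<eta>) = (if e \<in> F then p else 0)"
  using assms
proof (induction F rule: finite_induct)
  case (insert a F)
  have "bexp p F (\<lambda>_. 1) = 1" using insert.hyps by (simp add: bexp_const)
  then show ?case
    using insert by (cases "e = a") (auto simp: bprob_def bexp_insert algebra_simps)
qed (auto simp: bprob_def)

lemma boundary_pairs_translate:
  "boundary_pairs L ((+) u ` S) = map_prod ((+) u) ((+) u) ` boundary_pairs L S"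
proof -
  have e: "{u + x, u + y} \<in> edges L \<longleftrightarrow> {x, y} \<in> edges L" for x y
    by (simp add: edge_iff)
  show ?thesis
  proof (intro set_eqI iffI)
    fix z assume "z \<in> boundary_pairs L ((+) u ` S)"
    then obtain x y where z: "z = (u + x, y)" "x \<in> S" "y \<notin> (+) u ` S" "{u + x, y} \<in> edges L"
      by (auto simp: boundary_pairs_def)
    define y' where "y' = y - u"
    have y: "y = u + y'" by (simp add: y'_def)
    have "(x, y') \<in> boundary_pairs L S" using z e[of x y'] by (auto simp: boundary_pairs_def y)
    then show "z \<in> map_prod ((+) u) ((+) u) ` boundary_pairs L S" using z y by force
  qed (auto simp: boundary_pairs_def e)
qed

lemma phi_translate:
  assumes "finite S"
  shows "(\<Sum>(x, y)\<in>boundary_pairs L ((+) u ` S). p * ftau p (edges L \<inter> Pow ((+) u ` S)) u x) = phi L p S"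
proof -
  have im: "edges L \<inter> Pow ((+) u ` S) = (`) ((+) u) ` (edges L \<inter> Pow S)"
  proof (intro set_eqI iffI)
    fix e assume "e \<in> edges L \<inter> Pow ((+) u ` S)"
    then obtain e' where "e = (+) u ` e'" "e' \<subseteq> S" "e \<in> edges L" by (auto simp: subset_image_iff)
    then show "e \<in> (`) ((+) u) ` (edges L \<inter> Pow S)" by (auto simp: translate_edge_iff)
  qed (auto simp: translate_edge_iff)
  have "ftau p (edges L \<inter> Pow ((+) u ` S)) u (u + x) = ftau p (edges L \<inter> Pow S) 0 x" for x
    using ftau_translate[OF finite_edges_Pow[OF assms], of p u L 0 x] unfolding im by simp
  then show ?thesis
    unfolding boundary_pairs_translate phi_def
    by (subst sum.reindex) (auto simp: inj_on_def intro!: sum.cong)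
qed

text \<open>
  A path from \<open>u\<close> that leaves the translate of \<open>S\<close> to \<open>u\<close> does so through a boundary edge, after which a new,
  edge-disjoint connection starts. By the BK inequality the largest susceptibility \<open>m\<close> over all starting points in
  a cube satisfies \<open>m \<le> |S| + \<phi>\<^sub>p(S) m\<close>. In a cube \<open>m\<close> is finite, so this can be solved for \<open>m\<close>, and the
  solution does not depend on the cube.
\<close>
lemma finite_susceptibility_if_phi_less_1:
  fixes S :: "(int ^ 'd::finite) set"
  assumes p: "p \<in> {0..1}" and S: "finite S" "0 \<in> S" and phi: "phi L p S < 1"
  shows "\<exists>M. \<forall>Z :: (int ^ 'd) set. finite Z \<longrightarrow> (\<Sum>z\<in>Z. tau L p z) \<le> M"
proof -
  define M where "M = real (card S) / (1 - phi L p S)"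
  have bound: "(\<Sum>z\<in>(cube n :: (int ^ 'd) set). ftau p (cube_edges L n) 0 z) \<le> M" for n
  proof -
    define V where "V = (cube n :: (int ^ 'd) set)"
    define F where "F = (cube_edges L n :: (int ^ 'd) set set)"
    have fin: "finite F" "finite V" "0 \<in> V" by (auto simp: F_def V_def)
    define X where "X u = (\<Sum>z\<in>V. ftau p F u z)" for u
    define m where "m = Max (X ` V)"
    have m: "X u \<le> m" if "u \<in> V" for u unfolding m_def using fin that by auto
    have X0: "0 \<le> X u" for u unfolding X_def using p by (auto intro!: sum_nonneg)
    have step: "X u \<le> real (card S) + phi L p S * m" if "u \<in> V" for u
    proof -
      define S' where "S' = (+) u ` S"
      define I where "I = boundary_pairs L S'"
      have fin': "finite S'" "finite I" "card S' = card S" and u: "u \<in> S'"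
        using S by (auto simp: S'_def I_def card_image)
      let ?k = "\<lambda>x y z. ftau p (edges L \<inter> Pow S') u x * (if y \<in> V then p * ftau p F y z else 0)"
      have far: "ftau p F u z \<le> (\<Sum>(x, y)\<in>I. ?k x y z)"
        if z: "z \<notin> S'" for z
      proof -
        let ?in = "\<lambda>x \<omega>. conn (\<omega> \<inter> Pow S') u x" and ?out = "\<lambda>y \<omega>. conn \<omega> y z"
        have "ftau p F u z \<le> (\<Sum>(x, y)\<in>I. bprob p F (?in x \<box> (\<lambda>\<omega>. {x, y} \<in> \<omega>) \<box> ?out y))"
          unfolding case_prod_unfold
        proof (rule bprob_union_bound[OF p fin'(2)])
          fix \<eta> assume \<eta>: "\<eta> \<subseteq> F" "conn \<eta> u z"
          obtain x y where xy: "x \<in> S'" "y \<in> - S'" "(?in x \<box> (\<lambda>\<omega>. {x, y} \<in> \<omega>) \<box> ?out y) \<eta>"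
            using conn_exit[OF \<eta>(2) u z] by blast
          then have "{x, y} \<in> \<eta>" unfolding disj_occ_def by blast
          then have "(x, y) \<in> I" using xy \<eta>(1) by (auto simp: I_def boundary_pairs_def F_def cube_edges_def)
          then show "\<exists>i\<in>I. (?in (fst i) \<box> (\<lambda>\<omega>. {fst i, snd i} \<in> \<omega>) \<box> ?out (snd i)) \<eta>"
            using xy(3) by (intro bexI[of _ "(x, y)"]) auto
        qed
        also have "\<dots> \<le> (\<Sum>(x, y)\<in>I. ?k x y z)"
          unfolding case_prod_unfold
        proof (rule sum_mono)
          fix i assume "i \<in> I"
          let ?x = "fst i" and ?y = "snd i"
          have inc: "increasing_event (?in ?x)"
            by (rule increasingI) (erule conn_mono, blast)
          have inc2: "increasing_event (\<lambda>\<omega>. {?x, ?y} \<in> \<omega>)"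
            by (rule increasingI) blast
          have "bprob p F (?in ?x \<box> (\<lambda>\<omega>. {?x, ?y} \<in> \<omega>) \<box> ?out ?y)
              \<le> bprob p F (?in ?x) * bprob p F ((\<lambda>\<omega>. {?x, ?y} \<in> \<omega>) \<box> ?out ?y)"
            by (rule bk_inequality[OF fin(1) p inc increasing_disj_occ])
          also have "\<dots> \<le> bprob p F (?in ?x) * (bprob p F (\<lambda>\<omega>. {?x, ?y} \<in> \<omega>) * ftau p F ?y z)"
            using p by (intro mult_left_mono bk_inequality fin(1) increasing_conn inc2) auto
          also have "\<dots> \<le> ftau p (edges L \<inter> Pow S') u ?x * (if ?y \<in> V then p * ftau p F ?y z else 0)"
          proof (intro mult_mono)
            have "bprob p F (?in ?x) = ftau p (F \<inter> Pow S') u ?x"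
              unfolding bprob_def by (rule bexp_restrict[OF fin(1)])
            also have "\<dots> \<le> ftau p (edges L \<inter> Pow S') u ?x"
              using p fin'(1) by (intro ftau_mono_edges) (auto simp: F_def cube_edges_def)
            finally show "bprob p F (?in ?x) \<le> ftau p (edges L \<inter> Pow S') u ?x" .
            have "{?x, ?y} \<in> F \<Longrightarrow> ?y \<in> V" by (auto simp: F_def V_def cube_edges_def)
            then show "bprob p F (\<lambda>\<omega>. {?x, ?y} \<in> \<omega>) * ftau p F ?y z \<le> (if ?y \<in> V then p * ftau p F ?y z else 0)"
              using p by (auto simp: bprob_single[OF fin(1)])
          qed (use p in auto)
          finally show "bprob p F (?in ?x \<box> (\<lambda>\<omega>. {?x, ?y} \<in> \<omega>) \<box> ?out ?y)
            \<le> ftau p (edges L \<inter> Pow S') u ?x * (if ?y \<in> V then p * ftau p F ?y z else 0)" .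
        qed
        finally show ?thesis .
      qed
      have "X u = (\<Sum>z\<in>V \<inter> S'. ftau p F u z) + (\<Sum>z\<in>V - S'. ftau p F u z)"
        unfolding X_def using fin by (intro sum.Int_Diff)
      also have "(\<Sum>z\<in>V \<inter> S'. ftau p F u z) \<le> real (card S)"
      proof -
        have "(\<Sum>z\<in>V \<inter> S'. ftau p F u z) \<le> (\<Sum>z\<in>V \<inter> S'. 1)"
          using fin p by (intro sum_mono bprob_le_1) auto
        also have "\<dots> \<le> real (card S)"
          using fin' by (simp flip: fin'(3) add: card_mono)
        finally show ?thesis .
      qed
      also have "(\<Sum>z\<in>V - S'. ftau p F u z)
          \<le> (\<Sum>z\<in>V - S'. \<Sum>(x, y)\<in>I. ?k x y z)"
        using far by (intro sum_mono) auto
      also have "\<dots> \<le> (\<Sum>z\<in>V. \<Sum>(x, y)\<in>I. ?k x y z)"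
        using fin p by (intro sum_mono2) (auto intro!: sum_nonneg mult_nonneg_nonneg)
      also have "\<dots> = (\<Sum>(x, y)\<in>I. \<Sum>z\<in>V. ?k x y z)"
        unfolding case_prod_unfold by (rule sum.swap)
      also have "\<dots> = (\<Sum>(x, y)\<in>I. ftau p (edges L \<inter> Pow S') u x * (if y \<in> V then p * X y else 0))"
        by (intro sum.cong) (auto simp: X_def sum_distrib_left)
      also have "\<dots> \<le> (\<Sum>(x, y)\<in>I. p * ftau p (edges L \<inter> Pow S') u x * m)"
        unfolding case_prod_unfold
      proof (rule sum_mono)
        fix i assume "i \<in> I"
        have "(if snd i \<in> V then p * X (snd i) else 0) \<le> p * m"
          using m X0 p that by (auto intro!: mult_left_mono mult_nonneg_nonneg order.trans[OF X0 m])
        then have "ftau p (edges L \<inter> Pow S') u (fst i) * (if snd i \<in> V then p * X (snd i) else 0)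
            \<le> ftau p (edges L \<inter> Pow S') u (fst i) * (p * m)"
          using p by (intro mult_left_mono) auto
        then show "ftau p (edges L \<inter> Pow S') u (fst i) * (if snd i \<in> V then p * X (snd i) else 0)
            \<le> p * ftau p (edges L \<inter> Pow S') u (fst i) * m"
          by (simp add: mult_ac)
      qed
      also have "\<dots> = phi L p S * m"
        unfolding phi_translate[OF S(1), where L = L and p = p and u = u, folded S'_def I_def, symmetric] sum_distrib_right
        by (intro sum.cong) auto
      finally show ?thesis by simp
    qed
    have "m \<in> X ` V" unfolding m_def using fin by (intro Max_in) auto
    then have "m \<le> real (card S) + phi L p S * m" using step by auto
    then have "m \<le> M" using phi by (simp add: M_def field_simps)
    then have "X 0 \<le> M" using m[of 0] by (auto simp: V_def)
    then show ?thesis by (simp add: X_def V_def F_def)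
  qed
  have "(\<Sum>z\<in>Z. tau L p z) \<le> M" if Z: "finite Z" for Z :: "(int ^ 'd) set"
  proof -
    obtain k where k: "Z \<subseteq> cube k" using finite_subset_cube[OF Z] by auto
    have "(\<lambda>n. \<Sum>z\<in>Z. ftau p (cube_edges L n) 0 z) \<longlonglongrightarrow> (\<Sum>z\<in>Z. tau L p (z - 0))"
      by (intro tendsto_sum ftau_tendsto_tau p)
    moreover have "(\<Sum>z\<in>Z. ftau p (cube_edges L n) 0 z) \<le> M" if "n \<ge> k" for n
    proof -
      have "(\<Sum>z\<in>Z. ftau p (cube_edges L n) 0 z) \<le> (\<Sum>z\<in>(cube n :: (int ^ 'd) set). ftau p (cube_edges L n) 0 z)"
        using k cube_mono[OF that] p by (intro sum_mono2) auto
      then show ?thesis using bound[of n] by simp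
    qed
    ultimately show ?thesis by (intro LIMSEQ_le_const2) auto
  qed
  then show ?thesis by blast
qed

text \<open>
  Suppose that the origin does not reach the outside of \<open>V\<close>, and let \<open>S\<close>, called the hole, be the set of vertices
  of \<open>V\<close> that do not. A closed edge from \<open>x \<in> S\<close> to \<open>y \<notin> S\<close> is pivotal as soon as the origin reaches \<open>x\<close> within
  \<open>S\<close>. Whether the hole equals \<open>S\<close> depends only on edges that are not inside \<open>S\<close>, so given that it does,
  the edges inside \<open>S\<close> are still independent and the expected number of such pivotal edges is at least
  \<open>\<phi>\<^sub>r(S) \<ge> 1\<close>.
\<close>
lemma escape_derivative:
  fixes V :: "(int ^ 'd::finite) set"
  assumes r: "r \<in> {0..1}" and V: "finite V" "0 \<in> V"
    and phi: "\<And>S :: (int ^ 'd) set. finite S \<Longrightarrow> 0 \<in> S \<Longrightarrow> 1 \<le> phi L r S"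
  defines "A \<equiv> \<lambda>\<eta>. \<exists>y. y \<notin> V \<and> conn \<eta> 0 y"
  defines "F \<equiv> {e \<in> edges L. e \<inter> V \<noteq> {}}"
  shows "1 - bprob r F A \<le> (\<Sum>e\<in>F. bprob r F (pivot A e))"
proof -
  define esc where "esc \<eta> z \<longleftrightarrow> (\<exists>y. y \<notin> V \<and> conn \<eta> z y)" for \<eta> and z :: "int ^ 'd"
  define hole where "hole \<eta> = {z \<in> V. \<not> esc \<eta> z}" for \<eta>
  have F: "finite F" unfolding F_def by (rule finite_edges_touching[OF V(1)])
  have esc_mono: "esc \<eta> z \<Longrightarrow> \<eta> \<subseteq> \<zeta> \<Longrightarrow> esc \<zeta> z" for \<eta> \<zeta> z
    unfolding esc_def by (meson conn_mono)
  (* If no vertex of S can escape without the edges inside S, these edges help no vertex: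
     following an escaping path backwards from the outside, it never enters S. *)
  have esc_outside: "esc (\<eta> - Pow S) z" if sealed: "\<forall>z\<in>S. \<not> esc (\<eta> - Pow S) z" and escapes: "esc \<eta> z" for \<eta> S z
  proof -
    obtain y where y: "y \<notin> V" "conn \<eta> z y" using escapes by (auto simp: esc_def)
    from y(2) show ?thesis unfolding conn_def
    proof (induction rule: converse_rtranclp_induct)
      case base
      show ?case using y(1) unfolding esc_def by (intro exI[of _ y]) simp
    next
      case (step z z')
      then have "z' \<notin> S" using sealed by auto
      then have "{z, z'} \<in> \<eta> - Pow S" using step by auto
      from conn_trans[OF conn_edge[OF this]] show ?case using step.IH unfolding esc_def by blast
    qed
  qed
  have same: "esc (\<eta> - Pow S) z \<longleftrightarrow> esc \<eta> z" if "\<forall>z\<in>S. \<not> esc (\<eta> - Pow S) z" for \<eta> S z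
    using esc_outside[OF that, of z] esc_mono[of "\<eta> - Pow S" z \<eta>] by (metis Diff_subset)
  have hole_iff: "hole \<eta> = S \<longleftrightarrow> hole (\<eta> - Pow S) = S" for \<eta> S
  proof
    assume h: "hole \<eta> = S"
    have "\<not> esc (\<eta> - Pow S) z" if "z \<in> S" for z
    proof -
      have "\<not> esc \<eta> z" using h that by (auto simp: hole_def)
      then show ?thesis using esc_mono[of "\<eta> - Pow S" z \<eta>] by (metis Diff_subset)
    qed
    then show "hole (\<eta> - Pow S) = S" using h same[of S \<eta>] by (simp add: hole_def)
  next
    assume h: "hole (\<eta> - Pow S) = S"
    then have "\<forall>z\<in>S. \<not> esc (\<eta> - Pow S) z" by (auto simp: hole_def)
    then show "hole \<eta> = S" using h same[of S \<eta>] by (simp add: hole_def)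
  qed
  have A_iff: "A \<eta> \<longleftrightarrow> 0 \<notin> hole \<eta>" for \<eta>
    using V by (auto simp: A_def hole_def esc_def)
  have pointwise: "(\<Sum>S | S \<subseteq> V \<and> 0 \<in> S. \<Sum>(x, y)\<in>boundary_pairs L S.
       of_bool (conn (\<eta> \<inter> Pow S) 0 x) * of_bool (hole (\<eta> - Pow S) = S))
     \<le> (\<Sum>e\<in>F. of_bool (pivot A e \<eta>) :: real)" if \<eta>: "\<eta> \<subseteq> F" for \<eta>
  proof (cases "A \<eta>")
    case True
    then have "\<not> (hole (\<eta> - Pow S) = S)" if "0 \<in> S" for S
      using that hole_iff[of \<eta> S] by (auto simp: A_iff)
    then have "(\<Sum>S | S \<subseteq> V \<and> 0 \<in> S. \<Sum>(x, y)\<in>boundary_pairs L S.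
       of_bool (conn (\<eta> \<inter> Pow S) 0 x) * of_bool (hole (\<eta> - Pow S) = S)) = (0 :: real)"
      by (intro sum.neutral) auto
    then show ?thesis by (simp add: sum_nonneg)
  next
    case False
    define H where "H = hole \<eta>"
    have H: "H \<subseteq> V" "0 \<in> H" using False by (auto simp: H_def hole_def A_iff)
    define I where "I = {(x, y) \<in> boundary_pairs L H. conn (\<eta> \<inter> Pow H) 0 x}"
    have finH: "finite (boundary_pairs L H)" using finite_subset[OF H(1) V(1)] by simp
    have "(\<Sum>S | S \<subseteq> V \<and> 0 \<in> S. \<Sum>(x, y)\<in>boundary_pairs L S.
       of_bool (conn (\<eta> \<inter> Pow S) 0 x) * of_bool (hole (\<eta> - Pow S) = S))
      = (\<Sum>S\<in>{H}. \<Sum>(x, y)\<in>boundary_pairs L S.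
       of_bool (conn (\<eta> \<inter> Pow S) 0 x) * (of_bool (hole (\<eta> - Pow S) = S) :: real))"
    proof (rule sum.mono_neutral_right)
      show "\<forall>S\<in>{S. S \<subseteq> V \<and> 0 \<in> S} - {H}. (\<Sum>(x, y)\<in>boundary_pairs L S.
       of_bool (conn (\<eta> \<inter> Pow S) 0 x) * (of_bool (hole (\<eta> - Pow S) = S) :: real)) = 0"
        using hole_iff[of \<eta>] unfolding H_def by (auto intro!: sum.neutral)
    qed (use H V in auto)
    also have "\<dots> = (\<Sum>(x, y)\<in>boundary_pairs L H. of_bool (conn (\<eta> \<inter> Pow H) 0 x))"
      using hole_iff[of \<eta> H] by (simp add: H_def)
    also have "\<dots> = (\<Sum>i\<in>I. 1)"
      unfolding I_def using finH by (intro sum.mono_neutral_cong_right) auto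
    also have "\<dots> = (\<Sum>e\<in>(\<lambda>(x, y). {x, y}) ` I. 1)"
    proof (subst sum.reindex)
      show "inj_on (\<lambda>(x, y). {x, y}) I"
        by (auto intro!: inj_onI simp: I_def boundary_pairs_def doubleton_eq_iff)
    qed auto
    also have "\<dots> \<le> (\<Sum>e\<in>F. of_bool (pivot A e \<eta>))"
    proof -
      have piv: "{x, y} \<in> F \<and> pivot A {x, y} \<eta>" if xy: "(x, y) \<in> I" for x y
      proof
        show "{x, y} \<in> F" using xy H by (auto simp: I_def boundary_pairs_def F_def)
        have y: "y \<notin> H" and x: "conn \<eta> 0 x"
          using xy by (auto simp: I_def boundary_pairs_def elim: conn_mono)
        have "esc \<eta> y"
        proof (cases "y \<in> V")
          case False
          then show ?thesis unfolding esc_def by (intro exI[of _ y]) simp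
        qed (use y in \<open>simp add: H_def hole_def\<close>)
        then obtain w where w: "w \<notin> V" "conn \<eta> y w" by (auto simp: esc_def)
        have "conn (insert {x, y} \<eta>) 0 w"
          by (rule conn_trans[OF conn_mono[OF x] conn_trans[OF conn_edge conn_mono[OF w(2)]]]) auto
        then have "A (insert {x, y} \<eta>)" using w by (auto simp: A_def)
        moreover have "\<not> A (\<eta> - {{x, y}})"
          using False conn_mono[of "\<eta> - {{x, y}}" _ _ \<eta>] by (auto simp: A_def)
        ultimately show "pivot A {x, y} \<eta>" by (simp add: pivot_def)
      qed
      have "(\<Sum>e\<in>(\<lambda>(x, y). {x, y}) ` I. 1) = (\<Sum>e\<in>(\<lambda>(x, y). {x, y}) ` I. of_bool (pivot A e \<eta>) :: real)"
        using piv by (intro sum.cong) auto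
      also have "\<dots> \<le> (\<Sum>e\<in>F. of_bool (pivot A e \<eta>))"
        using piv F by (intro sum_mono2) auto
      finally show ?thesis .
    qed
    finally show ?thesis .
  qed
  have holeS: "bprob r F (\<lambda>\<eta>. hole \<eta> = S) \<le> (\<Sum>(x, y)\<in>boundary_pairs L S.
      bexp r F (\<lambda>\<eta>. of_bool (conn (\<eta> \<inter> Pow S) 0 x) * of_bool (hole (\<eta> - Pow S) = S)))"
    if S: "S \<subseteq> V" "0 \<in> S" for S
  proof -
    have fin: "finite S" using finite_subset[OF S(1) V(1)] .
    have FS: "F \<inter> Pow S = edges L \<inter> Pow S"
      using edges_Pow_subset[of L S] S unfolding F_def by blast
    have conn_S: "bexp r F (\<lambda>\<eta>. of_bool (conn (\<eta> \<inter> Pow S) 0 x)) = ftau r (edges L \<inter> Pow S) 0 x" for x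
      using bexp_restrict[OF F, of r "\<lambda>\<eta>. of_bool (conn \<eta> 0 x)" "Pow S"] by (simp add: FS bprob_def)
    have hole_S: "bexp r F (\<lambda>\<eta>. of_bool (hole (\<eta> - Pow S) = S)) = bprob r F (\<lambda>\<eta>. hole \<eta> = S)"
      unfolding bprob_def using hole_iff[of _ S] by simp
    have "1 \<le> phi L r S" by (rule phi[OF fin S(2)])
    (* The factor r in phi is
       dropped here, since only the lower bound 1 matters. *)
    also have "\<dots> \<le> (\<Sum>(x, y)\<in>boundary_pairs L S. ftau r (edges L \<inter> Pow S) 0 x)"
      unfolding phi_def using r by (intro sum_mono) (auto intro!: mult_left_le_one_le)
    finally have "bprob r F (\<lambda>\<eta>. hole \<eta> = S)
      \<le> (\<Sum>(x, y)\<in>boundary_pairs L S. ftau r (edges L \<inter> Pow S) 0 x) * bprob r F (\<lambda>\<eta>. hole \<eta> = S)"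
      using r mult_right_mono[of 1 _ "bprob r F (\<lambda>\<eta>. hole \<eta> = S)"] by simp
    also have "\<dots> = (\<Sum>(x, y)\<in>boundary_pairs L S.
      bexp r F (\<lambda>\<eta>. of_bool (conn (\<eta> \<inter> Pow S) 0 x) * of_bool (hole (\<eta> - Pow S) = S)))"
      unfolding sum_distrib_right case_prod_unfold
      by (intro sum.cong refl) (subst bexp_indep[OF F, where f = "\<lambda>\<eta>. of_bool (conn \<eta> 0 _)"], simp add: conn_S hole_S)
    finally show ?thesis .
  qed
  have "1 - bprob r F A = bprob r F (\<lambda>\<eta>. \<not> A \<eta>)"
  proof -
    have "bprob r F A + bprob r F (\<lambda>\<eta>. \<not> A \<eta>) = bexp r F (\<lambda>\<eta>. 1)"
      unfolding bprob_def bexp_add[symmetric] by (rule bexp_cong) auto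
    then show ?thesis by (simp add: bexp_const[OF F])
  qed
  also have "\<dots> \<le> (\<Sum>S | S \<subseteq> V \<and> 0 \<in> S. bprob r F (\<lambda>\<eta>. hole \<eta> = S))"
    using V by (intro bprob_union_bound[OF r]) (auto simp: A_iff hole_def)
  also have "\<dots> \<le> (\<Sum>S | S \<subseteq> V \<and> 0 \<in> S. \<Sum>(x, y)\<in>boundary_pairs L S.
      bexp r F (\<lambda>\<eta>. of_bool (conn (\<eta> \<inter> Pow S) 0 x) * of_bool (hole (\<eta> - Pow S) = S)))"
    using holeS by (intro sum_mono) auto
  also have "\<dots> = bexp r F (\<lambda>\<eta>. \<Sum>S | S \<subseteq> V \<and> 0 \<in> S. \<Sum>(x, y)\<in>boundary_pairs L S.
      of_bool (conn (\<eta> \<inter> Pow S) 0 x) * of_bool (hole (\<eta> - Pow S) = S))"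
    by (simp add: bexp_sum case_prod_unfold)
  also have "\<dots> \<le> bexp r F (\<lambda>\<eta>. \<Sum>e\<in>F. of_bool (pivot A e \<eta>))"
    using pointwise by (rule bexp_mono[OF r])
  also have "\<dots> = (\<Sum>e\<in>F. bprob r F (pivot A e))"
    by (simp add: bexp_sum bprob_def)
  finally show ?thesis .
qed

text \<open>
  The probability \<open>g\<close> of leaving a cube satisfies \<open>g' \<ge> 1 - g\<close> to the right of \<open>p\<close>. So either \<open>g \<ge> 1/2\<close> at \<open>q\<close>, or
  \<open>g' \<ge> 1/2\<close> between \<open>p\<close> and \<open>q\<close>.
\<close>
lemma theta_pos_if_phi_ge_1:
  assumes p: "0 \<le> p" "p < q" "q \<le> 1"
    and phi: "\<And>S :: (int ^ 'd::finite) set. finite S \<Longrightarrow> 0 \<in> S \<Longrightarrow> 1 \<le> phi L p S"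
  shows "(q - p) / 2 \<le> theta TYPE('d) L q"
proof (rule theta_ge)
  fix n
  let ?V = "cube n :: (int ^ 'd) set"
  let ?F = "{e \<in> edges L. e \<inter> ?V \<noteq> {}}"
  let ?A = "\<lambda>\<eta>. \<exists>y. y \<notin> ?V \<and> conn \<eta> 0 y"
  let ?g = "\<lambda>r. bprob r ?F ?A"
  show fin: "finite ?F" by (rule finite_edges_touching) simp
  have inc: "increasing_event ?A"
    by (rule increasingI) (meson conn_mono)
  show "(q - p) / 2 \<le> ?g q"
  proof (cases "?g q \<le> 1 / 2")
    case True
    have "\<exists>z. p < z \<and> z < q \<and> ?g q - ?g p = (q - p) * (\<Sum>e\<in>?F. bprob z ?F (pivot ?A e))"
      using p by (intro MVT2 russo fin inc) auto
    then obtain z where z: "p < z" "z < q" "?g q - ?g p = (q - p) * (\<Sum>e\<in>?F. bprob z ?F (pivot ?A e))"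
      by blast
    have phi_z: "1 \<le> phi L z S" if "finite S" "0 \<in> S" for S :: "(int ^ 'd) set"
    proof -
      have "phi L p S \<le> phi L z S"
        unfolding phi_def using p z that
        by (intro sum_mono) (auto intro!: mult_mono bprob_mono_p increasing_conn)
      then show ?thesis using phi[OF that] by simp
    qed
    have "?g z \<le> ?g q" using p z by (intro bprob_mono_p fin inc) auto
    then have "1 / 2 \<le> 1 - ?g z" using True by simp
    also have "\<dots> \<le> (\<Sum>e\<in>?F. bprob z ?F (pivot ?A e))"
      using p z by (intro escape_derivative phi_z) auto
    finally have "(q - p) * (1 / 2) \<le> ?g q - ?g p"
      unfolding z(3) using p by (intro mult_left_mono) auto
    moreover have "0 \<le> ?g p" using p by auto
    ultimately show ?thesis by simp
  qed (use p in auto)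
qed (use p in auto)

text \<open>
  If every finite \<open>S\<close> had \<open>\<phi>\<^sub>p(S) \<ge> 1\<close>, there would be percolation at every parameter above \<open>p\<close>, also at the
  one half way to the critical parameter.
\<close>
theorem subcritical_susceptibility_finite:
  assumes L: "L \<ge> 1" and p: "0 \<le> p" "p < p_crit TYPE('d::finite) L"
  shows "\<exists>M. \<forall>Z :: (int ^ 'd) set. finite Z \<longrightarrow> (\<Sum>z\<in>Z. tau L p z) \<le> M"
proof (cases "\<exists>S :: (int ^ 'd) set. finite S \<and> 0 \<in> S \<and> phi L p S < 1")
  case True
  then show ?thesis
    using finite_susceptibility_if_phi_less_1[of p _ L] p p_crit_in(1)[OF L, where 'd = 'd] by auto
next
  case False
  define q where "q = (p + p_crit TYPE('d) L) / 2"
  have q: "p < q" "q < p_crit TYPE('d) L" "q \<le> 1"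
    using p p_crit_in(1)[OF L, where 'd = 'd] by (auto simp: q_def)
  have "(q - p) / 2 \<le> theta TYPE('d) L q"
    using False p q by (intro theta_pos_if_phi_ge_1) force+
  then have "p_crit TYPE('d) L \<le> q" using p q by (intro p_crit_in(2)[OF L]) auto
  then show ?thesis using q by simp
qed

section \<open>Two disjoint clusters and pivotal edges\<close>

lemma bexp_partition:
  assumes "finite I" "\<And>\<eta>. \<eta> \<subseteq> F \<Longrightarrow> c \<eta> \<in> I"
  shows "bexp p F f = (\<Sum>i\<in>I. bexp p F (\<lambda>\<eta>. of_bool (c \<eta> = i) * f \<eta>))"
proof -
  have "bexp p F f = bexp p F (\<lambda>\<eta>. \<Sum>i\<in>I. of_bool (c \<eta> = i) * f \<eta>)"
  proof (rule bexp_cong)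
    fix \<eta> assume "\<eta> \<subseteq> F"
    then have "c \<eta> \<in> I" by (rule assms(2))
    then have "(\<Sum>i\<in>I. of_bool (c \<eta> = i) * f \<eta>) = (\<Sum>i\<in>{c \<eta>}. of_bool (c \<eta> = i) * f \<eta>)"
      using assms(1) by (intro sum.mono_neutral_right) auto
    then show "f \<eta> = (\<Sum>i\<in>I. of_bool (c \<eta> = i) * f \<eta>)" by simp
  qed
  then show ?thesis by (simp add: bexp_sum)
qed

text \<open>
  Whether the cluster of \<open>z\<close> is \<open>C\<close> depends only on the edges that touch \<open>C\<close>: a path that starts in \<open>C\<close> meets
  no other edges before it leaves \<open>C\<close>.
\<close>
lemma cluster_local:
  defines "cl \<equiv> \<lambda>\<eta> z. {y. conn \<eta> z y}"
  assumes "cl (\<eta> \<inter> {e. e \<inter> C \<noteq> {}}) z = C \<or> cl \<eta> z = C"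
  shows "cl \<eta> z = cl (\<eta> \<inter> {e. e \<inter> C \<noteq> {}}) z"
proof -
  let ?\<eta>' = "\<eta> \<inter> {e. e \<inter> C \<noteq> {}}"
  have sub: "cl ?\<eta>' z \<subseteq> cl \<eta> z" by (auto simp: cl_def intro: conn_mono)
  have "y \<in> cl ?\<eta>' z" if "conn \<eta> z y" for y
    using that unfolding conn_def
  proof (induction rule: rtranclp_induct)
    case (step y y')
    have "y \<in> C" using assms(2) step sub by (auto simp: cl_def conn_def)
    then have "{y, y'} \<in> ?\<eta>'" using step by auto
    from conn_edge[OF this] show ?case using step.IH conn_trans by (fastforce simp: cl_def)
  qed (simp add: cl_def)
  then show ?thesis using sub by (auto simp: cl_def)
qed

text \<open>
  Exploring the cluster \<open>C\<close> of \<open>z\<close> reveals only edges that touch \<open>C\<close>. Conditionally on it, \<open>v\<close> and \<open>x\<close> are connected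
  off \<open>C\<close> with probability at least the two-point function minus the probability of a connection
  through some \<open>y \<in> C\<close>, which the BK inequality bounds.
\<close>
lemma avoid_cluster:
  fixes F :: "'v set set"
  assumes r: "r \<in> {0..1}" and F: "finite F" and W: "finite W" "insert z (\<Union>F) \<subseteq> W"
  shows "ftau r F z u * ftau r F v x
      - (\<Sum>y\<in>W. bprob r F (\<lambda>\<eta>. conn \<eta> z u \<and> conn \<eta> z y) * ftau r F v y * ftau r F y x)
    \<le> bprob r F (\<lambda>\<eta>. conn \<eta> z u \<and> conn \<eta> v x \<and> \<not> conn \<eta> z x)"
proof -
  define cl where "cl \<eta> = {y. conn \<eta> z y}" for \<eta>
  define T where "T C = {e. e \<inter> C \<noteq> {}}" for C :: "'v set"
  define k where "k y = ftau r F v y * ftau r F y x" for y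
  have k0: "0 \<le> k y" for y using r by (simp add: k_def)
  have clW: "cl \<eta> \<in> Pow W" if "\<eta> \<subseteq> F" for \<eta>
  proof -
    have "insert z (\<Union>\<eta>) \<subseteq> W" using that W by auto
    then have "conn \<eta> z y \<Longrightarrow> y \<in> W" for y using conn_in_vertices[of \<eta> z y] by auto
    then show ?thesis by (auto simp: cl_def)
  qed
  have cl_iff: "cl \<eta> = C \<longleftrightarrow> cl (\<eta> \<inter> T C) = C" for \<eta> C
    using cluster_local[of \<eta> C z] unfolding cl_def T_def by auto
  have "ftau r F z u * ftau r F v x
      - (\<Sum>y\<in>W. bprob r F (\<lambda>\<eta>. conn \<eta> z u \<and> conn \<eta> z y) * ftau r F v y * ftau r F y x)
    = bexp r F (\<lambda>\<eta>. of_bool (u \<in> cl \<eta>) * (ftau r F v x - (\<Sum>y\<in>W. of_bool (y \<in> cl \<eta>) * k y)))"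
  proof -
    have "bexp r F (\<lambda>\<eta>. of_bool (u \<in> cl \<eta>) * (ftau r F v x - (\<Sum>y\<in>W. of_bool (y \<in> cl \<eta>) * k y)))
      = bexp r F (\<lambda>\<eta>. of_bool (conn \<eta> z u) * ftau r F v x
          - (\<Sum>y\<in>W. of_bool (conn \<eta> z u \<and> conn \<eta> z y) * k y))"
      by (intro bexp_cong) (auto simp: cl_def algebra_simps sum_distrib_left)
    also have "\<dots> = ftau r F z u * ftau r F v x
      - (\<Sum>y\<in>W. bprob r F (\<lambda>\<eta>. conn \<eta> z u \<and> conn \<eta> z y) * k y)"
      unfolding bprob_def bexp_diff bexp_sum bexp_cmult_right ..
    finally show ?thesis by (simp add: k_def mult.assoc)
  qed
  also have "\<dots> = (\<Sum>C\<in>Pow W. bexp r F (\<lambda>\<eta>. of_bool (cl \<eta> = C) *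
      (of_bool (u \<in> cl \<eta>) * (ftau r F v x - (\<Sum>y\<in>W. of_bool (y \<in> cl \<eta>) * k y)))))"
    using W clW by (intro bexp_partition) auto
  also have "\<dots> \<le> (\<Sum>C\<in>Pow W. bexp r F (\<lambda>\<eta>. of_bool (cl \<eta> = C) *
      of_bool (conn \<eta> z u \<and> conn \<eta> v x \<and> \<not> conn \<eta> z x)))"
  proof (rule sum_mono)
    fix C assume C: "C \<in> Pow W"
    then have finC: "finite C" using W finite_subset by auto
    define a where "a = (of_bool (u \<in> C) * (ftau r F v x - (\<Sum>y\<in>C. k y)) :: real)"
    have sumC: "(\<Sum>y\<in>W. of_bool (y \<in> C) * k y) = (\<Sum>y\<in>C. k y)"
      using C W by (intro sum.mono_neutral_cong_right) auto
    have "bexp r F (\<lambda>\<eta>. of_bool (cl \<eta> = C) * (of_bool (u \<in> cl \<eta>) * (ftau r F v x - (\<Sum>y\<in>W. of_bool (y \<in> cl \<eta>) * k y))))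
        = bexp r F (\<lambda>\<eta>. of_bool (cl \<eta> = C) * a)"
      by (rule bexp_cong) (auto simp: a_def sumC)
    also have "\<dots> = bprob r F (\<lambda>\<eta>. cl \<eta> = C) * a"
      by (simp add: bprob_def bexp_cmult_right)
    also have "\<dots> \<le> bexp r F (\<lambda>\<eta>. of_bool (cl \<eta> = C) *
      of_bool (conn \<eta> z u \<and> conn \<eta> v x \<and> \<not> conn \<eta> z x))" (is "_ \<le> ?R")
    proof (cases "u \<in> C \<and> v \<notin> C")
      case False
      (* For v in C the lower bound is trivial, because the term y = v of the sum already equals
         the two-point function. *)
      have "a \<le> 0"
      proof (cases "u \<in> C")
        case True
        then have "v \<in> C" using False by simp
        have "ftau r F v v = 1" by (rule bprob_True[OF F]) simp
        then have "ftau r F v x = k v" by (simp add: k_def)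
        also have "\<dots> \<le> (\<Sum>y\<in>C. k y)" using \<open>v \<in> C\<close> finC k0 by (intro member_le_sum) auto
        finally show ?thesis by (simp add: a_def)
      qed (simp add: a_def)
      then have "bprob r F (\<lambda>\<eta>. cl \<eta> = C) * a \<le> 0" using r by (intro mult_nonneg_nonpos) auto
      also have "0 \<le> ?R" by (rule bexp_nonneg[OF r]) simp
      finally show ?thesis .
    next
      case True
      have "a \<le> bprob r F (\<lambda>\<eta>. conn (\<eta> - T C) v x)"
      proof -
        have "ftau r F v x \<le> bexp r F (\<lambda>\<eta>. of_bool (conn (\<eta> - T C) v x)
            + (\<Sum>y\<in>C. of_bool (((\<lambda>\<omega>. conn \<omega> v y) \<box> (\<lambda>\<omega>. conn \<omega> y x)) \<eta>)))"
          unfolding bprob_def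
        proof (rule bexp_mono[OF r])
          fix \<eta>
          have eq: "{e \<in> \<eta>. e \<inter> C = {}} = \<eta> - T C" by (auto simp: T_def)
          show "of_bool (conn \<eta> v x) \<le> of_bool (conn (\<eta> - T C) v x)
            + (\<Sum>y\<in>C. of_bool (((\<lambda>\<omega>. conn \<omega> v y) \<box> (\<lambda>\<omega>. conn \<omega> y x)) \<eta>) :: real)"
          proof (cases "conn \<eta> v x \<and> \<not> conn (\<eta> - T C) v x")
            case True
            then obtain y where y: "y \<in> C" "((\<lambda>\<omega>. conn \<omega> v y) \<box> (\<lambda>\<omega>. conn \<omega> y x)) \<eta>"
              using conn_through[of \<eta> v x C] unfolding eq by auto
            then have "1 \<le> (\<Sum>y\<in>C. of_bool (((\<lambda>\<omega>. conn \<omega> v y) \<box> (\<lambda>\<omega>. conn \<omega> y x)) \<eta>) :: real)"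
              using member_le_sum[of y C "\<lambda>y. of_bool (((\<lambda>\<omega>. conn \<omega> v y) \<box> (\<lambda>\<omega>. conn \<omega> y x)) \<eta>) :: real"] finC
              by auto
            then show ?thesis using True by simp
          qed (auto intro!: sum_nonneg add_nonneg_nonneg)
        qed
        also have "\<dots> = bprob r F (\<lambda>\<eta>. conn (\<eta> - T C) v x)
            + (\<Sum>y\<in>C. bprob r F ((\<lambda>\<omega>. conn \<omega> v y) \<box> (\<lambda>\<omega>. conn \<omega> y x)))"
          by (simp add: bexp_add bexp_sum bprob_def)
        also have "\<dots> \<le> bprob r F (\<lambda>\<eta>. conn (\<eta> - T C) v x) + (\<Sum>y\<in>C. k y)"
          unfolding k_def by (intro add_left_mono sum_mono bk_inequality F r increasing_conn)
        finally show ?thesis using True by (simp add: a_def)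
      qed
      have cl_eq: "(\<lambda>\<eta>. of_bool (cl \<eta> = C)) = (\<lambda>\<eta>. of_bool (cl (\<eta> \<inter> T C) = C) :: real)"
        by (rule ext, rule arg_cong[where f = of_bool], rule cl_iff)
      from \<open>a \<le> _\<close> have "bprob r F (\<lambda>\<eta>. cl \<eta> = C) * a
          \<le> bprob r F (\<lambda>\<eta>. cl \<eta> = C) * bprob r F (\<lambda>\<eta>. conn (\<eta> - T C) v x)"
        using r by (intro mult_left_mono) auto
      also have "\<dots> = bexp r F (\<lambda>\<eta>. of_bool (cl (\<eta> \<inter> T C) = C) * of_bool (conn (\<eta> - T C) v x))"
        unfolding bprob_def cl_eq
        by (subst bexp_indep[OF F, where f = "\<lambda>\<eta>. of_bool (cl \<eta> = C)" and g = "\<lambda>\<eta>. of_bool (conn \<eta> v x)"]) simp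
      also have "\<dots> \<le> ?R"
      proof (rule bexp_mono[OF r])
        fix \<eta>
        have "conn \<eta> z u \<and> conn \<eta> v x \<and> \<not> conn \<eta> z x" if cl: "cl \<eta> = C" and vx: "conn (\<eta> - T C) v x"
        proof (intro conjI)
          have "x \<notin> C" using conn_in_vertices[OF vx] True by (auto simp: T_def)
          then show "\<not> conn \<eta> z x" using cl by (auto simp: cl_def)
          show "conn \<eta> z u" using cl True by (auto simp: cl_def)
          show "conn \<eta> v x" using conn_mono[OF vx] by auto
        qed
        then show "of_bool (cl (\<eta> \<inter> T C) = C) * of_bool (conn (\<eta> - T C) v x)
            \<le> of_bool (cl \<eta> = C) * (of_bool (conn \<eta> z u \<and> conn \<eta> v x \<and> \<not> conn \<eta> z x) :: real)"
          unfolding cl_iff[of \<eta> C, symmetric] by simp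
      qed
      finally show ?thesis .
    qed
    finally show "bexp r F (\<lambda>\<eta>. of_bool (cl \<eta> = C) * (of_bool (u \<in> cl \<eta>) * (ftau r F v x - (\<Sum>y\<in>W. of_bool (y \<in> cl \<eta>) * k y)))) \<le> ?R" .
  qed
  also have "\<dots> = bprob r F (\<lambda>\<eta>. conn \<eta> z u \<and> conn \<eta> v x \<and> \<not> conn \<eta> z x)"
    unfolding bprob_def using W clW by (intro bexp_partition[symmetric]) auto
  finally show ?thesis .
qed

lemma tree_graph:
  assumes r: "r \<in> {0..1}" and F: "finite F" and W: "finite W" "insert x (\<Union>F) \<subseteq> W"
  shows "bprob r F (\<lambda>\<eta>. conn \<eta> x u \<and> conn \<eta> x y) \<le> (\<Sum>z\<in>W. ftau r F x z * ftau r F z u * ftau r F z y)"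
proof -
  let ?B = "\<lambda>z. (\<lambda>\<omega>. conn \<omega> x z) \<box> (\<lambda>\<omega>. conn \<omega> z u) \<box> (\<lambda>\<omega>. conn \<omega> z y)"
  have "bprob r F (\<lambda>\<eta>. conn \<eta> x u \<and> conn \<eta> x y) \<le> (\<Sum>z\<in>W. bprob r F (?B z))"
  proof (rule bprob_union_bound[OF r W(1)])
    fix \<eta> assume \<eta>: "\<eta> \<subseteq> F" "conn \<eta> x u \<and> conn \<eta> x y"
    then obtain z where z: "?B z \<eta>" using conn_tree[of \<eta> x u y] by blast
    then obtain \<alpha> where "\<alpha> \<subseteq> \<eta>" "conn \<alpha> x z" unfolding disj_occ_def by auto
    then have "z \<in> W" using conn_in_vertices[of \<alpha> x z] W(2) \<eta>(1) by auto
    then show "\<exists>z\<in>W. ?B z \<eta>" using z by auto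
  qed
  also have "\<dots> \<le> (\<Sum>z\<in>W. ftau r F x z * (ftau r F z u * ftau r F z y))"
  proof (rule sum_mono)
    fix z
    have "bprob r F (?B z) \<le> ftau r F x z * bprob r F ((\<lambda>\<omega>. conn \<omega> z u) \<box> (\<lambda>\<omega>. conn \<omega> z y))"
      by (intro bk_inequality F r increasing_conn increasing_disj_occ)
    also have "\<dots> \<le> ftau r F x z * (ftau r F z u * ftau r F z y)"
      using r by (intro mult_left_mono bk_inequality F increasing_conn) auto
    finally show "bprob r F (?B z) \<le> ftau r F x z * (ftau r F z u * ftau r F z y)" .
  qed
  finally show ?thesis by (simp add: mult.assoc)
qed

text \<open>
  If opening all edges of a list makes \<open>A\<close> occur, there is a first edge that does, and this edge is pivotal in the
  configuration with its predecessors opened. Each opened predecessor costs a factor \<open>1 / r\<close>.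
\<close>
lemma open_one_by_one:
  assumes F: "finite F" and r: "0 < r" "r \<le> 1" and A: "increasing_event A" and es: "set es \<subseteq> F"
  shows "bprob r F (\<lambda>\<eta>. \<not> A \<eta> \<and> A (\<eta> \<union> set es))
    \<le> (\<Sum>e\<leftarrow>es. bprob r F (pivot A e)) / r ^ length es"
  using es
proof (induction es)
  case Nil
  then show ?case by (simp add: bprob_def bexp_const[OF F])
next
  case (Cons e es)
  let ?s = "\<Sum>e\<leftarrow>es. bprob r F (pivot A e)"
  let ?B = "\<lambda>\<eta>. \<not> A \<eta> \<and> A (\<eta> \<union> set es)"
  have r': "r \<in> {0..1}" using r by simp
  have s: "0 \<le> ?s" using r' by (intro sum_list_nonneg) auto
  have "bprob r F (\<lambda>\<eta>. \<not> A \<eta> \<and> A (\<eta> \<union> set (e # es)))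
      \<le> bexp r F (\<lambda>\<eta>. of_bool (pivot A e \<eta>) + of_bool (?B (insert e \<eta>)))"
    unfolding bprob_def
  proof (rule bexp_mono[OF r'])
    fix \<eta>
    have "\<not> A \<eta> \<Longrightarrow> \<not> A (\<eta> - {e})" using increasingD[OF A, of "\<eta> - {e}" \<eta>] by blast
    then show "of_bool (\<not> A \<eta> \<and> A (\<eta> \<union> set (e # es)))
        \<le> of_bool (pivot A e \<eta>) + (of_bool (?B (insert e \<eta>)) :: real)"
      by (auto simp: pivot_def of_bool_def)
  qed
  also have "\<dots> = bprob r F (pivot A e) + bexp r F (\<lambda>\<eta>. of_bool (?B (insert e \<eta>)))"
    by (simp add: bexp_add bprob_def)
  also have "\<dots> \<le> bprob r F (pivot A e) + bprob r F ?B / r"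
    using bexp_insert_le[OF F _ r, of e "\<lambda>\<eta>. of_bool (?B \<eta>)"] Cons.prems by (simp add: bprob_def)
  also have "\<dots> \<le> bprob r F (pivot A e) + (?s / r ^ length es) / r"
    using Cons r by (intro add_left_mono divide_right_mono) auto
  also have "\<dots> \<le> bprob r F (pivot A e) / r ^ length (e # es) + ?s / r ^ length (e # es)"
  proof -
    have "bprob r F (pivot A e) * r ^ length (e # es) \<le> bprob r F (pivot A e) * 1"
      using r r' by (intro mult_left_mono power_le_one) auto
    then have "bprob r F (pivot A e) \<le> bprob r F (pivot A e) / r ^ length (e # es)"
      using r by (simp add: field_simps)
    then show ?thesis by (simp add: mult.commute)
  qed
  also have "\<dots> = (\<Sum>e\<leftarrow>e # es. bprob r F (pivot A e)) / r ^ length (e # es)"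
    by (simp add: add_divide_distrib)
  finally show ?case .
qed

definition path_steps :: "'v list \<Rightarrow> ('v \<times> 'v) list"
  where "path_steps xs = zip xs (tl xs)"

lemma path_edges_steps: "path_edges xs = (\<lambda>(a, b). {a, b}) ` set (path_steps xs)"
  by (induction xs rule: path_edges.induct) (auto simp: path_steps_def)

lemma path_steps_distinct: "distinct xs \<Longrightarrow> (a, b) \<in> set (path_steps xs) \<Longrightarrow> a \<noteq> b"
  by (induction xs rule: path_edges.induct) (auto simp: path_steps_def)

text \<open>
  Summed over the translates of a path, a fixed step of the path runs through distinct edges: a translation that
  maps an edge to itself with its ends exchanged would have order two.
\<close>
lemma translated_steps_pivots:
  fixes xs :: "(int ^ 'd::finite) list"
  assumes r: "r \<in> {0..1}" and F: "finite F" and U: "finite U" and xs: "distinct xs"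
    and sub: "\<And>u a b. u \<in> U \<Longrightarrow> (a, b) \<in> set (path_steps xs) \<Longrightarrow> {u + a, u + b} \<in> F"
  shows "(\<Sum>u\<in>U. \<Sum>e\<leftarrow>map (\<lambda>(a, b). {u + a, u + b}) (path_steps xs). bprob r F (pivot A e))
    \<le> length xs * (\<Sum>e\<in>F. bprob r F (pivot A e))"
proof -
  let ?P = "\<Sum>e\<in>F. bprob r F (pivot A e)"
  have one: "(\<Sum>u\<in>U. bprob r F (pivot A {u + a, u + b})) \<le> ?P" if ab: "(a, b) \<in> set (path_steps xs)" for a b
  proof -
    have "inj_on (\<lambda>u. {u + a, u + b}) U"
    proof (rule inj_onI)
      fix u v assume eq: "{u + a, u + b} = {v + a, v + b}"
      show "u = v"
      proof (rule ccontr)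
        assume "u \<noteq> v"
        then have "u + a = v + b" "u + b = v + a" using eq by (auto simp: doubleton_eq_iff)
        then have "u $ i + a $ i = v $ i + b $ i \<and> u $ i + b $ i = v $ i + a $ i" for i
          by (simp add: vec_eq_iff)
        then have "a $ i = b $ i" for i by (smt (verit))
        then have "a = b" by (simp add: vec_eq_iff)
        then show False using path_steps_distinct[OF xs ab] by simp
      qed
    qed
    then have "(\<Sum>u\<in>U. bprob r F (pivot A {u + a, u + b}))
        = (\<Sum>e\<in>(\<lambda>u. {u + a, u + b}) ` U. bprob r F (pivot A e))"
      by (simp add: sum.reindex)
    also have "\<dots> \<le> ?P" using r F sub[OF _ ab] by (intro sum_mono2) auto
    finally show ?thesis .
  qed
  have "(\<Sum>u\<in>U. \<Sum>e\<leftarrow>map (\<lambda>(a, b). {u + a, u + b}) (path_steps xs). bprob r F (pivot A e))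
      = (\<Sum>s\<leftarrow>path_steps xs. \<Sum>u\<in>U. bprob r F (pivot A {u + fst s, u + snd s}))"
  proof -
    have "(\<Sum>u\<in>U. \<Sum>s\<leftarrow>ss. f u s) = (\<Sum>s\<leftarrow>ss. \<Sum>u\<in>U. f u s)" for f :: "_ \<Rightarrow> _ \<Rightarrow> real" and ss
      by (induction ss) (auto simp: sum.distrib)
    then show ?thesis by (simp add: case_prod_unfold o_def)
  qed
  also have "\<dots> \<le> (\<Sum>s\<leftarrow>path_steps xs. ?P)"
    using one by (intro sum_list_mono) auto
  also have "\<dots> = length (path_steps xs) * ?P" by (simp add: sum_list_triv)
  also have "\<dots> \<le> length xs * ?P"
    using r by (intro mult_right_mono sum_nonneg) (auto simp: path_steps_def)
  finally show ?thesis .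
qed

section \<open>Finite increments below the critical point\<close>

lemma sum_shift_le:
  fixes f :: "'a::ab_group_add \<Rightarrow> real"
  assumes "\<And>Z. finite Z \<Longrightarrow> sum f Z \<le> X" "finite Z"
  shows "(\<Sum>x\<in>Z. f (x - y)) \<le> X"
proof -
  have "(\<Sum>x\<in>Z. f (x - y)) = sum f ((\<lambda>x. x - y) ` Z)"
    by (subst sum.reindex) (auto simp: inj_on_def)
  then show ?thesis using assms by simp
qed

text \<open>
  The derivative of the susceptibility counts pivotal edges. By \<open>open_one_by_one\<close> there are at least a
  constant times as many of them as there are pairs \<open>(u, x)\<close> with \<open>u\<close> in the cluster of the origin and \<open>x\<close> in a
  disjoint cluster of \<open>u + w\<close>. By \<open>avoid_cluster\<close> and \<open>tree_graph\<close> the number of these pairs is at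
  least the square of the susceptibility minus a diagram, which contains the open triangle at \<open>w\<close>
  and two free two-point functions. Between \<open>p\<close> and \<open>q\<close>, the positive term is bounded below at \<open>p\<close> and the diagram
  above at \<open>q\<close>, so that the bound holds uniformly and survives the limit of infinite volume.
\<close>
lemma susceptibility_increment:
  fixes w :: "int ^ 'd::finite"
  assumes p: "0 < p0" "p0 \<le> p" "p < q" "q \<le> 1"
    and xs: "distinct xs" "xs \<noteq> []" "hd xs = 0" "last xs = w" "path_edges xs \<subseteq> edges L"
    and X: "\<And>Z :: (int ^ 'd) set. finite Z \<Longrightarrow> (\<Sum>x\<in>Z. tau L q x) \<le> X"
    and \<delta>: "\<And>A B :: (int ^ 'd) set. finite A \<Longrightarrow> finite B \<Longrightarrow>
        (\<Sum>a\<in>A. \<Sum>b\<in>B. tau L q a * tau L q b * tau L q (b - a - w)) \<le> \<delta>"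
    and UZ: "finite U" "finite Z"
  shows "(q - p) * (p0 ^ length xs / length xs *
      ((\<Sum>u\<in>U. \<Sum>x\<in>Z. tau L p u * tau L p (x - (u + w))) - X\<^sup>2 * \<delta>))
    \<le> (\<Sum>x\<in>Z. tau L q x - tau L p x)"
proof -
  define c where "c = p0 ^ length xs / length xs"
  have c: "0 < c" using p xs(2) by (simp add: c_def)
  have X0: "0 \<le> X" and \<delta>0: "0 \<le> \<delta>" using X[of "{}"] \<delta>[of "{}" "{}"] by auto
  let ?steps = "\<lambda>u. map (\<lambda>(a, b). {u + a, u + b}) (path_steps xs)"
  have steps: "set (?steps u) = (`) ((+) u) ` path_edges xs" for u
    unfolding path_edges_steps by (auto simp: image_image)
  have steps_edges: "set (?steps u) \<subseteq> edges L" for u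
    unfolding steps using xs(5) by (auto simp: translate_edge_iff)
  have conn_steps: "conn (set (?steps u)) u (u + w)" for u
    using conn_path_edges[OF xs(2)] conn_image[of "(+) u" "path_edges xs" 0 w] xs(3,4) unfolding steps by simp
  have "finite (\<Union>u\<in>U. set (?steps u))" using UZ by auto
  moreover have "(\<Union>u\<in>U. set (?steps u)) \<subseteq> edges L" using steps_edges by blast
  ultimately obtain N where N: "(\<Union>u\<in>U. set (?steps u)) \<subseteq> cube_edges L N"
    using finite_edges_subset_cube_edges by blast
  have finite_volume: "(q - p) * (c * ((\<Sum>u\<in>U. \<Sum>x\<in>Z. ftau p (cube_edges L n) 0 u * ftau p (cube_edges L n) (u + w) x) - X\<^sup>2 * \<delta>))
      \<le> (\<Sum>x\<in>Z. ftau q (cube_edges L n) 0 x) - (\<Sum>x\<in>Z. ftau p (cube_edges L n) 0 x)" if n: "n \<ge> N" for n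
  proof -
    define F where "F = (cube_edges L n :: (int ^ 'd) set set)"
    define W where "W = (cube n :: (int ^ 'd) set)"
    have F: "finite F" "F \<subseteq> edges L" using cube_edges_subset by (auto simp: F_def)
    have W: "finite W" "insert 0 (\<Union>F) \<subseteq> W" by (auto simp: F_def W_def cube_edges_def)
    have stepsF: "set (?steps u) \<subseteq> F" if "u \<in> U" for u
      using N cube_edges_mono[OF n, of L] that unfolding F_def by blast
    let ?piv = "\<lambda>r x. \<Sum>e\<in>F. bprob r F (pivot (\<lambda>\<eta>. conn \<eta> 0 x) e)"
    have derivative_bound: "c * ((\<Sum>u\<in>U. \<Sum>x\<in>Z. ftau p F 0 u * ftau p F (u + w) x) - X\<^sup>2 * \<delta>) \<le> (\<Sum>x\<in>Z. ?piv r x)"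
      if r: "p \<le> r" "r \<le> q" for r
    proof -
      have r01: "r \<in> {0..1}" "0 < r" "r \<le> 1" using p r by auto
      define t where "t = (tau L q :: int ^ 'd \<Rightarrow> real)"
      have t0: "0 \<le> t x" for x by (simp add: t_def)
      have t: "ftau r F x y \<le> t (y - x)" for x y
        unfolding t_def using ftau_le_tau[OF r01(1) F, of x y] tau_mono[of r q L "y - x"] r01 p r by simp
      define E where "E u x = bprob r F (\<lambda>\<eta>. conn \<eta> 0 u \<and> conn \<eta> (u + w) x \<and> \<not> conn \<eta> 0 x)" for u x
      have surgery: "c * (\<Sum>u\<in>U. E u x) \<le> ?piv r x" for x
      proof -
        let ?A = "\<lambda>\<eta>. conn \<eta> 0 x"
        have "(\<Sum>u\<in>U. E u x) \<le> (\<Sum>u\<in>U. (\<Sum>e\<leftarrow>?steps u. bprob r F (pivot ?A e)) / p0 ^ length xs)"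
        proof (rule sum_mono)
          fix u assume u: "u \<in> U"
          have "E u x \<le> bprob r F (\<lambda>\<eta>. \<not> ?A \<eta> \<and> ?A (\<eta> \<union> set (?steps u)))"
            unfolding E_def
          proof (rule bprob_mono[OF r01(1)])
            fix \<eta> assume \<eta>: "conn \<eta> 0 u \<and> conn \<eta> (u + w) x \<and> \<not> conn \<eta> 0 x"
            have "conn (\<eta> \<union> set (?steps u)) 0 u" "conn (\<eta> \<union> set (?steps u)) (u + w) x"
              "conn (\<eta> \<union> set (?steps u)) u (u + w)"
              using \<eta> conn_steps[of u] by (auto intro: conn_mono)
            then show "\<not> ?A \<eta> \<and> ?A (\<eta> \<union> set (?steps u))" using \<eta> by (meson conn_trans)
          qed
          also have "\<dots> \<le> (\<Sum>e\<leftarrow>?steps u. bprob r F (pivot ?A e)) / r ^ length (?steps u)"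
            by (intro open_one_by_one F r01 increasing_conn stepsF u)
          also have "\<dots> \<le> (\<Sum>e\<leftarrow>?steps u. bprob r F (pivot ?A e)) / p0 ^ length xs"
          proof (intro divide_left_mono)
            have "p0 ^ length xs \<le> p0 ^ length (?steps u)"
              using p r by (intro power_decreasing) (auto simp: path_steps_def)
            also have "\<dots> \<le> r ^ length (?steps u)" using p r by (intro power_mono) auto
            finally show "p0 ^ length xs \<le> r ^ length (?steps u)" .
            show "0 \<le> (\<Sum>e\<leftarrow>?steps u. bprob r F (pivot ?A e))"
              using r01 by (intro sum_list_nonneg) auto
          qed (use p r01 in auto)
          finally show "E u x \<le> (\<Sum>e\<leftarrow>?steps u. bprob r F (pivot ?A e)) / p0 ^ length xs" .
        qed
        also have "\<dots> = (\<Sum>u\<in>U. \<Sum>e\<leftarrow>?steps u. bprob r F (pivot ?A e)) / p0 ^ length xs"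
          by (simp add: sum_divide_distrib)
        also have "\<dots> \<le> length xs * ?piv r x / p0 ^ length xs"
        proof (intro divide_right_mono translated_steps_pivots r01 F UZ xs)
          fix u a b assume "u \<in> U" "(a, b) \<in> set (path_steps xs)"
          then show "{u + a, u + b} \<in> F" using stepsF[of u] by force
        qed (use p in auto)
        finally show ?thesis
          using p xs(2) by (simp add: c_def field_simps)
      qed
      let ?H = "\<lambda>u x y z. t z * (t (u - z) * t (y - z) * t (y - (u + w))) * t (x - y)"
      have two_clusters: "ftau r F 0 u * ftau r F (u + w) x
            - (\<Sum>y\<in>W. \<Sum>z\<in>W. ?H u x y z) \<le> E u x" for u x
      proof -
        have "(\<Sum>y\<in>W. bprob r F (\<lambda>\<eta>. conn \<eta> 0 u \<and> conn \<eta> 0 y) * ftau r F (u + w) y * ftau r F y x)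
          \<le> (\<Sum>y\<in>W. (\<Sum>z\<in>W. t z * t (u - z) * t (y - z)) * t (y - (u + w)) * t (x - y))"
        proof (rule sum_mono)
          fix y
          have "bprob r F (\<lambda>\<eta>. conn \<eta> 0 u \<and> conn \<eta> 0 y)
              \<le> (\<Sum>z\<in>W. ftau r F 0 z * ftau r F z u * ftau r F z y)"
            by (rule tree_graph[OF r01(1) F(1) W])
          also have "\<dots> \<le> (\<Sum>z\<in>W. t z * t (u - z) * t (y - z))"
            using t[of 0] t t0 r01 by (intro sum_mono mult_mono) (auto simp: mult_nonneg_nonneg)
          finally show "bprob r F (\<lambda>\<eta>. conn \<eta> 0 u \<and> conn \<eta> 0 y) * ftau r F (u + w) y * ftau r F y x
              \<le> (\<Sum>z\<in>W. t z * t (u - z) * t (y - z)) * t (y - (u + w)) * t (x - y)"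
            using t t0 r01 by (intro mult_mono) (auto intro!: mult_nonneg_nonneg sum_nonneg)
        qed
        also have "\<dots> = (\<Sum>y\<in>W. \<Sum>z\<in>W. ?H u x y z)"
          by (simp add: sum_distrib_right mult.assoc)
        finally show ?thesis
          using avoid_cluster[OF r01(1) F(1) W, of u "u + w" x] unfolding E_def by linarith
      qed
      (* Summing over x and z yields a factor X each. In the variables a = u - z and b = y - z the
         rest is the open triangle. *)
      have diagram: "(\<Sum>u\<in>U. \<Sum>x\<in>Z. \<Sum>y\<in>W. \<Sum>z\<in>W. ?H u x y z)
          \<le> X\<^sup>2 * \<delta>"
      proof -
        have "(\<Sum>u\<in>U. \<Sum>x\<in>Z. \<Sum>y\<in>W. \<Sum>z\<in>W. ?H u x y z)
          = (\<Sum>u\<in>U. \<Sum>y\<in>W. \<Sum>z\<in>W. t z * (t (u - z) * t (y - z) * t (y - (u + w))) * (\<Sum>x\<in>Z. t (x - y)))"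
          by (subst sum.swap[of _ W Z], subst sum.swap[of _ W Z]) (simp add: sum_distrib_left)
        also have "\<dots> \<le> (\<Sum>u\<in>U. \<Sum>y\<in>W. \<Sum>z\<in>W. t z * (t (u - z) * t (y - z) * t (y - (u + w))) * X)"
          using t0 sum_shift_le[of t X Z] X UZ unfolding t_def
          by (intro sum_mono mult_left_mono mult_nonneg_nonneg) auto
        also have "\<dots> = (\<Sum>u\<in>U. \<Sum>z\<in>W. \<Sum>y\<in>W. t z * (t (u - z) * t (y - z) * t (y - (u + w))) * X)"
          by (intro sum.cong refl sum.swap)
        also have "\<dots> = (\<Sum>z\<in>W. \<Sum>u\<in>U. \<Sum>y\<in>W. t z * (t (u - z) * t (y - z) * t (y - (u + w))) * X)"
          by (rule sum.swap)
        also have "\<dots> = (\<Sum>z\<in>W. t z * (\<Sum>u\<in>U. \<Sum>y\<in>W. t (u - z) * t (y - z) * t (y - (u + w))) * X)"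
          by (simp add: sum_distrib_left sum_distrib_right mult.assoc)
        also have "\<dots> \<le> (\<Sum>z\<in>W. t z * \<delta> * X)"
        proof (intro sum_mono mult_right_mono mult_left_mono t0 X0)
          fix z
          have "(\<Sum>u\<in>U. \<Sum>y\<in>W. t (u - z) * t (y - z) * t (y - (u + w)))
            = (\<Sum>a\<in>(\<lambda>u. u - z) ` U. \<Sum>b\<in>(\<lambda>y. y - z) ` W. t a * t b * t (b - a - w))"
            by (simp add: sum.reindex inj_on_def algebra_simps)
          also have "\<dots> \<le> \<delta>" unfolding t_def using UZ W by (intro \<delta>) auto
          finally show "(\<Sum>u\<in>U. \<Sum>y\<in>W. t (u - z) * t (y - z) * t (y - (u + w))) \<le> \<delta>" .
        qed
        also have "\<dots> = (\<Sum>z\<in>W. t z) * \<delta> * X" by (simp add: sum_distrib_right)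
        also have "\<dots> \<le> X * \<delta> * X"
          using X[OF W(1)] X0 \<delta>0 unfolding t_def by (intro mult_right_mono) auto
        finally show ?thesis by (simp add: power2_eq_square mult_ac)
      qed
      have "(\<Sum>u\<in>U. \<Sum>x\<in>Z. ftau p F 0 u * ftau p F (u + w) x) \<le> (\<Sum>u\<in>U. \<Sum>x\<in>Z. ftau r F 0 u * ftau r F (u + w) x)"
        using p r r01 by (intro sum_mono mult_mono bprob_mono_p F increasing_conn) auto
      moreover have "(\<Sum>u\<in>U. \<Sum>x\<in>Z. ftau r F 0 u * ftau r F (u + w) x) - X\<^sup>2 * \<delta> \<le> (\<Sum>u\<in>U. \<Sum>x\<in>Z. E u x)"
      proof -
        have "(\<Sum>u\<in>U. \<Sum>x\<in>Z. ftau r F 0 u * ftau r F (u + w) x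
            - (\<Sum>y\<in>W. \<Sum>z\<in>W. ?H u x y z))
          \<le> (\<Sum>u\<in>U. \<Sum>x\<in>Z. E u x)"
          by (intro sum_mono two_clusters)
        then show ?thesis using diagram by (simp add: sum_subtractf)
      qed
      ultimately have "(\<Sum>u\<in>U. \<Sum>x\<in>Z. ftau p F 0 u * ftau p F (u + w) x) - X\<^sup>2 * \<delta> \<le> (\<Sum>x\<in>Z. \<Sum>u\<in>U. E u x)"
        using sum.swap[of E Z U] by simp
      then have "c * ((\<Sum>u\<in>U. \<Sum>x\<in>Z. ftau p F 0 u * ftau p F (u + w) x) - X\<^sup>2 * \<delta>) \<le> (\<Sum>x\<in>Z. c * (\<Sum>u\<in>U. E u x))"
        using c by (simp add: sum_distrib_left[symmetric])
      also have "\<dots> \<le> (\<Sum>x\<in>Z. ?piv r x)" by (intro sum_mono surgery)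
      finally show ?thesis .
    qed
    have "\<exists>s. p < s \<and> s < q \<and> (\<Sum>x\<in>Z. ftau q F 0 x) - (\<Sum>x\<in>Z. ftau p F 0 x) = (q - p) * (\<Sum>x\<in>Z. ?piv s x)"
      using p by (intro MVT2 DERIV_sum russo F increasing_conn) auto
    then obtain s where s: "p < s" "s < q"
      "(\<Sum>x\<in>Z. ftau q F 0 x) - (\<Sum>x\<in>Z. ftau p F 0 x) = (q - p) * (\<Sum>x\<in>Z. ?piv s x)" by blast
    show ?thesis
      unfolding F_def[symmetric] s(3) using p s by (intro mult_left_mono derivative_bound) auto
  qed
  have p01: "p \<in> {0..1}" "q \<in> {0..1}" using p by auto
  have "(\<lambda>n. (q - p) * (c * ((\<Sum>u\<in>U. \<Sum>x\<in>Z. ftau p (cube_edges L n) 0 u * ftau p (cube_edges L n) (u + w) x) - X\<^sup>2 * \<delta>)))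
      \<longlonglongrightarrow> (q - p) * (c * ((\<Sum>u\<in>U. \<Sum>x\<in>Z. tau L p (u - 0) * tau L p (x - (u + w))) - X\<^sup>2 * \<delta>))"
    by (intro tendsto_intros ftau_tendsto_tau p01)
  moreover have "(\<lambda>n. (\<Sum>x\<in>Z. ftau q (cube_edges L n) 0 x) - (\<Sum>x\<in>Z. ftau p (cube_edges L n) 0 x))
      \<longlonglongrightarrow> (\<Sum>x\<in>Z. tau L q (x - 0)) - (\<Sum>x\<in>Z. tau L p (x - 0))"
    by (intro tendsto_intros ftau_tendsto_tau p01)
  ultimately have "(q - p) * (c * ((\<Sum>u\<in>U. \<Sum>x\<in>Z. tau L p (u - 0) * tau L p (x - (u + w))) - X\<^sup>2 * \<delta>))
      \<le> (\<Sum>x\<in>Z. tau L q (x - 0)) - (\<Sum>x\<in>Z. tau L p (x - 0))"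
    by (rule LIMSEQ_le) (intro exI[of _ N] allI impI finite_volume)
  then show ?thesis by (simp add: c_def sum_subtractf)
qed

text \<open>
  If \<open>e = {u, v}\<close> is pivotal, the connections from the origin to \<open>u\<close> and from \<open>v\<close> to \<open>x\<close> occur disjointly, so by
  Russo's formula and the BK inequality the derivative of the two-point function is at most the sum of
  \<open>\<tau>(u) \<tau>(x - v)\<close> over the edges. Here \<open>a\<close> stands for \<open>v - u\<close>.
\<close>
lemma tau_decrement:
  fixes x :: "int ^ 'd::finite"
  assumes p: "0 \<le> p" "p < q" "q \<le> 1"
    and D: "\<And>A :: (int ^ 'd) set. finite A \<Longrightarrow>
      (\<Sum>u\<in>A. \<Sum>a | {0, a} \<in> edges L. tau L q u * tau L q (x - u - a)) \<le> D"
  shows "tau L q x - tau L p x \<le> (q - p) * D"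
proof -
  let ?N = "{a :: int ^ 'd. {0, a} \<in> edges L}"
  have finN: "finite ?N" by (rule finite_nbrs)
  have p01: "p \<in> {0..1}" "q \<in> {0..1}" using p by auto
  have "ftau q (cube_edges L n) 0 x - ftau p (cube_edges L n) 0 x \<le> (q - p) * D" for n
  proof -
    define F where "F = (cube_edges L n :: (int ^ 'd) set set)"
    define V where "V = (cube n :: (int ^ 'd) set)"
    have F: "finite F" "F \<subseteq> edges L" using cube_edges_subset by (auto simp: F_def)
    let ?A = "\<lambda>\<eta>. conn \<eta> 0 x"
    define ends where "ends e = {(u, v). e = {u, v}}" for e :: "(int ^ 'd) set"
    have ends: "finite (ends e)" if "e \<in> F" for e
    proof (rule finite_subset)
      show "ends e \<subseteq> e \<times> e" by (auto simp: ends_def)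
      show "finite (e \<times> e)" using that F(2) by (auto elim!: edgesE)
    qed
    have deriv: "(\<Sum>e\<in>F. bprob r F (pivot ?A e)) \<le> D" if r: "p \<le> r" "r \<le> q" for r
    proof -
      have r01: "r \<in> {0..1}" using p r by auto
      have t: "ftau r F y z \<le> tau L q (z - y)" for y z
        using ftau_le_tau[OF r01(1) F, of y z] tau_mono[of r q L "z - y"] r01 p r by simp
      have "(\<Sum>e\<in>F. bprob r F (pivot ?A e)) \<le> (\<Sum>e\<in>F. \<Sum>(u, v)\<in>ends e. tau L q u * tau L q (x - v))"
      proof (rule sum_mono)
        fix e assume e: "e \<in> F"
        let ?B = "\<lambda>i. (\<lambda>\<omega>. conn \<omega> 0 (fst i)) \<box> (\<lambda>\<omega>. conn \<omega> (snd i) x)"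
        have "bprob r F (pivot ?A e) \<le> (\<Sum>i\<in>ends e. bprob r F (?B i))"
        proof (rule bprob_union_bound[OF r01 ends[OF e]])
          fix \<eta> assume "pivot ?A e \<eta>"
          then obtain u v where "e = {u, v}" "((\<lambda>\<omega>. conn \<omega> 0 u) \<box> (\<lambda>\<omega>. conn \<omega> v x)) \<eta>"
            using conn_pivot[of 0 x e \<eta>] by auto
          then show "\<exists>i\<in>ends e. ?B i \<eta>" by (intro bexI[of _ "(u, v)"]) (auto simp: ends_def)
        qed
        also have "\<dots> \<le> (\<Sum>i\<in>ends e. tau L q (fst i) * tau L q (x - snd i))"
        proof (rule sum_mono)
          fix i
          have "bprob r F (?B i) \<le> ftau r F 0 (fst i) * ftau r F (snd i) x"
            by (intro bk_inequality F r01 increasing_conn)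
          also have "\<dots> \<le> tau L q (fst i) * tau L q (x - snd i)"
            using t[of 0 "fst i"] t[of "snd i" x] r01 by (intro mult_mono) auto
          finally show "bprob r F (?B i) \<le> tau L q (fst i) * tau L q (x - snd i)" .
        qed
        finally show "bprob r F (pivot ?A e) \<le> (\<Sum>(u, v)\<in>ends e. tau L q u * tau L q (x - v))"
          by (simp add: case_prod_unfold)
      qed
      also have "\<dots> = (\<Sum>i\<in>Sigma F ends. tau L q (fst (snd i)) * tau L q (x - snd (snd i)))"
        using F ends by (subst sum.Sigma) (auto simp: case_prod_unfold)
      also have "\<dots> = (\<Sum>(u, a)\<in>(\<lambda>i. (fst (snd i), snd (snd i) - fst (snd i))) ` Sigma F ends. tau L q u * tau L q (x - u - a))"
        by (subst sum.reindex) (auto intro!: inj_onI simp: ends_def)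
      also have "\<dots> \<le> (\<Sum>(u, a)\<in>V \<times> ?N. tau L q u * tau L q (x - u - a))"
      proof (rule sum_mono2)
        show "(\<lambda>i. (fst (snd i), snd (snd i) - fst (snd i))) ` Sigma F ends \<subseteq> V \<times> ?N"
          by (auto simp: ends_def F_def V_def cube_edges_def edge_iff l1_norm_minus_commute)
      qed (use finN in \<open>auto simp: V_def\<close>)
      also have "\<dots> = (\<Sum>u\<in>V. \<Sum>a\<in>?N. tau L q u * tau L q (x - u - a))"
        by (simp add: sum.cartesian_product)
      also have "\<dots> \<le> D" by (rule D) (simp add: V_def)
      finally show ?thesis .
    qed
    have "\<exists>s. p < s \<and> s < q \<and> ftau q F 0 x - ftau p F 0 x = (q - p) * (\<Sum>e\<in>F. bprob s F (pivot ?A e))"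
      using p by (intro MVT2 russo F increasing_conn) auto
    then obtain s where s: "p < s" "s < q"
      "ftau q F 0 x - ftau p F 0 x = (q - p) * (\<Sum>e\<in>F. bprob s F (pivot ?A e))" by blast
    show ?thesis unfolding F_def[symmetric] s(3) using p s by (intro mult_left_mono deriv) auto
  qed
  moreover have "(\<lambda>n. ftau q (cube_edges L n) 0 x - ftau p (cube_edges L n) 0 x) \<longlonglongrightarrow> tau L q (x - 0) - tau L p (x - 0)"
    by (intro tendsto_intros ftau_tendsto_tau p01)
  ultimately show ?thesis using LIMSEQ_le_const2 by fastforce
qed

section \<open>The mean-field bound on the susceptibility\<close>

text \<open>
  The susceptibility as a real number. It agrees with \<open>chi\<close> wherever the sum is finite, in particular below
  the critical parameter.
\<close>
definition susc :: "'d::finite itself \<Rightarrow> int \<Rightarrow> real \<Rightarrow> real"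
  where "susc _ L p = (\<Sum>\<^sub>\<infinity>x :: int ^ 'd. tau L p x)"

lemma tau_summable:
  assumes L: "L \<ge> 1" and p: "0 \<le> p" "p < p_crit TYPE('d::finite) L"
  shows "(tau L p :: int ^ 'd \<Rightarrow> real) summable_on UNIV"
  using subcritical_susceptibility_finite[OF assms]
  by (intro nonneg_bdd_above_summable_on) (auto simp: bdd_above_def)

context
  fixes L :: int and pc :: real
  assumes L: "L \<ge> 1"
  defines "pc \<equiv> p_crit TYPE('d::finite) L"
begin

lemma sum_tau_le_susc:
  assumes "0 \<le> p" "p < pc" "finite Z"
  shows "(\<Sum>x\<in>Z. tau L p (x :: int ^ 'd)) \<le> susc TYPE('d) L p"
  unfolding susc_def using assms tau_summable[OF L, where 'd = 'd]
  by (intro finite_sum_le_infsum) (auto simp: pc_def)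

lemma susc_ge_1:
  assumes "0 \<le> p" "p < pc"
  shows "1 \<le> susc TYPE('d) L p"
  using sum_tau_le_susc[OF assms, of "{0}"] by simp

lemma pc_le_1: "pc \<le> 1"
  using p_crit_in(1)[OF L, where 'd = 'd] by (simp add: pc_def)

lemma susc_mono:
  assumes "0 \<le> p" "p \<le> q" "q < pc"
  shows "susc TYPE('d) L p \<le> susc TYPE('d) L q"
  unfolding susc_def using assms pc_le_1 tau_summable[OF L, where 'd = 'd]
  by (intro infsum_mono tau_mono) (auto simp: pc_def)

lemma susc_increment:
  fixes w :: "int ^ 'd"
  assumes p: "0 < p0" "p0 \<le> p" "p < q" "q < pc"
    and xs: "distinct xs" "xs \<noteq> []" "hd xs = 0" "last xs = w" "path_edges xs \<subseteq> edges L"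
    and \<delta>: "\<And>A B :: (int ^ 'd) set. finite A \<Longrightarrow> finite B \<Longrightarrow>
        (\<Sum>a\<in>A. \<Sum>b\<in>B. tau L pc a * tau L pc b * tau L pc (b - a - w)) \<le> \<delta>"
  shows "(q - p) * (p0 ^ length xs / length xs * ((susc TYPE('d) L p)\<^sup>2 - (susc TYPE('d) L q)\<^sup>2 * \<delta>))
    \<le> susc TYPE('d) L q - susc TYPE('d) L p"
proof -
  let ?S = "susc TYPE('d) L"
  define c where "c = (q - p) * (p0 ^ length xs / length xs)"
  have c: "0 < c" using p xs(2) by (simp add: c_def)
  have sum_p: "(tau L p :: int ^ 'd \<Rightarrow> real) summable_on UNIV" and sum_q: "(tau L q :: int ^ 'd \<Rightarrow> real) summable_on UNIV"
    using p tau_summable[OF L, where 'd = 'd] by (auto simp: pc_def)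
  have \<delta>': "(\<Sum>a\<in>A. \<Sum>b\<in>B. tau L q a * tau L q b * tau L q (b - a - w)) \<le> \<delta>"
    if "finite A" "finite B" for A B :: "(int ^ 'd) set"
  proof -
    have "(\<Sum>a\<in>A. \<Sum>b\<in>B. tau L q a * tau L q b * tau L q (b - a - w))
        \<le> (\<Sum>a\<in>A. \<Sum>b\<in>B. tau L pc a * tau L pc b * tau L pc (b - a - w))"
      using p pc_le_1 by (intro sum_mono mult_mono tau_mono) auto
    then show ?thesis using \<delta>[OF that] by simp
  qed
  have "(sum (tau L p) U)\<^sup>2 \<le> (?S q - ?S p) / c + (?S q)\<^sup>2 * \<delta>" if U: "finite U" for U :: "(int ^ 'd) set"
  proof -
    (* Large enough to contain the translates of U to all points u + w, so that every u sees
       the whole sum over U. *)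
    define Z where "Z = (\<Union>u\<in>U. (\<lambda>x. x + (u + w)) ` U)"
    have Z: "finite Z" using U by (simp add: Z_def)
    have "(sum (tau L p) U)\<^sup>2 = (\<Sum>u\<in>U. tau L p u * sum (tau L p) U)"
      by (simp add: power2_eq_square sum_distrib_right)
    also have "\<dots> \<le> (\<Sum>u\<in>U. tau L p u * (\<Sum>x\<in>Z. tau L p (x - (u + w))))"
    proof (intro sum_mono mult_left_mono)
      fix u assume u: "u \<in> U"
      have "sum (tau L p) U = (\<Sum>x\<in>(\<lambda>x. x + (u + w)) ` U. tau L p (x - (u + w)))"
        by (subst sum.reindex) (auto simp: inj_on_def)
      also have "\<dots> \<le> (\<Sum>x\<in>Z. tau L p (x - (u + w)))"
        using Z u by (intro sum_mono2) (auto simp: Z_def)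
      finally show "sum (tau L p) U \<le> (\<Sum>x\<in>Z. tau L p (x - (u + w)))" .
    qed auto
    finally have sq: "(sum (tau L p) U)\<^sup>2 \<le> (\<Sum>u\<in>U. \<Sum>x\<in>Z. tau L p u * tau L p (x - (u + w)))"
      by (simp add: sum_distrib_left)
    have "(q - p) * (p0 ^ length xs / length xs *
        ((\<Sum>u\<in>U. \<Sum>x\<in>Z. tau L p u * tau L p (x - (u + w))) - (?S q)\<^sup>2 * \<delta>)) \<le> (\<Sum>x\<in>Z. tau L q x - tau L p x)"
      using p pc_le_1 by (intro susceptibility_increment xs \<delta>' sum_tau_le_susc U Z) auto
    also have "\<dots> \<le> ?S q - ?S p"
    proof (rule finite_sum_le_has_sum)
      show "((\<lambda>x :: int ^ 'd. tau L q x - tau L p x) has_sum (?S q - ?S p)) UNIV"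
        using has_sum_add[OF has_sum_infsum[OF sum_q] has_sum_uminusI[OF has_sum_infsum[OF sum_p]]]
        by (simp add: susc_def)
    qed (use p pc_le_1 Z in \<open>auto intro!: tau_mono\<close>)
    finally have "c * ((\<Sum>u\<in>U. \<Sum>x\<in>Z. tau L p u * tau L p (x - (u + w))) - (?S q)\<^sup>2 * \<delta>) \<le> ?S q - ?S p"
      by (simp add: c_def mult.assoc)
    then have "(\<Sum>u\<in>U. \<Sum>x\<in>Z. tau L p u * tau L p (x - (u + w))) \<le> (?S q - ?S p) / c + (?S q)\<^sup>2 * \<delta>"
      using c by (simp add: field_simps)
    with sq show ?thesis by simp
  qed
  then have "sum (tau L p) U \<le> sqrt ((?S q - ?S p) / c + (?S q)\<^sup>2 * \<delta>)" if "finite U" for U :: "(int ^ 'd) set"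
    using that by (intro real_le_rsqrt) auto
  then have "?S p \<le> sqrt ((?S q - ?S p) / c + (?S q)\<^sup>2 * \<delta>)"
    unfolding susc_def by (intro infsum_le_finite_sums sum_p) auto
  moreover have "0 \<le> ?S p" using susc_ge_1[of p] p by simp
  ultimately have "(?S p)\<^sup>2 \<le> (?S q - ?S p) / c + (?S q)\<^sup>2 * \<delta>"
    by (smt (verit) real_sqrt_pow2 real_sqrt_le_0_iff power_mono real_sqrt_lt_0_iff)
  then have "c * ((?S p)\<^sup>2 - (?S q)\<^sup>2 * \<delta>) \<le> ?S q - ?S p" using c by (simp add: field_simps)
  then show ?thesis by (simp add: c_def mult.assoc)
qed

text \<open>
  As long as the susceptibility \<open>S\<close> has not doubled between \<open>p\<close> and \<open>q\<close>, the subtracted term in \<open>susc_increment\<close> is at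
  most half of the main term, so \<open>S\<close> grows by at least a constant times \<open>(q - p) S(p)\<^sup>2\<close>. Hence it doubles within
  a distance of order \<open>1 / S(p)\<close>. After the \<open>n\<close>-th doubling the next distance is smaller by a factor \<open>2\<^sup>n\<close>, so that
  all doublings happen within twice the first distance. If this were less than the distance to the critical
  point, \<open>S\<close> would be unbounded on an interval that ends strictly below the critical point, which is
  impossible as \<open>S\<close> is finite and increasing there.
\<close>
lemma susc_upper_bound:
  fixes w :: "int ^ 'd"
  assumes p0: "0 < p0"
    and w: "\<And>A B :: (int ^ 'd) set. finite A \<Longrightarrow> finite B \<Longrightarrow>
        (\<Sum>a\<in>A. \<Sum>b\<in>B. tau L pc a * tau L pc b * tau L pc (b - a - w)) \<le> 1 / 8"
  shows "\<exists>K>0. \<forall>p. p0 \<le> p \<longrightarrow> p < pc \<longrightarrow> (pc - p) * susc TYPE('d) L p \<le> K"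
proof -
  let ?S = "susc TYPE('d) L"
  obtain xs where xs: "distinct xs" "xs \<noteq> []" "hd xs = 0" "last xs = w" "path_edges xs \<subseteq> edges L"
    using conn_imp_path[OF conn_lattice[OF L]] by metis
  define c where "c = p0 ^ length xs / length xs"
  have c: "0 < c" using p0 xs(2) by (simp add: c_def)
  have doubling: "2 * ?S p \<le> ?S q" if pq: "p0 \<le> p" "q < pc" "q = p + 3 / (c * ?S p)" "p < pc" for p q
  proof (rule ccontr)
    assume less: "\<not> 2 * ?S p \<le> ?S q"
    have gap: "0 < 3 / (c * ?S p)"
      using c susc_ge_1[of p] pq p0 by simp
    then have "p < q" using pq by simp
    have S: "1 \<le> ?S p" "?S p \<le> ?S q" using susc_ge_1[of p] susc_mono[of p q] pq p0 \<open>p < q\<close> by auto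
    have "(?S q)\<^sup>2 \<le> (2 * ?S p)\<^sup>2" using less S by (intro power_mono) auto
    then have sq: "(?S p)\<^sup>2 / 2 \<le> (?S p)\<^sup>2 - (?S q)\<^sup>2 * (1 / 8)" by (simp add: power_mult_distrib)
    have diff: "q - p = 3 / (c * ?S p)" using pq by simp
    have "3 / 2 * ?S p = (q - p) * (c * ((?S p)\<^sup>2 / 2))"
      unfolding diff using c S by (simp add: field_simps power2_eq_square)
    also have "\<dots> \<le> (q - p) * (c * ((?S p)\<^sup>2 - (?S q)\<^sup>2 * (1 / 8)))"
      using sq c \<open>p < q\<close> by (intro mult_left_mono) auto
    also have "\<dots> \<le> ?S q - ?S p"
      unfolding c_def by (rule susc_increment[OF p0 pq(1) \<open>p < q\<close> pq(2) xs w])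
    finally show False using less S by simp
  qed
  have "(pc - p) * ?S p \<le> 6 / c" if p: "p0 \<le> p" "p < pc" for p
  proof (rule ccontr)
    assume far: "\<not> (pc - p) * ?S p \<le> 6 / c"
    have S1: "1 \<le> ?S p" using susc_ge_1 p p0 by simp
    define r where "r = p + 6 / (c * ?S p)"
    have r: "p < r" "r < pc" using far c S1 by (auto simp: r_def field_simps)
    (* The room that is left before r is at least twice the next step, whose length is
       3 / (c S(q)). One step leaves half of this room, which is enough as the step after it is at most half as long. *)
    have "\<exists>q\<ge>p. q + 6 / (c * ?S q) \<le> r \<and> 2 ^ n * ?S p \<le> ?S q \<and> q < r" for n
    proof (induction n)
      case 0
      then show ?case using r by (intro exI[of _ p]) (auto simp: r_def)
    next
      case (Suc n)
      then obtain q where q: "p \<le> q" "q + 6 / (c * ?S q) \<le> r" "2 ^ n * ?S p \<le> ?S q" "q < r" by auto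
      have Sq: "1 \<le> ?S q" using susc_ge_1[of q] q p p0 r by simp
      define g where "g = 3 / (c * ?S q)"
      define q' where "q' = q + g"
      have gap: "0 < g" and six: "6 / (c * ?S q) = 2 * g" using c Sq by (auto simp: g_def)
      have q': "q < q'" "q' < r" "q' + g \<le> r"
        using gap q(2) unfolding q'_def six by linarith+
      have double: "2 * ?S q \<le> ?S q'" using doubling[of q q'] q q' p r by (simp add: q'_def g_def)
      have "6 / (c * ?S q') \<le> 6 / (c * (2 * ?S q))"
        using double c Sq by (intro divide_left_mono mult_left_mono) auto
      also have "\<dots> = g" by (simp add: g_def)
      finally have "q' + 6 / (c * ?S q') \<le> r" using q' by simp
      then show ?case using q q' double by (intro exI[of _ q']) auto
    qed
    then have bound: "2 ^ n * ?S p \<le> ?S r" for n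
      using susc_mono[of _ r] r p p0 by (meson less_imp_le order.trans)
    obtain n where "?S r < 2 ^ n" using real_arch_pow[of 2 "?S r"] by auto
    also have "2 ^ n \<le> 2 ^ n * ?S p" using S1 by simp
    finally show False using bound[of n] by simp
  qed
  then show ?thesis using c by (intro exI[of _ "6 / c"]) auto
qed

end

section \<open>Lattice sums of powers\<close>

text \<open>
  A maximum norm, as the points of a given norm are then easy to count. The cutoff at \<open>1\<close> keeps powers with
  negative exponents finite at the origin.
\<close>
definition nrm :: "int ^ 'd::finite \<Rightarrow> nat"
  where "nrm x = max 1 (sup_norm x)"

definition decay :: "nat \<Rightarrow> int ^ 'd::finite \<Rightarrow> real"
  where "decay a x = 1 / real (nrm x) ^ a"

lemma nrm_ge_1 [simp]: "1 \<le> nrm x" "0 < nrm x" "Suc 0 \<le> nrm x"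
  by (auto simp: nrm_def)

lemma nrm_minus [simp]: "nrm (- x) = nrm x"
  by (simp add: nrm_def)

lemma nrm_triangle: "nrm (x + y) \<le> nrm x + nrm y"
  using sup_norm_triangle[of x y] by (auto simp: nrm_def)

lemma decay_pos [simp]: "0 < decay a x"
  by (simp add: decay_def)

lemma decay_minus [simp]: "decay a (- x) = decay a x"
  by (simp add: decay_def)

lemma in_cube_iff_nrm: "1 \<le> n \<Longrightarrow> x \<in> cube n \<longleftrightarrow> nrm x \<le> n"
  by (auto simp: cube_def nrm_def)

text \<open>
  The shell of points of norm \<open>k\<close> is the difference of two cubes, so its cardinality is a difference of two
  powers.
\<close>
lemma power_diff_bounds:
  fixes a b :: real
  assumes "0 \<le> b" "b \<le> a"
  shows "(a - b) * a ^ d \<le> a ^ Suc d - b ^ Suc d"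
    and "a ^ Suc d - b ^ Suc d \<le> real (Suc d) * (a - b) * a ^ d"
proof -
  have pw: "b ^ d \<le> a ^ d" for d using assms by (intro power_mono)
  show "(a - b) * a ^ d \<le> a ^ Suc d - b ^ Suc d"
    using mult_left_mono[OF pw[of d] assms(1)] by (simp add: algebra_simps)
  show "a ^ Suc d - b ^ Suc d \<le> real (Suc d) * (a - b) * a ^ d"
  proof (induction d)
    case (Suc d)
    have "a ^ Suc (Suc d) - b ^ Suc (Suc d) = a * (a ^ Suc d - b ^ Suc d) + (a - b) * b ^ Suc d"
      by (simp add: algebra_simps)
    also have "\<dots> \<le> a * (real (Suc d) * (a - b) * a ^ d) + (a - b) * a ^ Suc d"
      using Suc assms pw[of "Suc d"] by (intro add_mono mult_left_mono) auto
    also have "\<dots> = real (Suc (Suc d)) * (a - b) * a ^ Suc d"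
      by (simp add: algebra_simps)
    finally show ?case .
  qed simp
qed

lemma card_shell:
  assumes "1 \<le> k"
  shows "real k ^ (CARD('d) - 1) \<le> real (card {x :: int ^ 'd::finite. nrm x = k})"
    and "real (card {x :: int ^ 'd. nrm x = k}) \<le> 2 * real CARD('d) * 3 ^ CARD('d) * real k ^ (CARD('d) - 1)"
proof -
  obtain d where d: "CARD('d) = Suc d" using not0_implies_Suc by fastforce
  have c: "real (card (cube n :: (int ^ 'd) set)) = (2 * real n + 1) ^ Suc d" for n
    by (simp only: card_cube d) (simp add: algebra_simps)
  have "real k ^ d \<le> real (card {x :: int ^ 'd. nrm x = k}) \<and>
    real (card {x :: int ^ 'd. nrm x = k}) \<le> 2 * real (Suc d) * 3 ^ Suc d * real k ^ d"
  proof (cases "k = 1")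
    case True
    have "{x :: int ^ 'd. nrm x = 1} = cube 1" by (auto simp: nrm_def cube_def)
    then have "real (card {x :: int ^ 'd. nrm x = k}) = 3 ^ Suc d" using c[of 1] True by simp
    moreover have "(1 :: real) \<le> 3 ^ Suc d" by (rule one_le_power) simp
    moreover have "1 * 3 ^ Suc d \<le> 2 * real (Suc d) * 3 ^ Suc d" by (intro mult_right_mono) auto
    ultimately show ?thesis using True by simp
  next
    case False
    with assms have k: "2 \<le> k" by simp
    have sub: "cube (k - 1) \<subseteq> (cube k :: (int ^ 'd) set)" by (rule cube_mono) simp
    have "{x :: int ^ 'd. nrm x = k} = cube k - cube (k - 1)" using k by (auto simp: nrm_def cube_def)
    then have "card {x :: int ^ 'd. nrm x = k} = card (cube k :: (int ^ 'd) set) - card (cube (k - 1) :: (int ^ 'd) set)"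
      by (simp only: card_Diff_subset[OF finite_cube sub])
    then have "real (card {x :: int ^ 'd. nrm x = k})
        = real (card (cube k :: (int ^ 'd) set)) - real (card (cube (k - 1) :: (int ^ 'd) set))"
      using card_mono[OF finite_cube sub] by simp
    also have "\<dots> = (2 * real k + 1) ^ Suc d - (2 * real k - 1) ^ Suc d"
      unfolding c using k by (simp add: of_nat_diff algebra_simps)
    finally have card: "real (card {x :: int ^ 'd. nrm x = k}) = (2 * real k + 1) ^ Suc d - (2 * real k - 1) ^ Suc d" .
    have "real k ^ d \<le> 2 * (2 * real k + 1) ^ d"
      using power_mono[of "real k" "2 * real k + 1" d] zero_le_power[of "2 * real k + 1" d] by linarith
    moreover have "real (Suc d) * 2 * (2 * real k + 1) ^ d \<le> 2 * real (Suc d) * (3 ^ Suc d * real k ^ d)"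
    proof -
      have "(2 * real k + 1) ^ d \<le> (3 * real k) ^ d" using k by (intro power_mono) auto
      also have "\<dots> \<le> 3 ^ Suc d * real k ^ d" by (simp add: power_mult_distrib)
      finally show ?thesis using mult_left_mono[of _ _ "2 * real (Suc d)"] by (simp only: mult.commute[of "real (Suc d)" 2])
    qed
    ultimately show ?thesis
      unfolding card using power_diff_bounds[of "2 * real k - 1" "2 * real k + 1" d] k by (auto simp: mult.assoc)
  qed
  then show "real k ^ (CARD('d) - 1) \<le> real (card {x :: int ^ 'd::finite. nrm x = k})"
    "real (card {x :: int ^ 'd. nrm x = k}) \<le> 2 * real CARD('d) * 3 ^ CARD('d) * real k ^ (CARD('d) - 1)"
    unfolding d by simp_all
qed

lemma sum_over_shells:
  fixes f :: "nat \<Rightarrow> real"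
  assumes "1 \<le> n"
  shows "(\<Sum>x\<in>(cube n :: (int ^ 'd::finite) set). f (nrm x)) = (\<Sum>k=1..n. real (card {x :: int ^ 'd. nrm x = k}) * f k)"
proof -
  have "(\<Sum>x\<in>(cube n :: (int ^ 'd) set). f (nrm x)) = (\<Sum>k=1..n. \<Sum>x\<in>{x \<in> (cube n :: (int ^ 'd) set). nrm x = k}. f (nrm x))"
    using assms by (intro sum.group[symmetric]) (auto simp: in_cube_iff_nrm)
  also have "\<dots> = (\<Sum>k=1..n. real (card {x :: int ^ 'd. nrm x = k}) * f k)"
  proof (rule sum.cong[OF refl])
    fix k assume k: "k \<in> {1..n}"
    then have "{x \<in> (cube n :: (int ^ 'd) set). nrm x = k} = {x. nrm x = k}"
      using assms by (auto simp: in_cube_iff_nrm)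
    then have "(\<Sum>x\<in>{x \<in> (cube n :: (int ^ 'd) set). nrm x = k}. f (nrm x)) = (\<Sum>x\<in>{x :: int ^ 'd. nrm x = k}. f k)"
      by (intro sum.cong) auto
    then show "(\<Sum>x\<in>{x \<in> (cube n :: (int ^ 'd) set). nrm x = k}. f (nrm x)) = real (card {x :: int ^ 'd. nrm x = k}) * f k"
      by simp
  qed
  finally show ?thesis .
qed

lemma sum_over_cube_bounds:
  fixes f :: "nat \<Rightarrow> real"
  assumes "1 \<le> n" "\<And>k. 0 \<le> f k"
  shows "(\<Sum>k=1..n. real k ^ (CARD('d) - 1) * f k) \<le> (\<Sum>x\<in>(cube n :: (int ^ 'd::finite) set). f (nrm x))"
    and "(\<Sum>x\<in>(cube n :: (int ^ 'd::finite) set). f (nrm x))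
      \<le> 2 * real CARD('d) * 3 ^ CARD('d) * (\<Sum>k=1..n. real k ^ (CARD('d) - 1) * f k)"
  unfolding sum_over_shells[OF assms(1)] sum_distrib_left mult.assoc[symmetric]
  by (intro sum_mono mult_right_mono card_shell assms; simp)+

lemma sum_inverse_squares:
  assumes "1 \<le> m"
  shows "(\<Sum>k=Suc m..n. 1 / real k ^ 2) \<le> 1 / real m"
proof -
  have "(\<Sum>k=Suc m..n. 1 / real k ^ 2) \<le> 1 / real m - 1 / real n" if "m \<le> n" for n
    using that
  proof (induction n rule: dec_induct)
    case (step n)
    have n: "1 \<le> real n" using step assms by simp
    have "1 / real (Suc n) ^ 2 \<le> 1 / (real n * real (Suc n))"
      using n by (intro divide_left_mono) (auto simp: power2_eq_square)
    also have "\<dots> = 1 / real n - 1 / real (Suc n)" using n by (simp add: field_simps)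
    finally have "1 / real (Suc n) ^ 2 \<le> 1 / real n - 1 / real (Suc n)" .
    then show ?case using step by simp
  qed simp
  from this[of n] show ?thesis
    by (cases "m \<le> n") (auto intro: order.trans)
qed

text \<open>
  For \<open>k \<le> m\<close> all terms are at most the last one because \<open>a < d\<close>; for \<open>k > m\<close> the terms decay at least like
  \<open>1 / k\<^sup>2\<close> because \<open>d < a + b\<close>.
\<close>
lemma sum_convolution_kernel:
  assumes "a < d" "b < d" "d < a + b" "1 \<le> m"
  shows "(\<Sum>k=1..n. real k ^ (d - 1) * (1 / (real k ^ a * real (max m k) ^ b))) \<le> 2 / real m ^ (a + b - d)"
proof -
  define e where "e = a + b - d"
  have e: "1 \<le> e" "a + b = d + e" using assms by (auto simp: e_def)
  have m: "1 \<le> real m" using assms by simp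
  have "(\<Sum>k=1..n. real k ^ (d - 1) * (1 / (real k ^ a * real (max m k) ^ b)))
    \<le> (\<Sum>k=1..max m n. real k ^ (d - 1) * (1 / (real k ^ a * real (max m k) ^ b)))"
    by (rule sum_mono2) auto
  also have "\<dots> = (\<Sum>k=1..m. real k ^ (d - 1) * (1 / (real k ^ a * real (max m k) ^ b)))
     + (\<Sum>k=Suc m..max m n. real k ^ (d - 1) * (1 / (real k ^ a * real (max m k) ^ b)))"
  proof -
    have "{1..max m n} = {1..m} \<union> {Suc m..max m n}" using assms by auto
    then show ?thesis by (simp add: sum.union_disjoint)
  qed
  also have "(\<Sum>k=1..m. real k ^ (d - 1) * (1 / (real k ^ a * real (max m k) ^ b)))
      \<le> (\<Sum>k=1..m. real m ^ (d - 1 - a) / real m ^ b)"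
  proof (rule sum_mono)
    fix k assume k: "k \<in> {1..m}"
    have "real k ^ (d - 1) = real k ^ (d - 1 - a) * real k ^ a"
      using assms by (simp flip: power_add)
    then have "real k ^ (d - 1) * (1 / (real k ^ a * real (max m k) ^ b)) = real k ^ (d - 1 - a) / real m ^ b"
      using k max.absorb1[of k m] by simp
    also have "\<dots> \<le> real m ^ (d - 1 - a) / real m ^ b"
      using k by (intro divide_right_mono power_mono) auto
    finally show "real k ^ (d - 1) * (1 / (real k ^ a * real (max m k) ^ b)) \<le> real m ^ (d - 1 - a) / real m ^ b" .
  qed
  also have "(\<Sum>k=1..m. real m ^ (d - 1 - a) / real m ^ b) = 1 / real m ^ e"
  proof -
    have "real m * real m ^ (d - 1 - a) * real m ^ e = real m ^ b"
    proof -
      have "b = Suc (d - 1 - a + e)" using assms e by arith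
      then show ?thesis by (simp add: power_add)
    qed
    then show ?thesis using m by (simp add: field_simps)
  qed
  also have "(\<Sum>k=Suc m..max m n. real k ^ (d - 1) * (1 / (real k ^ a * real (max m k) ^ b)))
      \<le> (\<Sum>k=Suc m..max m n. 1 / real m ^ (e - 1) * (1 / real k ^ 2))"
  proof (rule sum_mono)
    fix k assume k: "k \<in> {Suc m..max m n}"
    have "real k ^ (d - 1) * (real k ^ (e - 1) * real k ^ 2) = real k ^ a * real k ^ b"
    proof -
      have "d - 1 + (e - 1 + 2) = a + b" using e assms by arith
      then show ?thesis by (simp only: power_add[symmetric])
    qed
    then have "real k ^ (d - 1) * (1 / (real k ^ a * real (max m k) ^ b)) = 1 / (real k ^ (e - 1) * real k ^ 2)"
      using k max.absorb2[of m k] by (simp add: field_simps)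
    also have "\<dots> \<le> 1 / (real m ^ (e - 1) * real k ^ 2)"
      using k m by (intro divide_left_mono mult_right_mono power_mono) auto
    finally show "real k ^ (d - 1) * (1 / (real k ^ a * real (max m k) ^ b)) \<le> 1 / real m ^ (e - 1) * (1 / real k ^ 2)"
      by simp
  qed
  also have "\<dots> \<le> 1 / real m ^ (e - 1) * (1 / real m)"
    unfolding sum_distrib_left[symmetric] using assms by (intro mult_left_mono sum_inverse_squares) auto
  also have "\<dots> = 1 / real m ^ e"
    using e(1) by (cases e) auto
  finally show ?thesis by (simp add: e_def)
qed

text \<open>
  Of the two points \<open>y\<close> and \<open>x - y\<close>, let \<open>y\<close> be the one of smaller norm. Then \<open>x - y\<close> has norm at least
  half of the maximum of the norms of \<open>x\<close> and \<open>y\<close>, so for fixed \<open>x\<close> the term is bounded by a function of the norm of \<open>y\<close>, and a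
  sum over shells remains. The other case is the same with \<open>a\<close> and \<open>b\<close> exchanged.
\<close>
lemma convolution_decay:
  assumes "a < CARD('d::finite)" "b < CARD('d)" "CARD('d) < a + b"
  shows "\<exists>C>0. \<forall>x Y. finite Y \<longrightarrow>
    (\<Sum>y\<in>Y. decay a y * decay b (x - y)) \<le> C * decay (a + b - CARD('d)) (x :: int ^ 'd)"
proof -
  define K where "K = 2 * real CARD('d) * 3 ^ CARD('d)"
  define h where "h a b m k = 1 / (real k ^ a * real (max m k) ^ b)" for a b m k :: nat
  have h0: "0 \<le> h a b m k" for a b m k by (simp add: h_def)
  have K: "0 < K" by (simp add: K_def)
  have kernel: "(\<Sum>y\<in>Y. h a b m (nrm y)) \<le> K * (2 / real m ^ (a + b - CARD('d)))"
    if Y: "finite Y" and ab: "a < CARD('d)" "b < CARD('d)" "CARD('d) < a + b" "1 \<le> m"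
    for Y :: "(int ^ 'd) set" and a b m
  proof -
    obtain n0 where "Y \<subseteq> cube n0" using finite_subset_cube[OF Y] by auto
    then have n: "Y \<subseteq> cube (Suc n0)" using cube_mono[of n0 "Suc n0"] by auto
    have "(\<Sum>y\<in>Y. h a b m (nrm y)) \<le> (\<Sum>y\<in>(cube (Suc n0) :: (int ^ 'd) set). h a b m (nrm y))"
      using n h0 by (intro sum_mono2) auto
    also have "\<dots> \<le> K * (\<Sum>k=1..Suc n0. real k ^ (CARD('d) - 1) * h a b m k)"
      unfolding K_def by (rule sum_over_cube_bounds(2)[where f = "h a b m" and 'd = 'd]) (auto simp: h0)
    also have "\<dots> \<le> K * (2 / real m ^ (a + b - CARD('d)))"
      unfolding h_def using ab K by (intro mult_left_mono sum_convolution_kernel) auto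
    finally show ?thesis .
  qed
  have split: "decay a y * decay b (x - y) \<le> 2 ^ b * h a b (nrm x) (nrm y)"
    if "nrm y \<le> nrm (x - y)" for a b and x y :: "int ^ 'd"
  proof -
    have "nrm x \<le> nrm y + nrm (x - y)" using nrm_triangle[of y "x - y"] by simp
    then have "real (max (nrm x) (nrm y)) \<le> 2 * real (nrm (x - y))" using that by auto
    then have "real (max (nrm x) (nrm y)) ^ b \<le> (2 * real (nrm (x - y))) ^ b"
      by (rule power_mono) simp
    then have "real (max (nrm x) (nrm y)) ^ b \<le> 2 ^ b * real (nrm (x - y)) ^ b"
      by (simp only: power_mult_distrib)
    moreover have "0 < real (max (nrm x) (nrm y)) ^ b" by (simp add: max_def)
    ultimately have "1 / real (nrm (x - y)) ^ b \<le> 2 ^ b / real (max (nrm x) (nrm y)) ^ b"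
      by (simp add: field_simps)
    then have "1 / real (nrm y) ^ a * (1 / real (nrm (x - y)) ^ b)
        \<le> 1 / real (nrm y) ^ a * (2 ^ b / real (max (nrm x) (nrm y)) ^ b)"
      by (intro mult_left_mono) auto
    then show ?thesis by (simp add: decay_def h_def)
  qed
  define C where "C = (2 ^ b + 2 ^ a) * K * 2"
  have "(\<Sum>y\<in>Y. decay a y * decay b (x - y)) \<le> C * decay (a + b - CARD('d)) x"
    if Y: "finite Y" for x :: "int ^ 'd" and Y
  proof -
    have "(\<Sum>y\<in>Y. decay a y * decay b (x - y))
      \<le> (\<Sum>y\<in>Y. 2 ^ b * h a b (nrm x) (nrm y) + 2 ^ a * h b a (nrm x) (nrm (x - y)))"
    proof (rule sum_mono)
      fix y
      show "decay a y * decay b (x - y) \<le> 2 ^ b * h a b (nrm x) (nrm y) + 2 ^ a * h b a (nrm x) (nrm (x - y))"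
      proof (cases "nrm y \<le> nrm (x - y)")
        case True
        then show ?thesis using split[OF True, of a b] h0[of b a "nrm x" "nrm (x - y)"] by (simp add: add_increasing2)
      next
        case False
        then have "decay b (x - y) * decay a (x - (x - y)) \<le> 2 ^ a * h b a (nrm x) (nrm (x - y))"
          by (intro split) simp
        then show ?thesis using h0[of a b "nrm x" "nrm y"] by (simp add: add_increasing mult.commute)
      qed
    qed
    also have "\<dots> = 2 ^ b * (\<Sum>y\<in>Y. h a b (nrm x) (nrm y)) + 2 ^ a * (\<Sum>y\<in>(\<lambda>y. x - y) ` Y. h b a (nrm x) (nrm y))"
      by (simp add: sum.distrib sum_distrib_left sum.reindex inj_on_def)
    also have "\<dots> \<le> 2 ^ b * (K * (2 / real (nrm x) ^ (a + b - CARD('d)))) + 2 ^ a * (K * (2 / real (nrm x) ^ (b + a - CARD('d))))"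
      using assms Y by (intro add_mono mult_left_mono kernel) auto
    also have "\<dots> = C * decay (a + b - CARD('d)) x"
      by (simp add: C_def decay_def algebra_simps)
    finally show ?thesis .
  qed
  moreover have "0 < C" using K by (simp add: C_def add_pos_pos)
  ultimately show ?thesis by blast
qed

lemma decay_shift:
  assumes "sup_norm a \<le> l"
  shows "decay b (x - a) \<le> real (1 + l) ^ b * decay b x"
proof -
  have "nrm x \<le> nrm (x - a) + l"
    using sup_norm_triangle[of "x - a" a] assms by (auto simp: nrm_def)
  also have "\<dots> \<le> nrm (x - a) * (1 + l)" using nrm_ge_1(1)[of "x - a"] by (simp add: add_mult_distrib2)
  finally have "real (nrm x) \<le> real (1 + l) * real (nrm (x - a))"
    by (simp only: mult.commute of_nat_mult[symmetric] of_nat_le_iff)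
  then have "real (nrm x) ^ b \<le> real (1 + l) ^ b * real (nrm (x - a)) ^ b"
    unfolding power_mult_distrib[symmetric] by (intro power_mono) auto
  then show ?thesis by (simp add: decay_def field_simps)
qed

lemma bracket_bounds:
  "real (nrm x) \<le> bracket x" "bracket x \<le> real CARD('d) * real (nrm (x :: int ^ 'd::finite))"
proof -
  let ?v = "\<chi> i. real_of_int (x $ i)"
  have comp: "real_of_int \<bar>x $ i\<bar> \<le> l2_norm x" for i
    using component_le_norm_cart[of ?v i] by (simp add: l2_norm_def)
  have "x $ i \<le> \<lfloor>l2_norm x\<rfloor> \<and> - (x $ i) \<le> \<lfloor>l2_norm x\<rfloor>" for i
    using comp[of i] by (auto simp: le_floor_iff)
  moreover have "0 \<le> l2_norm x" by (simp add: l2_norm_def)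
  ultimately have "sup_norm x \<le> nat \<lfloor>l2_norm x\<rfloor>"
    unfolding sup_norm_le_iff by (auto simp: abs_le_iff)
  then have "real (sup_norm x) \<le> l2_norm x" using \<open>0 \<le> l2_norm x\<close> by linarith
  then show "real (nrm x) \<le> bracket x" by (auto simp: nrm_def bracket_def)
  have "l2_norm x \<le> (\<Sum>i\<in>UNIV. \<bar>?v $ i\<bar>)" unfolding l2_norm_def by (rule norm_le_l1_cart)
  also have "\<dots> \<le> (\<Sum>i\<in>(UNIV :: 'd set). real (nrm x))"
  proof (rule sum_mono)
    fix i
    have "\<bar>x $ i\<bar> \<le> int (nrm x)" using abs_nth_le_sup_norm[of x i] by (auto simp: nrm_def)
    then show "\<bar>?v $ i\<bar> \<le> real (nrm x)" by simp
  qed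
  finally have "l2_norm x \<le> real CARD('d) * real (nrm x)" by simp
  moreover have "1 * 1 \<le> real CARD('d) * real (nrm x)"
    by (intro mult_mono) (auto simp: Suc_le_eq)
  ultimately show "bracket x \<le> real CARD('d) * real (nrm x)" by (simp add: bracket_def)
qed

section \<open>Convolutions and the square diagram\<close>

text \<open>
  Sums over the lattice as integrals, which makes Tonelli's theorem and the invariance under bijections
  available.
\<close>
abbreviation lsum :: "(int ^ 'd::finite \<Rightarrow> ennreal) \<Rightarrow> ennreal"
  where "lsum f \<equiv> \<integral>\<^sup>+x. f x \<partial>count_space UNIV"

lemma SUP_finite_sums_eq_SUP_cubes:
  fixes f :: "int ^ 'd::finite \<Rightarrow> ennreal"
  shows "(SUP F\<in>{F. finite F}. sum f F) = (SUP n. sum f (cube n))"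
proof (rule antisym)
  show "(SUP F\<in>{F. finite F}. sum f F) \<le> (SUP n. sum f (cube n))"
  proof (rule SUP_least)
    fix F :: "(int ^ 'd) set" assume "F \<in> {F. finite F}"
    then obtain n where n: "F \<subseteq> cube n" using finite_subset_cube[of F] by auto
    have "sum f F \<le> sum f (cube n)" using n by (intro sum_mono2) auto
    also have "\<dots> \<le> (SUP n. sum f (cube n))" by (rule SUP_upper) simp
    finally show "sum f F \<le> (SUP n. sum f (cube n))" .
  qed
qed (auto intro!: SUP_least SUP_upper)

lemma infsum_eq_lsum: "(\<Sum>\<^sub>\<infinity>x. f x) = lsum (f :: int ^ 'd::finite \<Rightarrow> ennreal)"
proof -
  have "lsum f = lsum (\<lambda>x. SUP n. f x * indicator (cube n) x)"
  proof (rule nn_integral_cong)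
    fix x :: "int ^ 'd"
    have "f x \<le> f x * indicator (cube (sup_norm x)) x" by (simp add: cube_def)
    also have "\<dots> \<le> (SUP n. f x * indicator (cube n) x)" by (rule SUP_upper) simp
    finally have "f x \<le> (SUP n. f x * indicator (cube n) x)" .
    moreover have "(SUP n. f x * indicator (cube n) x) \<le> f x"
      by (rule SUP_least) (simp split: split_indicator)
    ultimately show "f x = (SUP n. f x * indicator (cube n) x)" by simp
  qed
  also have "\<dots> = (SUP n. lsum (\<lambda>x. f x * indicator (cube n) x))"
  proof (rule nn_integral_monotone_convergence_SUP)
    show "incseq (\<lambda>n x. f x * indicator (cube n) x)"
    proof (intro monoI le_funI)
      fix m n :: nat and x :: "int ^ 'd"
      assume "m \<le> n"
      then show "f x * indicator (cube m) x \<le> f x * indicator (cube n) x"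
        using cube_mono[of m n] by (auto split: split_indicator)
    qed
  qed simp
  also have "\<dots> = (SUP n. sum f (cube n))"
    by (simp add: nn_integral_count_space_indicator[symmetric] nn_integral_count_space_finite
        flip: nn_integral_count_space_indicator)
  also have "\<dots> = (\<Sum>\<^sub>\<infinity>x. f x)"
    by (subst nonneg_infsum_complete) (auto simp: SUP_finite_sums_eq_SUP_cubes)
  finally show ?thesis ..
qed

lemma lsum_le:
  assumes "\<And>F. finite F \<Longrightarrow> sum f F \<le> c"
  shows "lsum f \<le> c"
  unfolding infsum_eq_lsum[symmetric] using assms
  by (subst nonneg_infsum_complete) (auto intro!: SUP_least)

lemma sum_le_lsum: "finite F \<Longrightarrow> sum f F \<le> lsum f"
  unfolding infsum_eq_lsum[symmetric]
  by (subst nonneg_infsum_complete) (auto intro!: SUP_upper)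

lemma lsum_shift: "lsum (\<lambda>y. f (y - x)) = lsum f"
  by (rule nn_integral_bij_count_space) (rule bij_betwI[where g = "\<lambda>y. y + x"]; simp)

lemma lsum_reflect: "lsum (\<lambda>y. f (x - y)) = lsum f"
  by (rule nn_integral_bij_count_space) (rule bij_betwI[where g = "\<lambda>y. x - y"]; simp)

lemma lsum_minus: "lsum (\<lambda>y. f (- y)) = lsum f"
  using lsum_reflect[of f 0] by simp

lemma lsum_swap: "lsum (\<lambda>x. lsum (\<lambda>y. f x y)) = lsum (\<lambda>y. lsum (\<lambda>x. f x y))"
  using nn_integral_fst_count_space[of "\<lambda>(x, y). f x y"] nn_integral_snd_count_space[of "\<lambda>(x, y). f x y"]
  by simp

lemma conv_eq_lsum: "(f \<circledast> g) x = lsum (\<lambda>y. f y * g (x - y))"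
  by (simp add: conv_def infsum_eq_lsum)

lemma conv_assoc: "(f \<circledast> g) \<circledast> h = f \<circledast> (g \<circledast> h)"
proof
  fix x
  have "((f \<circledast> g) \<circledast> h) x = lsum (\<lambda>y. lsum (\<lambda>z. f z * g (y - z) * h (x - y)))"
    by (simp add: conv_eq_lsum nn_integral_multc)
  also have "\<dots> = lsum (\<lambda>z. lsum (\<lambda>y. f z * g (y - z) * h (x - y)))"
    by (rule lsum_swap)
  also have "\<dots> = lsum (\<lambda>z. lsum (\<lambda>y. f z * (g y * h (x - z - y))))"
  proof (rule nn_integral_cong)
    fix z
    show "lsum (\<lambda>y. f z * g (y - z) * h (x - y)) = lsum (\<lambda>y. f z * (g y * h (x - z - y)))"
      using lsum_shift[of "\<lambda>y. f z * (g y * h (x - z - y))" z] by (simp add: algebra_simps)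
  qed
  also have "\<dots> = (f \<circledast> (g \<circledast> h)) x"
    by (simp add: conv_eq_lsum nn_integral_cmult)
  finally show "((f \<circledast> g) \<circledast> h) x = (f \<circledast> (g \<circledast> h)) x" .
qed

lemma conv_even:
  assumes "\<And>x. f (- x) = f x" "\<And>x. g (- x) = g x"
  shows "(f \<circledast> g) (- x) = (f \<circledast> g) x"
proof -
  have "(f \<circledast> g) (- x) = lsum (\<lambda>y. f (- y) * g (- x - - y))"
    unfolding conv_eq_lsum by (rule lsum_minus[symmetric])
  also have "\<dots> = lsum (\<lambda>y. f y * g (x - y))"
    using assms(2)[of "x - _"] by (intro nn_integral_cong) (simp add: assms(1))
  finally show ?thesis by (simp add: conv_eq_lsum)
qed

text \<open>
  There is no subtraction on \<^typ>\<open>ennreal\<close>, so the square of the difference is taken for the ordered pair.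
\<close>
lemma ennreal_two_mult_le: "2 * (a * b) \<le> a * a + b * (b :: ennreal)"
proof -
  have le: "2 * (a * b) \<le> a * a + b * b" if ab: "a \<le> b" for a b :: ennreal
  proof -
    obtain c where "b = a + c" using ab by (auto simp: le_iff_add)
    then have "a * a + b * b = (a * b + a * b) + c * c"
      by (simp add: distrib_left distrib_right ac_simps)
    then show ?thesis by (simp add: mult_2)
  qed
  show ?thesis using le[of a b] le[of b a] by (cases "a \<le> b") (auto simp: ac_simps)
qed

text \<open>
  The arithmetic-geometric inequality for each term; both sums of squares equal the value at the origin.
\<close>
lemma conv_self_le_at_0:
  assumes "\<And>x. g (- x) = g x"
  shows "(g \<circledast> g) x \<le> (g \<circledast> g) 0"
proof -
  have "(g \<circledast> g) 0 = lsum (\<lambda>y. g y * g y)"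
    using assms by (simp add: conv_eq_lsum)
  have "2 * (g \<circledast> g) x = lsum (\<lambda>y. 2 * (g y * g (x - y)))"
    by (simp add: conv_eq_lsum nn_integral_cmult)
  also have "\<dots> \<le> lsum (\<lambda>y. g y * g y + g (x - y) * g (x - y))"
    by (intro nn_integral_mono ennreal_two_mult_le)
  also have "\<dots> = lsum (\<lambda>y. g y * g y) + lsum (\<lambda>y. g (x - y) * g (x - y))"
    by (rule nn_integral_add) auto
  also have "\<dots> = 2 * (g \<circledast> g) 0"
    using lsum_reflect[of "\<lambda>y. g y * g y" x] assms by (simp add: conv_eq_lsum mult_2)
  finally show ?thesis by (simp add: ennreal_mult_le_mult_iff)
qed

text \<open>
  The square diagram is the sum of the squares of the bubble, see \<open>square_diagram_eq\<close>.
\<close>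
definition bubble :: "int \<Rightarrow> real \<Rightarrow> int ^ 'd::finite \<Rightarrow> ennreal"
  where "bubble L p = (\<lambda>x. ennreal (tau L p x)) \<circledast> (\<lambda>x. ennreal (tau L p x))"

lemma square_diagram_eq:
  assumes "p \<in> {0..1}"
  shows "square_diagram TYPE('d::finite) L p = lsum (\<lambda>x :: int ^ 'd. bubble L p x * bubble L p x)"
proof -
  let ?t = "\<lambda>x :: int ^ 'd. ennreal (tau L p x)"
  let ?g = "bubble L p :: int ^ 'd \<Rightarrow> ennreal"
  have even: "?g (- x) = ?g x" for x
    unfolding bubble_def by (rule conv_even) (simp_all add: tau_minus[OF assms])
  have four: "?t \<circledast> ?t \<circledast> ?t \<circledast> ?t = ?g \<circledast> ?g"
    by (simp add: bubble_def conv_assoc)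
  have "square_diagram TYPE('d) L p = (?g \<circledast> ?g) 0"
    unfolding square_diagram_def Let_def four
    by (rule Greatest_equality) (use conv_self_le_at_0[of ?g] even in auto)
  also have "\<dots> = lsum (\<lambda>x. ?g x * ?g x)" using even by (simp add: conv_eq_lsum)
  finally show ?thesis .
qed

lemma chi_eq_susc:
  assumes L: "L \<ge> 1" and p: "0 \<le> p" "p < p_crit TYPE('d::finite) L"
  shows "chi TYPE('d) L p = ennreal (susc TYPE('d) L p)"
proof -
  have "ennreal (susc TYPE('d) L p) = (SUP F\<in>{F. finite F \<and> F \<subseteq> UNIV}. ennreal (sum (tau L p) (F :: (int ^ 'd) set)))"
    unfolding susc_def by (intro infsum_nonneg_is_SUPREMUM_ennreal tau_summable L p) auto
  also have "\<dots> = chi TYPE('d) L p"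
    unfolding chi_def by (subst nonneg_infsum_complete) (auto simp: sum_ennreal)
  finally show ?thesis ..
qed

text \<open>
  The total mass of a convolution is the product of the masses.
\<close>
lemma lsum_bubble: "lsum (bubble L p :: int ^ 'd::finite \<Rightarrow> ennreal) = chi TYPE('d) L p * chi TYPE('d) L p"
proof -
  let ?t = "\<lambda>x :: int ^ 'd. ennreal (tau L p x)"
  have "lsum (bubble L p :: int ^ 'd \<Rightarrow> ennreal) = lsum (\<lambda>x. lsum (\<lambda>y. ?t y * ?t (x - y)))"
    by (simp add: bubble_def conv_eq_lsum)
  also have "\<dots> = lsum (\<lambda>y. lsum (\<lambda>x. ?t y * ?t (x - y)))" by (rule lsum_swap)
  also have "\<dots> = lsum (\<lambda>y. ?t y * lsum ?t)" by (simp add: nn_integral_cmult lsum_shift[of ?t])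
  also have "\<dots> = lsum ?t * lsum ?t" by (simp add: nn_integral_multc)
  finally show ?thesis by (simp add: chi_def infsum_eq_lsum)
qed

section \<open>Bounds below and near the critical point\<close>

text \<open>
  Up to constants, the sum of \<open>|x|\<close> to the power \<open>8 - 2 d\<close> over the ball of radius \<open>n\<close>. In this form it is \<open>n\<close> for
  \<open>d = 7\<close> and the harmonic sum for \<open>d = 8\<close>.
\<close>
definition shell_sum :: "nat \<Rightarrow> nat \<Rightarrow> real"
  where "shell_sum d n = (\<Sum>k=1..n. real k ^ (d - 1) * (1 / real k ^ (2 * (d - 4))))"

lemma shell_sum_nonneg: "0 \<le> shell_sum d n"
  by (auto simp: shell_sum_def intro!: sum_nonneg)

context
  fixes L :: int and pc cl cu :: real
  assumes L: "L \<ge> 1" and dim: "CARD('d::finite) > 6" and cl: "0 < cl" and cu: "0 < cu"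
    and lower: "\<And>x :: int ^ 'd. cl * decay (CARD('d) - 2) x \<le> tau L pc x"
    and upper: "\<And>x :: int ^ 'd. tau L pc x \<le> cu * decay (CARD('d) - 2) x"
    and pc_pos: "0 < pc" and pc_def: "pc = p_crit TYPE('d) L"
begin

lemma bubble_upper:
  "\<exists>C>0. \<forall>x Y. finite Y \<longrightarrow> (\<Sum>y\<in>Y. tau L pc y * tau L pc (x - y)) \<le> C * decay (CARD('d) - 4) (x :: int ^ 'd)"
proof -
  have exponents: "CARD('d) - 2 < CARD('d)" "CARD('d) < CARD('d) - 2 + (CARD('d) - 2)"
    "CARD('d) - 2 + (CARD('d) - 2) - CARD('d) = CARD('d) - 4" using dim by arith+
  obtain C where C: "C > 0" "\<And>x Y. finite Y \<Longrightarrow> (\<Sum>y\<in>Y. decay (CARD('d) - 2) y * decay (CARD('d) - 2) (x - y))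
      \<le> C * decay (CARD('d) - 4) (x :: int ^ 'd)"
    using convolution_decay[OF exponents(1,1,2)] unfolding exponents(3) by blast
  have "(\<Sum>y\<in>Y. tau L pc y * tau L pc (x - y)) \<le> cu\<^sup>2 * C * decay (CARD('d) - 4) x"
    if Y: "finite Y" for x :: "int ^ 'd" and Y
  proof -
    have "(\<Sum>y\<in>Y. tau L pc y * tau L pc (x - y))
        \<le> (\<Sum>y\<in>Y. (cu * decay (CARD('d) - 2) y) * (cu * decay (CARD('d) - 2) (x - y)))"
      using cu by (intro sum_mono mult_mono upper) (auto simp: less_imp_le)
    also have "\<dots> = cu\<^sup>2 * (\<Sum>y\<in>Y. decay (CARD('d) - 2) y * decay (CARD('d) - 2) (x - y))"
      by (simp add: sum_distrib_left power2_eq_square mult_ac)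
    also have "\<dots> \<le> cu\<^sup>2 * (C * decay (CARD('d) - 4) x)" using C(2)[OF Y] by (intro mult_left_mono) auto
    finally show ?thesis by (simp add: mult.assoc)
  qed
  then show ?thesis using C(1) cu by (intro exI[of _ "cu\<^sup>2 * C"]) auto
qed

lemma pc_in: "pc \<in> {0..1}"
  unfolding pc_def by (rule p_crit_in(1)[OF L])

text \<open>
  Two convolutions of the critical two-point function leave a bound by \<open>|w|\<close> to the power \<open>6 - d\<close>, which is small
  for large \<open>w\<close>. This is where \<open>d > 6\<close> is essential.
\<close>
lemma open_triangle_small:
  assumes "0 < \<epsilon>"
  shows "\<exists>w :: int ^ 'd. \<forall>A B. finite A \<longrightarrow> finite B \<longrightarrow>
    (\<Sum>a\<in>A. \<Sum>b\<in>B. tau L pc a * tau L pc b * tau L pc (b - a - w)) \<le> \<epsilon>"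
proof -
  obtain C where C: "C > 0" "\<And>x Y. finite Y \<Longrightarrow> (\<Sum>y\<in>Y. tau L pc y * tau L pc (x - y)) \<le> C * decay (CARD('d) - 4) (x :: int ^ 'd)"
    using bubble_upper by blast
  have exponents: "CARD('d) - 2 < CARD('d)" "CARD('d) - 4 < CARD('d)"
    "CARD('d) < CARD('d) - 2 + (CARD('d) - 4)"
    "CARD('d) - 2 + (CARD('d) - 4) - CARD('d) = CARD('d) - 6" using dim by arith+
  obtain C' where C': "C' > 0" "\<And>x Y. finite Y \<Longrightarrow> (\<Sum>y\<in>Y. decay (CARD('d) - 2) y * decay (CARD('d) - 4) (x - y))
      \<le> C' * decay (CARD('d) - 6) (x :: int ^ 'd)"
    using convolution_decay[OF exponents(1,2,3)] unfolding exponents(4) by blast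
  obtain M :: nat where M: "cu * C * C' / \<epsilon> < real M" using reals_Archimedean2 by blast
  define w :: "int ^ 'd" where "w = (\<chi> i. int M)"
  have "\<bar>w $ i\<bar> \<le> int (nrm w)" for i
    using abs_nth_le_sup_norm[of w i] by (auto simp: nrm_def)
  then have "M \<le> nrm w" by (simp add: w_def)
  then have "real M \<le> real (nrm w)" by simp
  also have "\<dots> \<le> real (nrm w) ^ (CARD('d) - 6)"
    using dim self_le_power[of "real (nrm w)" "CARD('d) - 6"] by simp
  finally have "cu * C * C' / \<epsilon> \<le> real (nrm w) ^ (CARD('d) - 6)" using M by linarith
  then have small: "cu * C * C' * decay (CARD('d) - 6) w \<le> \<epsilon>"
    using assms by (simp add: decay_def field_simps)
  have "(\<Sum>a\<in>A. \<Sum>b\<in>B. tau L pc a * tau L pc b * tau L pc (b - a - w)) \<le> \<epsilon>"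
    if A: "finite A" and B: "finite B" for A B
  proof -
    have "(\<Sum>a\<in>A. \<Sum>b\<in>B. tau L pc a * tau L pc b * tau L pc (b - a - w))
        = (\<Sum>a\<in>A. tau L pc a * (\<Sum>b\<in>B. tau L pc b * tau L pc (a + w - b)))"
    proof -
      have "tau L pc (b - a - w) = tau L pc (a + w - b)" for a b
        using tau_minus[OF pc_in, of L "a + w - b"] by (simp add: algebra_simps)
      then show ?thesis by (simp add: sum_distrib_left mult.assoc)
    qed
    also have "\<dots> \<le> (\<Sum>a\<in>A. (cu * decay (CARD('d) - 2) a) * (C * decay (CARD('d) - 4) (a + w)))"
      using cu C(1) B by (intro sum_mono mult_mono upper C) (auto intro!: sum_nonneg simp: less_imp_le)
    also have "\<dots> = cu * C * (\<Sum>a\<in>A. decay (CARD('d) - 2) a * decay (CARD('d) - 4) (- w - a))"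
    proof -
      have "decay (CARD('d) - 4) (a + w) = decay (CARD('d) - 4) (- w - a)" for a
      proof -
        have "- w - a = - (a + w)" by simp
        then show ?thesis by (simp only: decay_minus)
      qed
      then show ?thesis by (simp add: sum_distrib_left mult_ac)
    qed
    also have "\<dots> \<le> cu * C * (C' * decay (CARD('d) - 6) (- w))"
      using cu C(1) A by (intro mult_left_mono C') auto
    also have "\<dots> \<le> \<epsilon>" using small by (simp add: mult_ac)
    finally show ?thesis .
  qed
  then show ?thesis by blast
qed

lemma susc_gap_bound:
  "\<exists>K>0. \<forall>p. pc / 2 \<le> p \<longrightarrow> p < pc \<longrightarrow> (pc - p) * susc TYPE('d) L p \<le> K"
proof -
  obtain w :: "int ^ 'd" where w: "\<And>A B. finite A \<Longrightarrow> finite B \<Longrightarrow>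
    (\<Sum>a\<in>A. \<Sum>b\<in>B. tau L pc a * tau L pc b * tau L pc (b - a - w)) \<le> 1 / 8"
    using open_triangle_small[of "1 / 8"] by auto
  then show ?thesis
    unfolding pc_def using pc_pos by (intro susc_upper_bound[OF L, where w = w]) (auto simp: pc_def)
qed

text \<open>
  By \<open>tau_decrement\<close> the loss against the critical two-point function is at most a constant times
  \<open>(p\<^sub>c - p) |x|\<^sup>2\<close> relative to \<open>|x|\<close> to the power \<open>2 - d\<close>; the condition on \<open>x\<close> makes it at most half of the critical
  lower bound.
\<close>
lemma tau_lower_near_pc:
  "\<exists>\<kappa>>0. \<forall>p x. 0 \<le> p \<longrightarrow> p < pc \<longrightarrow> (pc - p) * real (nrm x) ^ 2 \<le> \<kappa> \<longrightarrow>
    cl / 2 * decay (CARD('d) - 2) (x :: int ^ 'd) \<le> tau L p x"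
proof -
  obtain C where C: "C > 0" "\<And>x Y. finite Y \<Longrightarrow> (\<Sum>y\<in>Y. tau L pc y * tau L pc (x - y)) \<le> C * decay (CARD('d) - 4) (x :: int ^ 'd)"
    using bubble_upper by blast
  let ?N = "{a :: int ^ 'd. {0, a} \<in> edges L}"
  define D where "D = (real (card ?N) + 1) * (C * real (1 + nat L) ^ (CARD('d) - 4))"
  have D: "0 < D" using C by (simp add: D_def)
  have decr: "tau L pc x - tau L p x \<le> (pc - p) * (D * decay (CARD('d) - 4) x)"
    if p: "0 \<le> p" "p < pc" for p and x :: "int ^ 'd"
  proof (rule tau_decrement)
    fix A :: "(int ^ 'd) set" assume A: "finite A"
    have "(\<Sum>u\<in>A. \<Sum>a\<in>?N. tau L pc u * tau L pc (x - u - a)) = (\<Sum>a\<in>?N. \<Sum>u\<in>A. tau L pc u * tau L pc (x - a - u))"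
      by (subst sum.swap) (simp add: algebra_simps)
    also have "\<dots> \<le> (\<Sum>a\<in>?N. C * (real (1 + nat L) ^ (CARD('d) - 4) * decay (CARD('d) - 4) x))"
    proof (rule sum_mono)
      fix a assume "a \<in> ?N"
      then have "sup_norm a \<le> nat L" using edge_sup_norm[of 0 a L] sup_norm_minus[of a] by simp
      then have "decay (CARD('d) - 4) (x - a) \<le> real (1 + nat L) ^ (CARD('d) - 4) * decay (CARD('d) - 4) x"
        by (rule decay_shift)
      then have "C * decay (CARD('d) - 4) (x - a) \<le> C * (real (1 + nat L) ^ (CARD('d) - 4) * decay (CARD('d) - 4) x)"
        using C(1) by (intro mult_left_mono) auto
      then show "(\<Sum>u\<in>A. tau L pc u * tau L pc (x - a - u)) \<le> C * (real (1 + nat L) ^ (CARD('d) - 4) * decay (CARD('d) - 4) x)"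
        using C(2)[OF A, of "x - a"] by simp
    qed
    also have "\<dots> = real (card ?N) * (C * real (1 + nat L) ^ (CARD('d) - 4)) * decay (CARD('d) - 4) x"
      by (simp add: mult_ac)
    also have "\<dots> \<le> D * decay (CARD('d) - 4) x"
      unfolding D_def using C(1) by (intro mult_right_mono) (auto simp: less_imp_le)
    finally show "(\<Sum>u\<in>A. \<Sum>a\<in>?N. tau L pc u * tau L pc (x - u - a)) \<le> D * decay (CARD('d) - 4) x" .
  qed (use p pc_in in auto)
  have "cl / 2 * decay (CARD('d) - 2) x \<le> tau L p x"
    if p: "0 \<le> p" "p < pc" and near: "(pc - p) * real (nrm x) ^ 2 \<le> cl / (2 * D)" for p and x :: "int ^ 'd"
  proof -
    have nz: "nrm x \<noteq> 0" using nrm_ge_1(2)[of x] by linarith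
    have "CARD('d) - 2 = Suc (Suc (CARD('d) - 4))" using dim by simp
    then have "decay (CARD('d) - 4) x = real (nrm x) ^ 2 * decay (CARD('d) - 2) x"
      by (simp add: nz decay_def power2_eq_square)
    then have "(pc - p) * (D * decay (CARD('d) - 4) x) = D * ((pc - p) * real (nrm x) ^ 2) * decay (CARD('d) - 2) x"
      by simp
    also have "\<dots> \<le> D * (cl / (2 * D)) * decay (CARD('d) - 2) x"
      using D near by (intro mult_right_mono mult_left_mono) (auto simp: less_imp_le)
    also have "\<dots> = cl / 2 * decay (CARD('d) - 2) x" using D by simp
    finally show ?thesis using decr[OF p, of x] lower[of x] by (simp add: field_simps)
  qed
  then show ?thesis using cl D by (intro exI[of _ "cl / (2 * D)"]) auto
qed

text \<open>
  One factor of the squared bubble is estimated pointwise outside of the cube of radius \<open>n\<close>, and the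
  other one by the total mass \<open>\<chi>\<^sup>2\<close>; inside, both are estimated pointwise.
\<close>
lemma square_upper:
  "\<exists>C>0. \<forall>p n. 0 \<le> p \<longrightarrow> p < pc \<longrightarrow> 1 \<le> n \<longrightarrow> square_diagram TYPE('d) L p
    \<le> ennreal (C * (shell_sum CARD('d) n + (susc TYPE('d) L p)\<^sup>2 / real n ^ (CARD('d) - 4)))"
proof -
  let ?d = "CARD('d)"
  obtain C where C: "C > 0" "\<And>x Y. finite Y \<Longrightarrow> (\<Sum>y\<in>Y. tau L pc y * tau L pc (x - y)) \<le> C * decay (CARD('d) - 4) (x :: int ^ 'd)"
    using bubble_upper by blast
  define K where "K = 2 * real ?d * 3 ^ ?d"
  have K: "0 < K" by (simp add: K_def)
  have "square_diagram TYPE('d) L p \<le> ennreal ((C\<^sup>2 * K + C) * (shell_sum ?d n + (susc TYPE('d) L p)\<^sup>2 / real n ^ (?d - 4)))"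
    if p: "0 \<le> p" "p < pc" and n: "1 \<le> n" for p n
  proof -
    let ?G = "bubble L p :: int ^ 'd \<Rightarrow> ennreal"
    have p01: "p \<in> {0..1}" using p pc_in by auto
    have G: "?G x \<le> ennreal (C * decay (?d - 4) x)" for x
      unfolding bubble_def conv_eq_lsum
    proof (rule lsum_le)
      fix Y :: "(int ^ 'd) set" assume Y: "finite Y"
      have "(\<Sum>y\<in>Y. tau L p y * tau L p (x - y)) \<le> (\<Sum>y\<in>Y. tau L pc y * tau L pc (x - y))"
        using p pc_in by (intro sum_mono mult_mono tau_mono) auto
      also have "\<dots> \<le> C * decay (?d - 4) x" by (rule C(2)[OF Y])
      finally have "ennreal (\<Sum>y\<in>Y. tau L p y * tau L p (x - y)) \<le> ennreal (C * decay (?d - 4) x)"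
        by (rule ennreal_leI)
      then show "(\<Sum>y\<in>Y. ennreal (tau L p y) * ennreal (tau L p (x - y))) \<le> ennreal (C * decay (?d - 4) x)"
        by (simp add: ennreal_mult[symmetric])
    qed
    let ?b = "\<lambda>x :: int ^ 'd. ennreal (C * decay (?d - 4) x)"
    have far: "?G x \<le> ennreal (C / real n ^ (?d - 4))" if x: "x \<notin> cube n" for x
    proof -
      have "real n ^ (?d - 4) \<le> real (nrm x) ^ (?d - 4)"
        using x n by (intro power_mono) (auto simp: in_cube_iff_nrm)
      then have "C * decay (?d - 4) x \<le> C / real n ^ (?d - 4)"
        using C(1) n by (auto simp: decay_def intro!: divide_left_mono)
      then show ?thesis using G[of x] by (meson ennreal_leI order_trans)
    qed
    have "square_diagram TYPE('d) L p = lsum (\<lambda>x. ?G x * ?G x)"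
      by (rule square_diagram_eq[OF p01])
    also have "\<dots> \<le> lsum (\<lambda>x :: int ^ 'd. ?b x * ?b x * indicator (cube n) x
        + ?G x * ennreal (C / real n ^ (?d - 4)))"
    proof (rule nn_integral_mono)
      fix x :: "int ^ 'd"
      show "?G x * ?G x \<le> ?b x * ?b x * indicator (cube n) x
        + ?G x * ennreal (C / real n ^ (?d - 4))"
      proof (cases "x \<in> cube n")
        case True
        have "?G x * ?G x \<le> ?b x * ?b x"
          using G[of x] by (intro mult_mono) auto
        then show ?thesis using True by (simp add: add_increasing2)
      next
        case False
        then show ?thesis using far[OF False] by (simp add: mult_left_mono)
      qed
    qed
    also have "\<dots> = lsum (\<lambda>x :: int ^ 'd. ?b x * ?b x * indicator (cube n) x)
        + lsum ?G * ennreal (C / real n ^ (?d - 4))"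
      by (simp add: nn_integral_add nn_integral_multc)
    also have "lsum ?G = ennreal ((susc TYPE('d) L p)\<^sup>2)"
      using chi_eq_susc[OF L, of p, where 'd = 'd] susc_ge_1[OF L, of p, where 'd = 'd] p
      unfolding lsum_bubble by (simp add: pc_def ennreal_mult[symmetric] power2_eq_square)
    also have "\<dots> * ennreal (C / real n ^ (?d - 4)) = ennreal (C * ((susc TYPE('d) L p)\<^sup>2 / real n ^ (?d - 4)))"
      using C(1) by (simp add: ennreal_mult[symmetric] mult.commute)
    also have "lsum (\<lambda>x :: int ^ 'd. ?b x * ?b x * indicator (cube n) x)
        \<le> ennreal (C\<^sup>2 * K * shell_sum ?d n)"
    proof -
      have "lsum (\<lambda>x :: int ^ 'd. ?b x * ?b x * indicator (cube n) x)
        = (\<Sum>x\<in>(cube n :: (int ^ 'd) set). ?b x * ?b x)"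
        by (simp add: nn_integral_count_space_finite flip: nn_integral_count_space_indicator)
      also have "\<dots> = ennreal (\<Sum>x\<in>(cube n :: (int ^ 'd) set). C\<^sup>2 * (1 / real (nrm x) ^ (2 * (?d - 4))))"
        using C(1) by (simp add: ennreal_mult[symmetric] decay_def power2_eq_square mult_2 power_add mult_ac
            sum_ennreal)
      also have "\<dots> \<le> ennreal (C\<^sup>2 * K * shell_sum ?d n)"
      proof (rule ennreal_leI)
        have "(\<Sum>x\<in>(cube n :: (int ^ 'd) set). C\<^sup>2 * (1 / real (nrm x) ^ (2 * (?d - 4))))
            = C\<^sup>2 * (\<Sum>x\<in>(cube n :: (int ^ 'd) set). 1 / real (nrm x) ^ (2 * (?d - 4)))"
          by (simp add: sum_distrib_left)
        also have "\<dots> \<le> C\<^sup>2 * (K * shell_sum ?d n)"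
          unfolding K_def shell_sum_def
          by (intro mult_left_mono sum_over_cube_bounds(2)[OF n, where f = "\<lambda>k. 1 / real k ^ (2 * (?d - 4))"]) auto
        finally show "(\<Sum>x\<in>(cube n :: (int ^ 'd) set). C\<^sup>2 * (1 / real (nrm x) ^ (2 * (?d - 4)))) \<le> C\<^sup>2 * K * shell_sum ?d n"
          by (simp add: mult.assoc)
      qed
      finally show ?thesis .
    qed
    also have "ennreal (C\<^sup>2 * K * shell_sum ?d n) + ennreal (C * ((susc TYPE('d) L p)\<^sup>2 / real n ^ (?d - 4)))
        = ennreal (C\<^sup>2 * K * shell_sum ?d n + C * ((susc TYPE('d) L p)\<^sup>2 / real n ^ (?d - 4)))"
      using C(1) K by (intro ennreal_plus[symmetric]) (auto simp: shell_sum_nonneg)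
    also have "\<dots> \<le> ennreal ((C\<^sup>2 * K + C) * (shell_sum ?d n + (susc TYPE('d) L p)\<^sup>2 / real n ^ (?d - 4)))"
    proof (rule ennreal_leI)
      have expand: "a * s + C * t \<le> (a + C) * (s + t)" if "0 \<le> a" "0 \<le> s" "0 \<le> t" for a s t :: real
        using that C(1) by (simp add: distrib_left distrib_right)
      show "C\<^sup>2 * K * shell_sum ?d n + C * ((susc TYPE('d) L p)\<^sup>2 / real n ^ (?d - 4))
        \<le> (C\<^sup>2 * K + C) * (shell_sum ?d n + (susc TYPE('d) L p)\<^sup>2 / real n ^ (?d - 4))"
        using K by (intro expand shell_sum_nonneg) auto
    qed
    finally show ?thesis by (simp add: add_right_mono)
  qed
  moreover have "0 < C\<^sup>2 * K + C" using C(1) K by (simp add: add_pos_pos)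
  ultimately show ?thesis by blast
qed

text \<open>
  For \<open>x\<close> of norm \<open>m \<le> n\<close>, restricting the convolution to the \<open>y\<close> of norm at most \<open>m\<close> keeps \<open>y\<close> and \<open>x - y\<close>
  in the range of \<open>tau_lower_near_pc\<close>, which explains the factor \<open>2\<close> in the condition. There are about \<open>m\<close> to the power
  \<open>d\<close> such \<open>y\<close>, and each contributes order \<open>m\<close> to the power \<open>4 - 2 d\<close>. The bound on the susceptibility is weak, and serves
  only to show that it diverges.
\<close>
lemma square_lower:
  "\<exists>c>0. \<exists>\<kappa>>0. \<forall>p n. 0 \<le> p \<longrightarrow> p < pc \<longrightarrow> 1 \<le> n \<longrightarrow> (pc - p) * real (2 * n) ^ 2 \<le> \<kappa> \<longrightarrow>
    ennreal (c * shell_sum CARD('d) n) \<le> square_diagram TYPE('d) L p \<and> c * real n \<le> susc TYPE('d) L p"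
proof -
  let ?d = "CARD('d)"
  obtain \<kappa> where \<kappa>: "\<kappa> > 0" "\<And>p x. 0 \<le> p \<Longrightarrow> p < pc \<Longrightarrow> (pc - p) * real (nrm x) ^ 2 \<le> \<kappa> \<Longrightarrow>
    cl / 2 * decay (?d - 2) (x :: int ^ 'd) \<le> tau L p x"
    using tau_lower_near_pc by blast
  define c1 where "c1 = (cl / 2)\<^sup>2 / 2 ^ (?d - 2)"
  have c1: "0 < c1" using cl by (simp add: c1_def)
  have main: "ennreal (c1\<^sup>2 * shell_sum ?d n) \<le> square_diagram TYPE('d) L p \<and> cl / 2 * real n \<le> susc TYPE('d) L p"
    if p: "0 \<le> p" "p < pc" and n: "1 \<le> n" and near: "(pc - p) * real (2 * n) ^ 2 \<le> \<kappa>" for p n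
  proof
    have p01: "p \<in> {0..1}" using p pc_in by auto
    have tau_lower: "cl / 2 * decay (?d - 2) x \<le> tau L p x" if "nrm x \<le> 2 * n" for x :: "int ^ 'd"
    proof (rule \<kappa>(2)[OF p])
      have "(pc - p) * real (nrm x) ^ 2 \<le> (pc - p) * real (2 * n) ^ 2"
        using that p by (intro mult_left_mono power_mono) auto
      then show "(pc - p) * real (nrm x) ^ 2 \<le> \<kappa>" using near by simp
    qed
    have bubble: "ennreal (c1 * decay (?d - 4) x) \<le> bubble L p x" if x: "x \<in> cube n" for x :: "int ^ 'd"
    proof -
      define m where "m = nrm x"
      have m: "1 \<le> m" "m \<le> n" using x n by (auto simp: m_def in_cube_iff_nrm)
      have product_lower: "(cl / 2)\<^sup>2 / 2 ^ (?d - 2) * (1 / real m ^ (?d - 2)) * (1 / real m ^ (?d - 2)) \<le> tau L p y * tau L p (x - y)"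
        if y: "y \<in> cube m" for y
      proof -
        have ny: "nrm y \<le> m" using y m by (simp add: in_cube_iff_nrm)
        have nxy: "nrm (x - y) \<le> 2 * m" using nrm_triangle[of x "- y"] ny by (simp add: m_def)
        have "real (nrm y) ^ (?d - 2) \<le> real m ^ (?d - 2)" using ny by (intro power_mono) auto
        then have "1 / real m ^ (?d - 2) \<le> decay (?d - 2) y" using m by (auto simp: decay_def intro!: divide_left_mono)
        then have "cl / 2 * (1 / real m ^ (?d - 2)) \<le> cl / 2 * decay (?d - 2) y"
          using cl by (intro mult_left_mono) auto
        also have "\<dots> \<le> tau L p y" using ny m by (intro tau_lower) auto
        finally have 1: "cl / 2 * (1 / real m ^ (?d - 2)) \<le> tau L p y" .
        have "real (nrm (x - y)) ^ (?d - 2) \<le> real (2 * m) ^ (?d - 2)" using nxy by (intro power_mono of_nat_mono) auto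
        then have "1 / real (2 * m) ^ (?d - 2) \<le> decay (?d - 2) (x - y)" using m by (auto simp: decay_def intro!: divide_left_mono)
        then have "cl / 2 * (1 / real (2 * m) ^ (?d - 2)) \<le> cl / 2 * decay (?d - 2) (x - y)"
          using cl by (intro mult_left_mono) auto
        also have "\<dots> \<le> tau L p (x - y)" using nxy m by (intro tau_lower) auto
        finally have 2: "cl / 2 * (1 / real (2 * m) ^ (?d - 2)) \<le> tau L p (x - y)" .
        have "(cl / 2 * (1 / real m ^ (?d - 2))) * (cl / 2 * (1 / real (2 * m) ^ (?d - 2))) \<le> tau L p y * tau L p (x - y)"
          using 1 2 cl by (intro mult_mono) auto
        then show ?thesis by (simp add: power2_eq_square power_mult_distrib mult_ac)
      qed
      have "c1 * decay (?d - 4) x \<le> (\<Sum>y\<in>cube m. tau L p y * tau L p (x - y))"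
      proof -
        have "real m ^ ?d \<le> real (card (cube m :: (int ^ 'd) set))"
          unfolding card_cube of_nat_power by (intro power_mono) auto
        moreover have "real m ^ ?d * (1 / real m ^ (?d - 2) * (1 / real m ^ (?d - 2))) = decay (?d - 4) x"
        proof -
          have "real m ^ ?d * real m ^ (?d - 4) = real m ^ (?d - 2) * real m ^ (?d - 2)"
            using dim by (simp flip: power_add)
          then show ?thesis using m by (simp add: decay_def m_def[symmetric] field_simps)
        qed
        moreover have "0 \<le> 1 / real m ^ (?d - 2) * (1 / real m ^ (?d - 2))" by simp
        ultimately have "decay (?d - 4) x \<le> real (card (cube m :: (int ^ 'd) set)) * (1 / real m ^ (?d - 2) * (1 / real m ^ (?d - 2)))"
          using mult_right_mono by metis
        then have "c1 * decay (?d - 4) x \<le> c1 * (real (card (cube m :: (int ^ 'd) set)) * (1 / real m ^ (?d - 2) * (1 / real m ^ (?d - 2))))"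
          using c1 by (intro mult_left_mono) auto
        also have "\<dots> = (\<Sum>y\<in>(cube m :: (int ^ 'd) set). (cl / 2)\<^sup>2 / 2 ^ (?d - 2) * (1 / real m ^ (?d - 2)) * (1 / real m ^ (?d - 2)))"
          by (simp add: c1_def mult_ac)
        also have "\<dots> \<le> (\<Sum>y\<in>cube m. tau L p y * tau L p (x - y))" by (intro sum_mono product_lower)
        finally show ?thesis .
      qed
      then have "ennreal (c1 * decay (?d - 4) x) \<le> ennreal (\<Sum>y\<in>cube m. tau L p y * tau L p (x - y))"
        by (rule ennreal_leI)
      also have "\<dots> = (\<Sum>y\<in>cube m. ennreal (tau L p y) * ennreal (tau L p (x - y)))"
        by (simp add: ennreal_mult[symmetric] sum_ennreal)
      also have "\<dots> \<le> bubble L p x" unfolding bubble_def conv_eq_lsum by (rule sum_le_lsum) simp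
      finally show ?thesis .
    qed
    have "c1\<^sup>2 * shell_sum ?d n \<le> c1\<^sup>2 * (\<Sum>x\<in>(cube n :: (int ^ 'd) set). 1 / real (nrm x) ^ (2 * (?d - 4)))"
      unfolding shell_sum_def
      by (intro mult_left_mono sum_over_cube_bounds(1)[OF n, where f = "\<lambda>k. 1 / real k ^ (2 * (?d - 4))"]) auto
    also have "\<dots> = (\<Sum>x\<in>(cube n :: (int ^ 'd) set). (c1 * decay (?d - 4) x) * (c1 * decay (?d - 4) x))"
      by (simp add: sum_distrib_left decay_def power2_eq_square mult_2 power_add mult_ac)
    finally have "ennreal (c1\<^sup>2 * shell_sum ?d n) \<le> ennreal (\<Sum>x\<in>(cube n :: (int ^ 'd) set). (c1 * decay (?d - 4) x) * (c1 * decay (?d - 4) x))"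
      by (rule ennreal_leI)
    also have "\<dots> = (\<Sum>x\<in>(cube n :: (int ^ 'd) set). ennreal (c1 * decay (?d - 4) x) * ennreal (c1 * decay (?d - 4) x))"
      using c1 by (simp add: ennreal_mult[symmetric] sum_ennreal less_imp_le)
    also have "\<dots> \<le> (\<Sum>x\<in>(cube n :: (int ^ 'd) set). bubble L p x * bubble L p x)"
      using bubble by (intro sum_mono mult_mono) auto
    also have "\<dots> \<le> lsum (\<lambda>x :: int ^ 'd. bubble L p x * bubble L p x)" by (rule sum_le_lsum) simp
    also have "\<dots> = square_diagram TYPE('d) L p" by (rule square_diagram_eq[OF p01, symmetric])
    finally show "ennreal (c1\<^sup>2 * shell_sum ?d n) \<le> square_diagram TYPE('d) L p" .
    have "real n \<le> (\<Sum>k=1..n. real k ^ (?d - 1) * (1 / real k ^ (?d - 2)))"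
    proof -
      have "real n = (\<Sum>k=1..n. 1)" by simp
      also have "\<dots> \<le> (\<Sum>k=1..n. real k ^ (?d - 1) * (1 / real k ^ (?d - 2)))"
      proof (rule sum_mono)
        fix k assume k: "k \<in> {1..n}"
        have "?d - 1 = Suc (?d - 2)" using dim by simp
        then have "real k ^ (?d - 1) * (1 / real k ^ (?d - 2)) = real k" using k by simp
        then show "1 \<le> real k ^ (?d - 1) * (1 / real k ^ (?d - 2))" using k by simp
      qed
      finally show ?thesis .
    qed
    also have "\<dots> \<le> (\<Sum>x\<in>(cube n :: (int ^ 'd) set). decay (?d - 2) x)"
      unfolding decay_def by (rule sum_over_cube_bounds(1)[OF n, where f = "\<lambda>k. 1 / real k ^ (?d - 2)"]) auto
    finally have "cl / 2 * real n \<le> cl / 2 * (\<Sum>x\<in>(cube n :: (int ^ 'd) set). decay (?d - 2) x)"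
      using cl by (intro mult_left_mono) auto
    also have "\<dots> \<le> (\<Sum>x\<in>(cube n :: (int ^ 'd) set). tau L p x)"
      unfolding sum_distrib_left using n by (intro sum_mono tau_lower) (auto simp: in_cube_iff_nrm)
    also have "\<dots> \<le> susc TYPE('d) L p"
      using p by (intro sum_tau_le_susc[OF L]) (auto simp: pc_def)
    finally show "cl / 2 * real n \<le> susc TYPE('d) L p" .
  qed
  define c where "c = min (c1\<^sup>2) (cl / 2)"
  have c: "0 < c" using c1 cl by (simp add: c_def)
  have "ennreal (c * shell_sum ?d n) \<le> square_diagram TYPE('d) L p \<and> c * real n \<le> susc TYPE('d) L p"
    if "0 \<le> p" "p < pc" "1 \<le> n" "(pc - p) * real (2 * n) ^ 2 \<le> \<kappa>" for p n
  proof -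
    have "0 \<le> shell_sum ?d n" by (rule shell_sum_nonneg)
    then have "ennreal (c * shell_sum ?d n) \<le> ennreal (c1\<^sup>2 * shell_sum ?d n)" "c * real n \<le> cl / 2 * real n"
      by (intro ennreal_leI mult_right_mono; simp add: c_def)+
    then show ?thesis using main[OF that] by (auto intro: order_trans)
  qed
  then show ?thesis using c \<kappa>(1) by blast
qed

end

section \<open>Proof of the theorem\<close>

lemma bprob_at_0: "finite F \<Longrightarrow> bprob 0 F A = of_bool (A {})"
proof -
  assume "finite F"
  then have "bexp 0 F f = f {}" for f :: "'a set \<Rightarrow> real"
    by (induction F rule: finite_induct) (auto simp: bexp_insert)
  then show ?thesis by (simp add: bprob_def)
qed

lemma tau_at_0:
  assumes "x \<noteq> 0"
  shows "tau L 0 x = 0"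
proof -
  have "\<not> conn {} 0 x" using conn_in_vertices[of "{}" 0 x] assms by auto
  then have "(\<lambda>n. ftau 0 (cube_edges L n) 0 x) \<longlonglongrightarrow> 0" by (simp add: bprob_at_0)
  then show ?thesis using ftau_tendsto_tau[of 0 L 0 x] LIMSEQ_unique by fastforce
qed

lemma bprob_ge_power:
  assumes "finite F" "A F" "p \<in> {0..1}"
  shows "p ^ card F \<le> bprob p F A"
  using assms(1,2)
proof (induction F arbitrary: A rule: finite_induct)
  case (insert e F)
  have "p ^ card (insert e F) = p * p ^ card F" using insert.hyps by simp
  also have "\<dots> \<le> p * bprob p F (\<lambda>\<eta>. A (insert e \<eta>))"
    using insert assms(3) by (intro mult_left_mono) auto
  also have "\<dots> \<le> p * bprob p F (\<lambda>\<eta>. A (insert e \<eta>)) + (1 - p) * bprob p F A"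
    using assms(3) by (simp add: mult_nonneg_nonneg)
  also have "\<dots> = bprob p (insert e F) A" using insert.hyps by (simp add: bprob_def bexp_insert)
  finally show ?case .
qed (simp add: bprob_def)

lemma tau_pos:
  assumes "L \<ge> 1" "0 < p" "p \<le> 1"
  shows "0 < tau L p (x :: int ^ 'd::finite)"
proof -
  obtain xs where xs: "xs \<noteq> []" "hd xs = 0" "last xs = x" "path_edges xs \<subseteq> edges L"
    using conn_imp_path[OF conn_lattice[OF assms(1)]] by metis
  have p: "p \<in> {0..1}" using assms by auto
  have "0 < p ^ card (path_edges xs)" using assms by simp
  also have "\<dots> \<le> ftau p (path_edges xs) 0 x"
    using conn_path_edges[OF xs(1)] xs(2,3) by (intro bprob_ge_power p) auto
  also have "\<dots> \<le> tau L p (x - 0)" by (intro ftau_le_tau p xs) simp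
  finally show ?thesis by simp
qed

text \<open>
  The asymptotic equivalence holds outside of some cube. Inside, the finitely many values are positive, because an
  explicit path is open with positive probability; this uses that the critical parameter is positive,
  which holds as otherwise the critical two-point function would vanish off the origin.
\<close>
lemma two_point_bounds:
  fixes L :: int
  assumes d: "CARD('d::finite) > 2" and L: "L \<ge> 1"
    and asymp: "\<exists>A>0. (\<lambda>x :: int ^ 'd. tau L (p_crit TYPE('d) L) x)
            \<sim>[filtercomap l2_norm at_top] (\<lambda>x. A * bracket x powr (2 - real CARD('d)))"
  shows "0 < p_crit TYPE('d) L"
    and "\<exists>cl>0. \<exists>cu>0. \<forall>x :: int ^ 'd. cl * decay (CARD('d) - 2) x \<le> tau L (p_crit TYPE('d) L) x \<and>
      tau L (p_crit TYPE('d) L) x \<le> cu * decay (CARD('d) - 2) x"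
proof -
  let ?pc = "p_crit TYPE('d) L" and ?d = "CARD('d)"
  have pc: "?pc \<in> {0..1}" by (rule p_crit_in(1)[OF L])
  obtain A where A: "A > 0" and eq: "(\<lambda>x :: int ^ 'd. tau L ?pc x)
            \<sim>[filtercomap l2_norm at_top] (\<lambda>x. A * bracket x powr (2 - real ?d))"
    using asymp by blast
  let ?g = "\<lambda>x :: int ^ 'd. A * bracket x powr (2 - real ?d)"
  have bracket_pos: "0 < bracket x" for x :: "int ^ 'd" by (simp add: bracket_def)
  have g: "?g x = A / bracket x ^ (?d - 2)" for x :: "int ^ 'd"
  proof -
    have "2 - real ?d = - real (?d - 2)" using d by simp
    then have "bracket x powr (2 - real ?d) = bracket x powr - real (?d - 2)" by (simp only:)
    also have "\<dots> = inverse (bracket x ^ (?d - 2))"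
      by (simp only: powr_minus powr_realpow[OF bracket_pos])
    finally show ?thesis by (simp only: divide_inverse)
  qed
  have g_upper: "?g x \<le> A * decay (?d - 2) x" for x :: "int ^ 'd"
  proof -
    have "real (nrm x) ^ (?d - 2) \<le> bracket x ^ (?d - 2)" using bracket_bounds(1)[of x] by (intro power_mono) auto
    moreover have "0 < real (nrm x) ^ (?d - 2)" by simp
    ultimately have "A / bracket x ^ (?d - 2) \<le> A / real (nrm x) ^ (?d - 2)"
      using A bracket_pos[of x] by (intro divide_left_mono) auto
    then show ?thesis unfolding g by (simp add: decay_def)
  qed
  have g_lower: "A / real ?d ^ (?d - 2) * decay (?d - 2) x \<le> ?g x" for x :: "int ^ 'd"
  proof -
    have "bracket x ^ (?d - 2) \<le> (real ?d * real (nrm x)) ^ (?d - 2)"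
      using bracket_bounds(2)[of x] bracket_pos[of x] by (intro power_mono) auto
    then have "A / (real ?d * real (nrm x)) ^ (?d - 2) \<le> A / bracket x ^ (?d - 2)"
      using A bracket_pos[of x] d by (intro divide_left_mono) (auto intro!: mult_pos_pos zero_less_power)
    then show ?thesis unfolding g by (simp add: decay_def power_mult_distrib)
  qed
  have theta: "(\<lambda>x :: int ^ 'd. tau L ?pc x) \<in> \<Theta>[filtercomap l2_norm at_top](?g)"
    by (rule asymp_equiv_imp_bigtheta[OF eq])
  obtain c1 N1 where c1: "c1 > 0" "\<And>x :: int ^ 'd. l2_norm x \<ge> N1 \<Longrightarrow> norm (tau L ?pc x) \<le> c1 * norm (?g x)"
    using landau_o.bigE[OF bigthetaD1[OF theta]] unfolding eventually_filtercomap_at_top_linorder by metis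
  obtain c2 N2 where c2: "c2 > 0" "\<And>x :: int ^ 'd. l2_norm x \<ge> N2 \<Longrightarrow> norm (?g x) \<le> c2 * norm (tau L ?pc x)"
    using landau_o.bigE[OF bigthetaD1[OF bigtheta_sym[THEN iffD1, OF theta]]]
    unfolding eventually_filtercomap_at_top_linorder by metis
  define m where "m = nat \<lceil>max 1 (max N1 N2)\<rceil>"
  have m: "1 \<le> m" "max N1 N2 \<le> real m" unfolding m_def by linarith+
  have far: "N1 \<le> l2_norm x \<and> N2 \<le> l2_norm x" if "x \<notin> cube m" for x :: "int ^ 'd"
  proof -
    have "real m < real (nrm x)" using that m by (simp add: in_cube_iff_nrm)
    also have "\<dots> \<le> bracket x" by (rule bracket_bounds)
    finally have "real m < l2_norm x" using m by (auto simp: bracket_def)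
    then show ?thesis using m by auto
  qed
  have g_pos: "0 \<le> ?g x" for x using A by simp
  have far_upper: "tau L ?pc x \<le> c1 * A * decay (?d - 2) x" if x: "x \<notin> cube m" for x :: "int ^ 'd"
  proof -
    have "tau L ?pc x \<le> c1 * ?g x" using c1(2)[of x] far[OF x] g_pos[of x] by simp
    also have "\<dots> \<le> c1 * (A * decay (?d - 2) x)" using c1(1) by (intro mult_left_mono g_upper) simp
    finally show ?thesis by simp
  qed
  define a where "a = A / real ?d ^ (?d - 2) / c2"
  have a: "0 < a" using A c2 d by (simp add: a_def)
  have far_lower: "a * decay (?d - 2) x \<le> tau L ?pc x" if x: "x \<notin> cube m" for x :: "int ^ 'd"
  proof -
    have "A / real ?d ^ (?d - 2) * decay (?d - 2) x \<le> ?g x" by (rule g_lower)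
    also have "\<dots> \<le> c2 * tau L ?pc x" using c2(2)[of x] far[OF x] g_pos[of x] by simp
    finally show ?thesis using c2(1) by (simp add: a_def field_simps)
  qed
  show pc_pos: "0 < ?pc"
  proof (rule ccontr)
    assume "\<not> 0 < ?pc"
    then have zero: "?pc = 0" using pc by simp
    define x :: "int ^ 'd" where "x = (\<chi> i. int m + 1)"
    have "x \<notin> cube m" by (auto simp: x_def in_cube_iff)
    then have "0 < tau L ?pc x" using far_lower[of x] a by (smt (verit) decay_pos mult_pos_pos)
    moreover have "x \<noteq> 0" using \<open>x \<notin> cube m\<close> by auto
    ultimately show False using tau_at_0[of x L] unfolding zero by simp
  qed
  define b where "b = Min (tau L ?pc ` (cube m :: (int ^ 'd) set))"
  have "(cube m :: (int ^ 'd) set) \<noteq> {}" using zero_in_cube[of m] by blast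
  then have b: "0 < b" unfolding b_def
    using tau_pos[OF L pc_pos] pc by (subst Min_gr_iff) auto
  have near_lower: "b * decay (?d - 2) x \<le> tau L ?pc x" if "x \<in> cube m" for x :: "int ^ 'd"
  proof -
    have "b * decay (?d - 2) x \<le> b * 1"
      using b by (intro mult_left_mono) (auto simp: decay_def intro!: one_le_power)
    also have "b \<le> tau L ?pc x" unfolding b_def using that by (intro Min_le) auto
    finally show ?thesis by simp
  qed
  have near_upper: "tau L ?pc x \<le> real m ^ (?d - 2) * decay (?d - 2) x" if "x \<in> cube m" for x :: "int ^ 'd"
  proof -
    have "real (nrm x) ^ (?d - 2) \<le> real m ^ (?d - 2)"
      using that m by (intro power_mono) (auto simp: in_cube_iff_nrm)
    moreover have "0 < real (nrm x) ^ (?d - 2)" by simp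
    ultimately have "1 \<le> real m ^ (?d - 2) * decay (?d - 2) x" by (simp add: decay_def)
    then show ?thesis using tau_le_1[of L ?pc x] by simp
  qed
  have "min a b * decay (?d - 2) x \<le> tau L ?pc x" for x :: "int ^ 'd"
  proof -
    have "min a b * decay (?d - 2) x \<le> a * decay (?d - 2) x" "min a b * decay (?d - 2) x \<le> b * decay (?d - 2) x"
      by (intro mult_right_mono; simp add: less_imp_le)+
    then show ?thesis using far_lower[of x] near_lower[of x] by (cases "x \<in> cube m") (meson order_trans)+
  qed
  moreover have "tau L ?pc x \<le> max (c1 * A) (real m ^ (?d - 2)) * decay (?d - 2) x" for x :: "int ^ 'd"
  proof -
    have "c1 * A * decay (?d - 2) x \<le> max (c1 * A) (real m ^ (?d - 2)) * decay (?d - 2) x"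
      "real m ^ (?d - 2) * decay (?d - 2) x \<le> max (c1 * A) (real m ^ (?d - 2)) * decay (?d - 2) x"
      by (intro mult_right_mono; simp add: less_imp_le)+
    then show ?thesis using far_upper[of x] near_upper[of x] by (cases "x \<in> cube m") (meson order_trans)+
  qed
  moreover have "0 < min a b" "0 < max (c1 * A) (real m ^ (?d - 2))" using a b c1(1) A by (simp_all add: less_max_iff_disj)
  ultimately show "\<exists>cl>0. \<exists>cu>0. \<forall>x :: int ^ 'd. cl * decay (?d - 2) x \<le> tau L ?pc x \<and>
      tau L ?pc x \<le> cu * decay (?d - 2) x"
    by blast
qed

lemma shell_sum_7: "shell_sum 7 n = real n"
proof -
  have "shell_sum 7 n = (\<Sum>k=1..n. 1)"
    unfolding shell_sum_def by (intro sum.cong) auto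
  then show ?thesis by simp
qed

lemma shell_sum_8: "shell_sum 8 n = harm n"
  unfolding shell_sum_def harm_def
proof (intro sum.cong refl)
  fix k assume "k \<in> {1..n}"
  then show "real k ^ (8 - 1) * (1 / real k ^ (2 * (8 - 4))) = inverse (real k)"
    by (simp add: field_simps flip: power_Suc)
qed

lemma harm_le_ln: "1 \<le> n \<Longrightarrow> harm n \<le> 1 + ln (real n)"
proof (induction n rule: dec_induct)
  case (step n)
  have n: "0 < real n" using step by simp
  have "ln (real n / real (Suc n)) \<le> real n / real (Suc n) - 1"
    using n by (intro ln_le_minus_one) auto
  also have "\<dots> = - inverse (real (Suc n))" by (simp add: field_simps)
  finally have "inverse (real (Suc n)) \<le> ln (real (Suc n)) - ln (real n)"
    using n by (simp add: ln_div)
  then show ?case using step by (simp add: harm_Suc)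
qed (simp add: harm_def)

lemma shell_sum_ge_9:
  assumes "9 \<le> d" "1 \<le> n"
  shows "shell_sum d n \<le> 2" "1 \<le> shell_sum d n"
proof -
  have eq: "real k ^ (d - 1) * (1 / real k ^ (2 * (d - 4))) = 1 / real k ^ (d - 7)" if "1 \<le> k" for k
  proof -
    have "2 * (d - 4) = (d - 1) + (d - 7)" using assms by simp
    then show ?thesis using that by (simp add: power_add)
  qed
  have "shell_sum d n = (\<Sum>k=1..n. 1 / real k ^ (d - 7))"
    unfolding shell_sum_def by (intro sum.cong refl eq) auto
  also have "\<dots> = 1 + (\<Sum>k=Suc 1..n. 1 / real k ^ (d - 7))"
    using assms(2) by (subst sum.atLeast_Suc_atMost) auto
  finally have head: "shell_sum d n = 1 + (\<Sum>k=Suc 1..n. 1 / real k ^ (d - 7))" .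
  have "(\<Sum>k=Suc 1..n. 1 / real k ^ (d - 7)) \<le> (\<Sum>k=Suc 1..n. 1 / real k ^ 2)"
    using assms by (intro sum_mono divide_left_mono power_increasing) auto
  also have "\<dots> \<le> 1" using sum_inverse_squares[of 1 n] by simp
  finally show "shell_sum d n \<le> 2" unfolding head by simp
  show "1 \<le> shell_sum d n" unfolding head by (simp add: sum_nonneg)
qed

theorem proposition1p3:
  fixes L :: int
  assumes "CARD('d::finite) > 6"
    and "L \<ge> 1"
    and "\<exists>A>0. (\<lambda>x :: int ^ 'd. tau L (p_crit TYPE('d) L) x)
            \<sim>[filtercomap l2_norm at_top] (\<lambda>x. A * bracket x powr (2 - real CARD('d)))"
  shows "(\<lambda>p. enn2real (square_diagram TYPE('d) L p))
            \<in> \<Theta>[at_left (p_crit TYPE('d) L)](\<lambda>p. psi CARD('d) (enn2real (chi TYPE('d) L p)))"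
proof -
  let ?d = "CARD('d)"
  let ?S = "susc TYPE('d) L"
  let ?Q = "\<lambda>p. enn2real (square_diagram TYPE('d) L p)"
  define pc where "pc = p_crit TYPE('d) L"
  have "2 < ?d" using assms(1) by simp
  note bounds = two_point_bounds[OF this assms(2,3), folded pc_def]
  have pc_pos: "0 < pc" by (rule bounds(1))
  obtain cl cu where cl: "0 < cl" and cu: "0 < cu"
    and lower: "\<And>x :: int ^ 'd. cl * decay (?d - 2) x \<le> tau L pc x"
    and upper: "\<And>x :: int ^ 'd. tau L pc x \<le> cu * decay (?d - 2) x"
    using bounds(2) by blast
  note setting = assms(2,1) cl cu lower upper pc_pos pc_def
  obtain C where C: "C > 0" "\<And>p n. 0 \<le> p \<Longrightarrow> p < pc \<Longrightarrow> 1 \<le> n \<Longrightarrow> square_diagram TYPE('d) L p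
    \<le> ennreal (C * (shell_sum ?d n + (?S p)\<^sup>2 / real n ^ (?d - 4)))"
    using square_upper[OF setting] by blast
  obtain c \<kappa> where c: "c > 0" and \<kappa>: "\<kappa> > 0" and low: "\<And>p n. 0 \<le> p \<Longrightarrow> p < pc \<Longrightarrow> 1 \<le> n \<Longrightarrow>
    (pc - p) * real (2 * n) ^ 2 \<le> \<kappa> \<Longrightarrow>
    ennreal (c * shell_sum ?d n) \<le> square_diagram TYPE('d) L p \<and> c * real n \<le> ?S p"
    using square_lower[OF setting] by blast
  obtain K where K: "K > 0" "\<And>p. pc / 2 \<le> p \<Longrightarrow> p < pc \<Longrightarrow> (pc - p) * ?S p \<le> K"
    using susc_gap_bound[OF setting] by blast
  define \<eta> where "\<eta> = sqrt (\<kappa> / (4 * K))"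
  have \<eta>: "0 < \<eta>" using \<kappa> K by (simp add: \<eta>_def)
  (* T is the size of the logarithm of the susceptibility that dimension 8 requires, and R the radius
     of validity of the lower bound that guarantees it. *)
  define T where "T = max 1 (- 4 * ln \<eta>)"
  define R where "R = max 1 (2 * exp T / c)"
  have R: "1 \<le> R" "2 * exp T / c \<le> R" by (auto simp: R_def)
  define b where "b = max (pc / 2) (pc - \<kappa> / (4 * R\<^sup>2))"
  have b: "b < pc" using pc_pos \<kappa> R by (auto simp: b_def)
  have sandwich: "min (c * \<eta> / 2) (c / 4) * norm (psi ?d (enn2real (chi TYPE('d) L p))) \<le> norm (?Q p)
      \<and> norm (?Q p) \<le> 4 * C * norm (psi ?d (enn2real (chi TYPE('d) L p)))"
    if p: "b < p" "p < pc" for p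
  proof -
    define S where "S = ?S p"
    have p0: "0 \<le> p" "pc / 2 \<le> p" using p pc_pos by (auto simp: b_def)
    have S1: "1 \<le> S" unfolding S_def using p0 p by (intro susc_ge_1[OF assms(2)]) (auto simp: pc_def)
    have chi: "enn2real (chi TYPE('d) L p) = S"
      using chi_eq_susc[OF assms(2), of p, where 'd = 'd] p p0 S1 by (simp add: pc_def S_def)
    define r where "r = sqrt S"
    have r: "1 \<le> r" "r ^ 2 = S" using S1 by (auto simp: r_def)

    (* The cutoff in square_upper is taken at the square root of the susceptibility. *)
    define n where "n = nat \<lceil>r\<rceil>"
    have n: "1 \<le> n" "r \<le> real n" "real n \<le> 2 * r" using r unfolding n_def by linarith+
    have finite_square: "square_diagram TYPE('d) L p < \<infinity>"
      using C(2)[OF p0(1) p(2) n(1)] by (auto intro: le_less_trans)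
    have Q_upper: "?Q p \<le> C * (shell_sum ?d n + S\<^sup>2 / real n ^ (?d - 4))"
      using C(2)[OF p0(1) p(2) n(1)] C(1)
      by (intro enn2real_leI) (auto simp: S_def shell_sum_nonneg intro!: mult_nonneg_nonneg add_nonneg_nonneg)
    have tail: "S\<^sup>2 / real n ^ (?d - 4) \<le> r ^ 4 / r ^ (?d - 4)"
    proof -
      have "S\<^sup>2 = r ^ 4" unfolding r(2)[symmetric] by (simp add: eval_nat_numeral)
      moreover have "r ^ (?d - 4) \<le> real n ^ (?d - 4)" using n r by (intro power_mono) auto
      ultimately show ?thesis using r n by (auto intro!: divide_left_mono)
    qed

    (* This is the largest radius to which square_lower applies. The mean-field bound makes it at
       least a multiple of r. *)
    define \<rho> where "\<rho> = sqrt (\<kappa> / (pc - p)) / 2"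
    have gap: "0 < pc - p" "pc - p \<le> \<kappa> / (4 * R\<^sup>2)" using p by (auto simp: b_def)
    have "2 * \<rho> = sqrt (\<kappa> / (pc - p))" by (simp add: \<rho>_def)
    then have "(2 * \<rho>)\<^sup>2 = \<kappa> / (pc - p)"
      using gap(1) \<kappa> by (simp only:) (rule real_sqrt_pow2, simp)
    then have \<rho>_sq: "4 * \<rho>\<^sup>2 = \<kappa> / (pc - p)" by (simp add: power_mult_distrib)
    then have \<rho>2: "4 * \<rho>\<^sup>2 * (pc - p) = \<kappa>" using gap(1) by (metis less_irrefl nonzero_eq_divide_eq)
    have "(pc - p) * (4 * R\<^sup>2) \<le> \<kappa>" using gap(2) R by (simp add: field_simps)
    then have "R\<^sup>2 \<le> \<kappa> / (pc - p) / 4" using gap(1) by (simp add: field_simps)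
    also have "\<dots> = \<rho>\<^sup>2" unfolding \<rho>_sq[symmetric] by simp
    finally have "R\<^sup>2 \<le> \<rho>\<^sup>2" .
    moreover have "0 \<le> \<rho>" using gap(1) \<kappa> by (simp add: \<rho>_def)
    ultimately have "R \<le> \<rho>" by (rule power2_le_imp_le)
    define m where "m = nat \<lfloor>\<rho>\<rfloor>"
    have "1 \<le> \<rho>" using \<open>R \<le> \<rho>\<close> R(1) by simp
    then have m: "1 \<le> m" "real m \<le> \<rho>" "\<rho> \<le> real m + 1"
      unfolding m_def by linarith+
    then have m2: "\<rho> \<le> 2 * real m" by linarith
    have "(pc - p) * real (2 * m) ^ 2 \<le> (pc - p) * (2 * \<rho>) ^ 2"
      using gap m by (intro mult_left_mono power_mono) auto
    also have "\<dots> = \<kappa>" using \<rho>2 by (simp add: power_mult_distrib mult_ac)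
    finally have low': "ennreal (c * shell_sum ?d m) \<le> square_diagram TYPE('d) L p" "c * real m \<le> S"
      using low[OF p0(1) p(2) m(1)] by (auto simp: S_def)
    have Q_lower: "c * shell_sum ?d m \<le> ?Q p"
      using enn2real_mono[OF low'(1)] finite_square c shell_sum_nonneg[of ?d m] by simp
    have \<rho>_ge: "\<eta> * r \<le> \<rho>"
    proof -
      have "(pc - p) * S \<le> K" using K(2)[OF p0(2) p(2)] by (simp add: S_def)
      then have "S \<le> K / (pc - p)" using gap(1) by (simp add: pos_le_divide_eq mult.commute)
      then have "\<kappa> / (4 * K) * S \<le> \<kappa> / (4 * K) * (K / (pc - p))"
        using K(1) \<kappa> by (intro mult_left_mono) auto
      also have "\<dots> = \<kappa> / (pc - p) / 4" using K(1) by simp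
      finally have "\<kappa> / (4 * K) * S \<le> \<kappa> / (pc - p) / 4" .
      moreover have "(\<eta> * r)\<^sup>2 = \<kappa> / (4 * K) * S"
        using K(1) \<kappa> by (simp add: \<eta>_def power_mult_distrib r(2))
      moreover have "\<kappa> / (pc - p) / 4 = \<rho>\<^sup>2" unfolding \<rho>_sq[symmetric] by simp
      ultimately have "(\<eta> * r)\<^sup>2 \<le> \<rho>\<^sup>2" by simp
      then show ?thesis by (rule power2_le_imp_le) (use \<open>1 \<le> \<rho>\<close> in simp)
    qed
    have "2 * exp T / c \<le> \<rho>" using R(2) \<open>R \<le> \<rho>\<close> by simp
    then have "exp T \<le> c * \<rho> / 2" using c by (simp add: pos_divide_le_eq mult.commute)
    also have "\<dots> \<le> c * real m" using m2 c by simp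
    also have "\<dots> \<le> S" by (rule low'(2))
    finally have "T \<le> ln S" using S1 by (simp add: ln_ge_iff)
    then have lnS: "1 \<le> ln S" "- 4 * ln \<eta> \<le> ln S" by (auto simp: T_def)
    have two_sided: "min (c * \<eta> / 2) (c / 4) * norm (psi ?d (enn2real (chi TYPE('d) L p))) \<le> norm (?Q p)
        \<and> norm (?Q p) \<le> 4 * C * norm (psi ?d (enn2real (chi TYPE('d) L p)))"
      if "psi ?d S = y" "0 \<le> y" "min (c * \<eta> / 2) (c / 4) * y \<le> ?Q p" "?Q p \<le> 4 * C * y" for y
      using that by (simp add: chi)

    consider (seven) "?d = 7" | (eight) "?d = 8" | (nine) "9 \<le> ?d" using assms(1) by linarith
    then show ?thesis
    proof cases
      case seven
      have psi: "psi ?d S = r" by (simp add: psi_def seven r_def powr_half_sqrt S1 order_trans[OF _ S1])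
      have "r ^ 4 / r ^ (?d - 4) = r" using r(1) by (simp add: seven eval_nat_numeral)
      then have "C * (shell_sum ?d n + S\<^sup>2 / real n ^ (?d - 4)) \<le> C * (4 * r)"
        using tail n r(1) C(1) by (intro mult_left_mono) (auto simp: seven shell_sum_7)
      moreover have "c * \<eta> / 2 * r \<le> c * shell_sum ?d m"
        using \<rho>_ge m2 c by (simp add: seven shell_sum_7)
      moreover have "min (c * \<eta> / 2) (c / 4) * r \<le> c * \<eta> / 2 * r" using r(1) by (intro mult_right_mono) auto
      ultimately have "min (c * \<eta> / 2) (c / 4) * r \<le> ?Q p" "?Q p \<le> 4 * C * r"
        using Q_upper Q_lower by linarith+
      with psi show ?thesis using r(1) by (intro two_sided) auto
    next
      case eight
      have psi: "psi ?d S = ln S" by (simp add: psi_def eight)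
      have lnr: "ln S = 2 * ln r" unfolding r(2)[symmetric] using r(1) by (simp add: ln_realpow)
      have "harm n \<le> 1 + ln (real n)" by (rule harm_le_ln[OF n(1)])
      also have "ln (real n) \<le> ln (2 * r)" using n by simp
      also have "ln (2 * r) \<le> 1 + ln r" using r(1) ln_2_less_1 by (simp add: ln_mult)
      finally have "harm n \<le> 2 + ln S / 2" using lnr by simp
      moreover have "r ^ 4 / r ^ (?d - 4) = 1" using r(1) by (simp add: eight)
      ultimately have "C * (shell_sum ?d n + S\<^sup>2 / real n ^ (?d - 4)) \<le> C * (4 * ln S)"
        using tail lnS C(1) by (intro mult_left_mono) (auto simp: eight shell_sum_8)
      moreover have "c / 4 * ln S \<le> c * shell_sum ?d m"
      proof -
        have "ln \<eta> + ln r = ln (\<eta> * r)" using \<eta> r(1) by (simp add: ln_mult)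
        also have "\<dots> \<le> ln (real m + 1)" using \<rho>_ge m(3) \<eta> r(1) by (intro ln_mono) auto
        also have "\<dots> \<le> harm m" by (rule ln_le_harm)
        finally have "ln S / 4 \<le> harm m" using lnS lnr by linarith
        then show ?thesis using c by (simp add: eight shell_sum_8)
      qed
      moreover have "min (c * \<eta> / 2) (c / 4) * ln S \<le> c / 4 * ln S" using lnS by (intro mult_right_mono) auto
      ultimately have "min (c * \<eta> / 2) (c / 4) * ln S \<le> ?Q p" "?Q p \<le> 4 * C * ln S"
        using Q_upper Q_lower by linarith+
      with psi show ?thesis using lnS by (intro two_sided) auto
    next
      case nine
      have psi: "psi ?d S = 1" using nine by (simp add: psi_def)
      have "r ^ 4 \<le> r ^ (?d - 4)" using r(1) nine by (intro power_increasing) auto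
      then have "r ^ 4 / r ^ (?d - 4) \<le> 1" using r(1) by simp
      then have "C * (shell_sum ?d n + S\<^sup>2 / real n ^ (?d - 4)) \<le> C * 4"
        using tail shell_sum_ge_9(1)[OF nine n(1)] C(1) by (intro mult_left_mono) auto
      moreover have "c * 1 \<le> c * shell_sum ?d m"
        using shell_sum_ge_9(2)[OF nine m(1)] c by (intro mult_left_mono) auto
      moreover have "min (c * \<eta> / 2) (c / 4) \<le> c" using c by auto
      ultimately have "min (c * \<eta> / 2) (c / 4) * 1 \<le> ?Q p" "?Q p \<le> 4 * C * 1"
        using Q_upper Q_lower by linarith+
      with psi show ?thesis  by (intro two_sided) auto
    qed
  qed
  show ?thesis unfolding pc_def[symmetric]
  proof (rule bigthetaI')
    show "0 < min (c * \<eta> / 2) (c / 4)" using c \<eta> by simp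
    show "0 < 4 * C" using C(1) by simp
    show "\<forall>\<^sub>F p in at_left pc. min (c * \<eta> / 2) (c / 4) * norm (psi ?d (enn2real (chi TYPE('d) L p))) \<le> norm (?Q p)
      \<and> norm (?Q p) \<le> 4 * C * norm (psi ?d (enn2real (chi TYPE('d) L p)))"
      unfolding eventually_at_left_field using b sandwich by blast
  qed
qed

end
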